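(* Let $f$ be of either ignition type or general KPP type. There exist constants $C_1,C_2>0$, depending only on $f$, such that the following holds. Let $U_0,H,\kappa,v_0>0$ satisfy $U_0H/\kappa\ge1$ and $l/H\le1$, $l=\kappa/v_0$, let $$u(x,y)=U_0\left(\sin\frac xH\cos\frac yH,\ -\cos\frac xH\sin\frac yH\right)\quad\text{on }\mathbb R\times[0,\pi H],$$ and let $c$ be the speed of a traveling wave-type solution $T(x,y,t)=U(x-ct,x,y)$, with $U(s,x,y)$ periodic in the last two variables, of $$T_t+u\cdot\nabla T=\kappa\Delta T+\frac{v_0^2}\kappa f(T).$$ Set $\tau_c=\kappa/v_0^2$, $\tau_u=H/U_0$. Then $$c\ge\begin{cases}\left(C_1\sqrt{\dfrac{\tau_c}{\tau_u}}+C_2\right)v_0,&\tau_c\le\tau_u,\\[2mm]\left(C_1\left(\dfrac{\tau_c}{\tau_u}\right)^{1/5}+C_2\right)v_0,&\tau_c\ge\tau_u.\end{cases}$$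
   Context: The nonlinearity $f\in C^1[0,1]$ satisfies $f(0)=f(1)=0$, $f\ge0$ on $(0,1)$, $f\not\equiv0$. General KPP type: $f>0$ on $(0,1)$. Ignition type: for some $\theta_0\in(0,1)$, $f=0$ on $[0,\theta_0]$ and at $1$, $f>0$ on $(\theta_0,1)$. A traveling wave-type solution $U(s,x,y)$ takes values in $[0,1]$, is periodic in $x$ with the period $2\pi H$ of $u$, satisfies Neumann ($T_y=0$ at $y=0,\pi H$) or periodic (period $\pi H$, the strip width) boundary conditions in $y$ (periodicity in $y$ is understood through these), and $U\to1$ as $s\to-\infty$, $U\to0$ as $s\to+\infty$; it is known that such fronts are monotonically decreasing in $s$. *)

theory Defs
  imports "HOL-Analysis.Analysis"
begin

definition C1_on :: "real set \<Rightarrow> (real \<Rightarrow> real) \<Rightarrow> bool" where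
  "C1_on S f \<longleftrightarrow>
     (\<exists>f'. continuous_on S f' \<and> (\<forall>z\<in>S. (f has_real_derivative f' z) (at z within S)))"

definition admissible_nonlinearity :: "(real \<Rightarrow> real) \<Rightarrow> bool" where
  "admissible_nonlinearity f \<longleftrightarrow>
     C1_on {0..1} f \<and> f 0 = 0 \<and> f 1 = 0 \<and> (\<forall>z\<in>{0<..<1}. f z \<ge> 0) \<and> (\<exists>z\<in>{0<..<1}. f z \<noteq> 0)"

definition general_KPP_type :: "(real \<Rightarrow> real) \<Rightarrow> bool" where
  "general_KPP_type f \<longleftrightarrow> admissible_nonlinearity f \<and> (\<forall>z\<in>{0<..<1}. f z > 0)"

definition ignition_type :: "(real \<Rightarrow> real) \<Rightarrow> bool" where
  "ignition_type f \<longleftrightarrow> admissible_nonlinearity f \<and>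
     (\<exists>\<theta>\<^sub>0\<in>{0<..<1}. (\<forall>z\<in>{0..\<theta>\<^sub>0}. f z = 0) \<and> (\<forall>z\<in>{\<theta>\<^sub>0<..<1}. f z > 0))"

definition cellular_flow :: "real \<Rightarrow> real \<Rightarrow> real \<Rightarrow> real \<Rightarrow> real \<times> real" where
  "cellular_flow U\<^sub>0 H x y =
     U\<^sub>0 *\<^sub>R (sin (x / H) * cos (y / H), - (cos (x / H) * sin (y / H)))"

text \<open>
  Classical solutions \<open>T x y t\<close> of \<open>T\<^sub>t + u \<cdot> \<nabla>T = \<kappa> \<Delta>T + g(T)\<close> on the strip \<open>\<real> \<times> [0, L]\<close>, for all
  times \<open>t \<in> \<real>\<close>: \<open>T\<close>, \<open>T\<^sub>x\<close>, \<open>T\<^sub>y\<close> are continuous up to the boundary of the strip (with one-sided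
  \<open>y\<close>-derivatives there), and \<open>T\<^sub>t\<close>, \<open>T\<^sub>x\<^sub>x\<close>, \<open>T\<^sub>y\<^sub>y\<close> are continuous in the interior, where the equation
  holds. All continuity is joint in the three variables.
\<close>

definition classical_solution ::
    "real \<Rightarrow> (real \<Rightarrow> real \<Rightarrow> real \<times> real) \<Rightarrow> real \<Rightarrow> (real \<Rightarrow> real)
     \<Rightarrow> (real \<Rightarrow> real \<Rightarrow> real \<Rightarrow> real) \<Rightarrow> bool" where
  "classical_solution L u \<kappa> g T \<longleftrightarrow>
     (\<exists>Tt Tx Ty Txx Tyy.
        (\<forall>F\<in>{T, Tx, Ty}. continuous_on (UNIV \<times> {0..L} \<times> UNIV) (\<lambda>(x, y, t). F x y t)) \<and>
        (\<forall>F\<in>{Tt, Txx, Tyy}. continuous_on (UNIV \<times> {0<..<L} \<times> UNIV) (\<lambda>(x, y, t). F x y t)) \<and>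
        (\<forall>x t. \<forall>y\<in>{0..L}.
           ((\<lambda>x. T x y t) has_real_derivative Tx x y t) (at x) \<and>
           ((\<lambda>y. T x y t) has_real_derivative Ty x y t) (at y within {0..L})) \<and>
        (\<forall>x t. \<forall>y\<in>{0<..<L}.
           ((\<lambda>t. T x y t) has_real_derivative Tt x y t) (at t) \<and>
           ((\<lambda>x. Tx x y t) has_real_derivative Txx x y t) (at x) \<and>
           ((\<lambda>y. Ty x y t) has_real_derivative Tyy x y t) (at y) \<and>
           Tt x y t + u x y \<bullet> (Tx x y t, Ty x y t) = \<kappa> * (Txx x y t + Tyy x y t) + g (T x y t)))"

definition neumann_bc :: "real \<Rightarrow> (real \<Rightarrow> real \<Rightarrow> real \<Rightarrow> real) \<Rightarrow> bool" where
  "neumann_bc L T \<longleftrightarrow>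
     (\<forall>x t. \<forall>y\<in>{0, L}. ((\<lambda>y. T x y t) has_real_derivative 0) (at y within {0..L}))"

text \<open>
  Periodic boundary conditions match the values and the \<open>y\<close>-derivatives at \<open>y = 0\<close> and \<open>y = L\<close>.
  Second derivatives are not matched: for the cellular flow with \<open>L = \<pi>H\<close> the first component of \<open>u\<close>
  has opposite signs on the two boundary lines.
\<close>

definition periodic_bc :: "real \<Rightarrow> (real \<Rightarrow> real \<Rightarrow> real \<Rightarrow> real) \<Rightarrow> bool" where
  "periodic_bc L T \<longleftrightarrow>
     (\<forall>x t. T x 0 t = T x L t \<and>
        (\<exists>d. ((\<lambda>y. T x y t) has_real_derivative d) (at 0 within {0..L}) \<and>
             ((\<lambda>y. T x y t) has_real_derivative d) (at L within {0..L})))"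

text \<open>
  \<open>traveling_wave f U\<^sub>0 H \<kappa> v\<^sub>0 c U\<close>: \<open>U(s, x, y)\<close> is the profile of a traveling wave-type solution
  \<open>T(x, y, t) = U(x - c t, x, y)\<close> with speed \<open>c\<close>. Neither the sign of \<open>c\<close> nor the monotonicity of \<open>U\<close>
  in \<open>s\<close> is assumed, and the limits in \<open>s\<close> are pointwise in \<open>(x, y)\<close>.
\<close>

definition traveling_wave ::
    "(real \<Rightarrow> real) \<Rightarrow> real \<Rightarrow> real \<Rightarrow> real \<Rightarrow> real \<Rightarrow> real
     \<Rightarrow> (real \<Rightarrow> real \<Rightarrow> real \<Rightarrow> real) \<Rightarrow> bool" where
  "traveling_wave f U\<^sub>0 H \<kappa> v\<^sub>0 c U \<longleftrightarrow>
     (\<forall>x. \<forall>y\<in>{0..pi * H}.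
        (\<forall>s. U s x y \<in> {0..1} \<and> U s (x + 2 * pi * H) y = U s x y) \<and>
        ((\<lambda>s. U s x y) \<longlongrightarrow> 1) at_bot \<and> ((\<lambda>s. U s x y) \<longlongrightarrow> 0) at_top) \<and>
     (let T = (\<lambda>x y t. U (x - c * t) x y) in
        classical_solution (pi * H) (cellular_flow U\<^sub>0 H) \<kappa> (\<lambda>z. v\<^sub>0\<^sup>2 / \<kappa> * f z) T \<and>
        (neumann_bc (pi * H) T \<or> periodic_bc (pi * H) T))"

end

theory Submission
  imports Defs
begin

text \<open>
  In the moving frame the front is periodic in time. Testing its equation with \<open>1\<close> and with the solution
  itself shows that, per period \<open>P\<close>, the total reaction equals \<open>c L P\<close> (\<open>L = \<pi> H\<close>) and the total dissipation
  is at most half of it. Let \<open>G\<close> increase from \<open>G 0 = 0\<close> to \<open>G 1 = 1\<close> with \<open>G'\<^sup>2 \<le> K f\<close>; then integrals of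
  \<open>\<bar>\<nabla>G(T)\<bar>\<close> and of \<open>G'(T)\<^sup>2\<close> are controlled by \<open>c\<close> as well. Since \<open>G(T)\<close> drops by one along the strip, \<open>c \<ge> C v\<^sub>0\<close>.

  For the enhancement, let \<open>E = exp (-(sin X sin Y / d)\<^sup>2)\<close>, where \<open>X = x / H\<close>, \<open>Y = y / H\<close>. The divergence-free
  field with stream function \<open>-(U\<^sub>0 H d\<^sup>2 / 2) cos Y E\<close> has flux \<open>U\<^sub>0 H d\<^sup>2\<close> through every cross-section and splits as
  \<open>\<Phi> u + b e\<^sub>1\<close>: a part along the flow, in stream tubes near the cell boundaries, where the equation itself
  bounds the contribution of \<open>G(T)\<close> by a multiple of \<open>\<kappa> c / v\<^sub>0\<close>, and \<open>b = (U\<^sub>0 d\<^sup>2 / 2) sin Y E\<close>, carried by layers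
  of width \<open>d H\<close> around the vertical separatrices. For \<open>d\<^sup>2\<close> of order \<open>\<kappa> c / (v\<^sub>0 U\<^sub>0 H)\<close> at least half of the drop of
  \<open>G(T)\<close> takes place in these layers. By Cauchy-Schwarz this costs a large gradient unless much of the
  reaction zone lies inside them, while the zone cannot be thinner than about \<open>\<kappa> / v\<^sub>0\<close>. This gives
  \<open>(c / v\<^sub>0)\<^sup>5 \<ge> C \<tau>\<^sub>c / \<tau>\<^sub>u\<close>.
\<close>

section \<open>Flux integrals on a space-time box\<close>

text \<open>The profile is known to have its limits only pointwise, without rate and without any
  gradient bound, and second derivatives exist only inside the strip. Every identity is therefore
  tested with a cutoff in \<open>x\<close> whose radius is a whole number of cells, arranged so that
  derivatives of the cutoff meet only bounded functions of the solution; averages over many cells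
  replace limits at infinity, and the integration in \<open>y\<close> comes last. The step
  \<open>G\<close> is used because \<open>f\<close> may vanish or degenerate near the end values:
  only intermediate temperatures are certain to burn. Origin of the exponent: put \<gamma> = c / v0,
  \<rho> = \<tau>c / \<tau>u and l = \<kappa> / v0. The choice of \<open>d\<close> makes (d H / l)^2
  a multiple of \<gamma> / \<rho>. If the layers are thinner than \<open>l\<close>, the estimates
  end in 1 <= C \<gamma> (d H / l)^(1/2), whose fourth power is \<rho> <= C \<gamma>^5; wider layers
  give \<rho> <= C \<gamma> at once. In the regime \<rho> <= 1 the enhancement factor is at most
  one, so c >= C v0 already contains the claim.\<close>

lemma integral_box3_y_first:
  fixes S :: "real \<times> real \<times> real \<Rightarrow> real"
  assumes S: "continuous_on (cbox (a, 0, 0) (b, L, P)) S"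
  shows "integral (cbox (a, 0, 0) (b, L, P)) S =
         integral {0..L} (\<lambda>y. integral (cbox (a, 0) (b, P)) (\<lambda>q. S (fst q, y, snd q)))"
proof -
  note cs = continuous_on_compose2[OF S]
  have c1: "continuous_on (cbox (0, 0) (L, P)) (\<lambda>q. S (x, q))" if "x \<in> {a..b}" for x
    by (rule cs) (use that in \<open>auto simp: cbox_Pair_eq intro!: continuous_intros\<close>)
  have c2: "continuous_on (cbox (a, 0) (b, P)) (\<lambda>q. S (fst q, y, snd q))" if "y \<in> {0..L}" for y
    by (rule cs) (use that in \<open>auto simp: cbox_Pair_eq intro!: continuous_intros\<close>)
  have c3: "continuous_on (cbox (a, 0) (b, L)) (\<lambda>(x, y). integral (cbox 0 P) (\<lambda>t. S (x, y, t)))"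
  proof -
    have "continuous_on (cbox (a, 0) (b, L)) (\<lambda>r. integral (cbox 0 P) (\<lambda>t. S (fst r, snd r, t)))"
      unfolding case_prod_unfold
      by (rule integral_continuous_on_param)
        (auto simp: cbox_Pair_eq case_prod_unfold intro!: cs continuous_intros)
    then show ?thesis by (simp add: case_prod_unfold)
  qed
  have "integral (cbox (a, 0, 0) (b, L, P)) S
      = integral (cbox a b) (\<lambda>x. integral (cbox (0, 0) (L, P)) (\<lambda>q. S (x, q)))"
    using integral_prod_continuous[of a "(0, 0)" b "(L, P)" S] S by simp
  also have "\<dots> = integral (cbox a b) (\<lambda>x. integral (cbox 0 L) (\<lambda>y. integral (cbox 0 P) (\<lambda>t. S (x, y, t))))"
  proof (rule integral_cong)
    fix x assume "x \<in> cbox a b"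
    then show "integral (cbox (0, 0) (L, P)) (\<lambda>q. S (x, q))
        = integral (cbox 0 L) (\<lambda>y. integral (cbox 0 P) (\<lambda>t. S (x, y, t)))"
      using integral_prod_continuous[of 0 0 L P "\<lambda>q. S (x, q)"] c1[of x] by simp
  qed
  also have "\<dots> = integral (cbox 0 L) (\<lambda>y. integral (cbox a b) (\<lambda>x. integral (cbox 0 P) (\<lambda>t. S (x, y, t))))"
    by (rule integral_swap_continuous[OF c3])
  also have "\<dots> = integral (cbox 0 L) (\<lambda>y. integral (cbox (a, 0) (b, P)) (\<lambda>q. S (fst q, y, snd q)))"
  proof (rule integral_cong)
    fix y assume "y \<in> cbox 0 L"
    then show "integral (cbox a b) (\<lambda>x. integral (cbox 0 P) (\<lambda>t. S (x, y, t)))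
        = integral (cbox (a, 0) (b, P)) (\<lambda>q. S (fst q, y, snd q))"
      using integral_prod_continuous[of a 0 b P "\<lambda>q. S (fst q, y, snd q)"] c2[of y] by simp
  qed
  finally show ?thesis by simp
qed

text \<open>The divergence theorem for a field that is differentiable only for
  \<open>0 < y < L\<close>. The integral \<open>N y\<close> of the vertical flux over
  \<open>x\<close> and \<open>t\<close> is continuous up to the walls, and inside its derivative is
  the slice integral of \<open>S\<close>, since the two other derivatives integrate to zero over
  each slice. The single derivatives may blow up at the walls; only their sum \<open>S\<close> and
  the flux \<open>F2\<close> extend continuously.\<close>

lemma box_flux_zero:
  fixes F0 F1 F2 F0t F1x F2y S :: "real \<times> real \<times> real \<Rightarrow> real"
  assumes ab: "a \<le> b" and L: "0 < L" and P: "0 \<le> P"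
    and S: "continuous_on ({a..b} \<times> {0..L} \<times> {0..P}) S"
    and F2: "continuous_on ({a..b} \<times> {0..L} \<times> {0..P}) F2"
    and F0t: "continuous_on ({a..b} \<times> {0<..<L} \<times> {0..P}) F0t"
    and F1x: "continuous_on ({a..b} \<times> {0<..<L} \<times> {0..P}) F1x"
    and F2y: "continuous_on ({a..b} \<times> {0<..<L} \<times> {0..P}) F2y"
    and d0: "\<And>x y t. x \<in> {a..b} \<Longrightarrow> y \<in> {0<..<L} \<Longrightarrow> t \<in> {0..P} \<Longrightarrow>
        ((\<lambda>t. F0 (x, y, t)) has_real_derivative F0t (x, y, t)) (at t)"
    and d1: "\<And>x y t. x \<in> {a..b} \<Longrightarrow> y \<in> {0<..<L} \<Longrightarrow> t \<in> {0..P} \<Longrightarrow>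
        ((\<lambda>x. F1 (x, y, t)) has_real_derivative F1x (x, y, t)) (at x)"
    and d2: "\<And>x y t. x \<in> {a..b} \<Longrightarrow> y \<in> {0<..<L} \<Longrightarrow> t \<in> {0..P} \<Longrightarrow>
        ((\<lambda>y. F2 (x, y, t)) has_real_derivative F2y (x, y, t)) (at y)"
    and eq: "\<And>x y t. x \<in> {a..b} \<Longrightarrow> y \<in> {0<..<L} \<Longrightarrow> t \<in> {0..P} \<Longrightarrow>
        F0t (x, y, t) + F1x (x, y, t) + F2y (x, y, t) = S (x, y, t)"
    and b0: "\<And>x y. x \<in> {a..b} \<Longrightarrow> y \<in> {0<..<L} \<Longrightarrow> F0 (x, y, P) = F0 (x, y, 0)"
    and b1: "\<And>y t. y \<in> {0<..<L} \<Longrightarrow> t \<in> {0..P} \<Longrightarrow> F1 (b, y, t) = F1 (a, y, t)"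
    and b2: "\<And>x t. x \<in> {a..b} \<Longrightarrow> t \<in> {0..P} \<Longrightarrow> F2 (x, L, t) = F2 (x, 0, t)"
  shows "integral (cbox (a, 0, 0) (b, L, P)) S = 0"
proof -
  let ?Q = "cbox (a, 0) (b, P)"
  define N where "N = (\<lambda>y. integral ?Q (\<lambda>q. F2 (fst q, y, snd q)))"
  define s where "s = (\<lambda>y. integral ?Q (\<lambda>q. S (fst q, y, snd q)))"
  have cont_slice: "continuous_on ?Q (\<lambda>q. F (fst q, y, snd q))"
    if "continuous_on ({a..b} \<times> Y \<times> {0..P}) F" "y \<in> Y" for F :: "real \<times> real \<times> real \<Rightarrow> real" and Y y
    by (rule continuous_on_compose2[OF that(1)])
      (use that in \<open>auto simp: cbox_Pair_eq intro!: continuous_intros\<close>)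
  have int_slice: "(\<lambda>q. F (fst q, y, snd q)) integrable_on ?Q"
    if "continuous_on ({a..b} \<times> Y \<times> {0..P}) F" "y \<in> Y" for F :: "real \<times> real \<times> real \<Rightarrow> real" and Y y
    using cont_slice[OF that] by (rule integrable_continuous)
  have N: "continuous_on {0..L} N"
    unfolding N_def
    by (rule integral_continuous_on_param)
      (auto simp: cbox_Pair_eq case_prod_unfold intro!: continuous_on_compose2[OF F2] continuous_intros)
  have zero0: "integral ?Q (\<lambda>q. F0t (fst q, y, snd q)) = 0" if y: "y \<in> {0<..<L}" for y
  proof -
    have "integral ?Q (\<lambda>q. F0t (fst q, y, snd q)) = integral {a..b} (\<lambda>x. integral {0..P} (\<lambda>t. F0t (x, y, t)))"
      using integral_prod_continuous[OF cont_slice[OF F0t y]] by simp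
    also have "\<dots> = integral {a..b} (\<lambda>x. 0)"
    proof (rule integral_cong)
      fix x assume x: "x \<in> {a..b}"
      have "((\<lambda>t. F0t (x, y, t)) has_integral F0 (x, y, P) - F0 (x, y, 0)) {0..P}"
        by (rule fundamental_theorem_of_calculus[OF P])
          (use d0[OF x y] in \<open>auto simp: has_real_derivative_iff_has_vector_derivative[symmetric] intro: DERIV_subset\<close>)
      then show "integral {0..P} (\<lambda>t. F0t (x, y, t)) = 0"
        using b0[OF x y] by (simp add: integral_unique)
    qed
    finally show ?thesis by simp
  qed
  have zero1: "integral ?Q (\<lambda>q. F1x (fst q, y, snd q)) = 0" if y: "y \<in> {0<..<L}" for y
  proof -
    have "integral ?Q (\<lambda>q. F1x (fst q, y, snd q)) = integral {a..b} (\<lambda>x. integral {0..P} (\<lambda>t. F1x (x, y, t)))"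
      using integral_prod_continuous[OF cont_slice[OF F1x y]] by simp
    also have "\<dots> = integral {0..P} (\<lambda>t. integral {a..b} (\<lambda>x. F1x (x, y, t)))"
      using integral_swap_continuous[of a 0 b P "\<lambda>x t. F1x (x, y, t)"] cont_slice[OF F1x y]
      by (simp add: case_prod_unfold)
    also have "\<dots> = integral {0..P} (\<lambda>x. 0)"
    proof (rule integral_cong)
      fix t assume t: "t \<in> {0..P}"
      have "((\<lambda>x. F1x (x, y, t)) has_integral F1 (b, y, t) - F1 (a, y, t)) {a..b}"
        by (rule fundamental_theorem_of_calculus[OF ab])
          (use d1[OF _ y t] in \<open>auto simp: has_real_derivative_iff_has_vector_derivative[symmetric] intro: DERIV_subset\<close>)
      then show "integral {a..b} (\<lambda>x. F1x (x, y, t)) = 0"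
        using b1[OF y t] by (simp add: integral_unique)
    qed
    finally show ?thesis by simp
  qed
  have dN: "(N has_real_derivative s y) (at y)" if y: "y \<in> {0<..<L}" for y
  proof -
    have "(N has_real_derivative integral ?Q (\<lambda>q. F2y (fst q, y, snd q))) (at y within {0<..<L})"
      unfolding N_def
    proof (rule leibniz_rule_field_derivative[where fx = "\<lambda>y q. F2y (fst q, y, snd q)"])
      show "((\<lambda>x. F2 (fst t, x, snd t)) has_real_derivative F2y (fst t, x, snd t)) (at x within {0<..<L})"
        if "x \<in> {0<..<L}" "t \<in> ?Q" for x t
        using d2[of "fst t" x "snd t"] that by (auto simp: cbox_Pair_eq intro: DERIV_subset)
      show "(\<lambda>q. F2 (fst q, x, snd q)) integrable_on ?Q" if "x \<in> {0<..<L}" for x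
        using int_slice[OF F2] that by auto
      show "continuous_on ({0<..<L} \<times> ?Q) (\<lambda>(x, t). F2y (fst t, x, snd t))"
        by (auto simp: cbox_Pair_eq case_prod_unfold intro!: continuous_on_compose2[OF F2y] continuous_intros)
    qed (use y in auto)
    moreover have "integral ?Q (\<lambda>q. F2y (fst q, y, snd q)) = s y"
    proof -
      have "s y = integral ?Q (\<lambda>q. (F0t (fst q, y, snd q) + F1x (fst q, y, snd q)) + F2y (fst q, y, snd q))"
        unfolding s_def by (rule integral_cong) (use eq y in \<open>auto simp: cbox_Pair_eq\<close>)
      also have "\<dots> = integral ?Q (\<lambda>q. F0t (fst q, y, snd q) + F1x (fst q, y, snd q)) + integral ?Q (\<lambda>q. F2y (fst q, y, snd q))"
        using int_slice[OF F0t y] int_slice[OF F1x y] int_slice[OF F2y y]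
        by (intro integral_add integrable_add)
      also have "\<dots> = integral ?Q (\<lambda>q. F2y (fst q, y, snd q))"
        using int_slice[OF F0t y] int_slice[OF F1x y] by (simp add: integral_add zero0[OF y] zero1[OF y])
      finally show ?thesis by simp
    qed
    ultimately show ?thesis
      using y by (simp add: at_within_open[of y "{0<..<L}"])
  qed
  have "(s has_integral N L - N 0) {0..L}"
    by (rule fundamental_theorem_of_calculus_interior)
      (use L N dN in \<open>auto simp: has_real_derivative_iff_has_vector_derivative[symmetric]\<close>)
  moreover have "N L = N 0"
    unfolding N_def by (rule integral_cong) (auto simp: cbox_Pair_eq b2)
  ultimately have "integral {0..L} s = 0"
    by (simp add: integral_unique)
  moreover have "continuous_on (cbox (a, 0, 0) (b, L, P)) S"
    using S by (simp add: cbox_Pair_eq)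
  ultimately show ?thesis
    by (simp add: integral_box3_y_first s_def)
qed

section \<open>Averages over many period cells\<close>

lemma cesaro_zero:
  fixes a :: "nat \<Rightarrow> real"
  assumes "a \<longlonglongrightarrow> 0"
  shows "(\<lambda>n. (\<Sum>k<n. a k) / real n) \<longlonglongrightarrow> 0"
proof (rule LIMSEQ_I)
  fix e :: real assume e: "e > 0"
  then obtain N where N: "\<And>n. n \<ge> N \<Longrightarrow> \<bar>a n\<bar> < e / 2"
    using LIMSEQ_D[OF assms, of "e / 2"] by auto
  define C where "C = \<bar>\<Sum>k<N. a k\<bar>"
  obtain M :: nat where M: "real M > 2 * C / e" using reals_Archimedean2 by blast
  show "\<exists>n0. \<forall>n\<ge>n0. norm ((\<Sum>k<n. a k) / real n - 0) < e"
  proof (intro exI allI impI)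
    fix n assume n: "n \<ge> max (Suc N) (Suc M)"
    then have n0: "real n > 0" by simp
    have "(\<Sum>k<n. a k) = (\<Sum>k<N. a k) + (\<Sum>k=N..<n. a k)"
      using n by (subst sum.atLeastLessThan_concat[of 0 N n, symmetric, unfolded atLeast0LessThan]) auto
    then have "\<bar>\<Sum>k<n. a k\<bar> \<le> C + (\<Sum>k=N..<n. \<bar>a k\<bar>)"
      unfolding C_def using abs_triangle_ineq[of "\<Sum>k<N. a k" "\<Sum>k=N..<n. a k"] sum_abs[of a "{N..<n}"]
      by linarith
    also have "(\<Sum>k=N..<n. \<bar>a k\<bar>) \<le> (\<Sum>k=N..<n. e / 2)"
      by (rule sum_mono) (use N in \<open>auto intro: less_imp_le\<close>)
    also have "\<dots> \<le> real n * (e / 2)"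
      using e n by (simp add: mult_right_mono)
    finally have "\<bar>\<Sum>k<n. a k\<bar> \<le> C + real n * (e / 2)" by simp
    moreover have "C < real n * (e / 2)"
    proof -
      have "2 * C / e < real n" using M n by linarith
      then show ?thesis using e by (simp add: field_simps)
    qed
    ultimately have "\<bar>\<Sum>k<n. a k\<bar> < real n * e" by (simp add: field_simps)
    then show "norm ((\<Sum>k<n. a k) / real n - 0) < e"
      using n0 by (simp add: field_simps)
  qed
qed

text \<open>Splits a long interval into \<open>n\<close> cells. Convergence of the cell integrals is
  what dominated convergence delivers from limits along shifts by whole periods, and a Cesaro mean
  is all that a cutoff slope of size \<open>1 / n\<close> can see.\<close>

lemma integral_cells_mean_zero:
  fixes v :: "real \<Rightarrow> real"
  assumes v: "continuous_on UNIV v" and d: "d > 0"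
    and lim: "(\<lambda>k. integral {0..d} (\<lambda>x. v (x + real k * d))) \<longlonglongrightarrow> 0"
  shows "(\<lambda>n. integral {0..real n * d} v / real n) \<longlonglongrightarrow> 0"
proof -
  have vi: "v integrable_on {r..s}" for r s
    by (rule integrable_continuous_real) (rule continuous_on_subset[OF v], simp)
  have "integral {0..real n * d} v = (\<Sum>k<n. integral {0..d} (\<lambda>x. v (x + real k * d)))" for n
  proof (induction n)
    case (Suc n)
    have "integral {0..real (Suc n) * d} v = integral {0..real n * d} v + integral {real n * d..real (Suc n) * d} v"
      using d by (intro Henstock_Kurzweil_Integration.integral_combine[symmetric] vi) (auto simp: field_simps)
    moreover have "integral {real n * d..real (Suc n) * d} v = integral {0..d} (\<lambda>x. v (x + real n * d))"
      using integral_shift_real_ivl[of "real n * d" "real n * d" "real (Suc n) * d" v] 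
      by (simp add: algebra_simps)
    ultimately show ?case using Suc by simp
  qed simp
  then show ?thesis using cesaro_zero[OF lim] by simp
qed

section \<open>Cutoffs and averages over many cells\<close>

text \<open>A polynomial bump meant for \<open>[-R, R]\<close> only and hence not truncated: value
  and slope vanish at both ends, so every end flux drops out of the integrations by parts, and two
  derivatives are explicit.\<close>

definition cutoff :: "real \<Rightarrow> real \<Rightarrow> real" where
  "cutoff R x = (1 - (x / R)\<^sup>2)\<^sup>2"

definition cutoff' :: "real \<Rightarrow> real \<Rightarrow> real" where
  "cutoff' R x = - 4 * x / R\<^sup>2 * (1 - (x / R)\<^sup>2)"

definition cutoff'' :: "real \<Rightarrow> real \<Rightarrow> real" where
  "cutoff'' R x = (12 * (x / R)\<^sup>2 - 4) / R\<^sup>2"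

lemma cutoff_derivs:
  "(cutoff R has_real_derivative cutoff' R x) (at x)"
  "(cutoff' R has_real_derivative cutoff'' R x) (at x)"
proof -
  show "(cutoff R has_real_derivative cutoff' R x) (at x)"
    unfolding cutoff_def[abs_def] cutoff'_def
    by (cases "R = 0") (auto intro!: derivative_eq_intros simp: power2_eq_square)
  show "(cutoff' R has_real_derivative cutoff'' R x) (at x)"
    unfolding cutoff''_def cutoff'_def[abs_def]
    by (cases "R = 0") (auto intro!: derivative_eq_intros simp: field_simps power2_eq_square)
qed

lemma cutoff_continuous [continuous_intros]:
  assumes "continuous_on S g"
  shows "continuous_on S (\<lambda>x. cutoff R (g x))"
    and "continuous_on S (\<lambda>x. cutoff' R (g x))"
    and "continuous_on S (\<lambda>x. cutoff'' R (g x))"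
  using assms unfolding cutoff_def cutoff'_def cutoff''_def
  by (cases "R = 0"; auto intro!: continuous_intros)+

lemma cutoff_ends [simp]:
  assumes "R \<noteq> 0"
  shows "cutoff R R = 0" "cutoff R (- R) = 0" "cutoff' R R = 0" "cutoff' R (- R) = 0" "cutoff R 0 = 1"
  using assms by (auto simp: cutoff_def cutoff'_def)

lemma cutoff_bounds:
  assumes "R > 0" "\<bar>x\<bar> \<le> R"
  shows "0 \<le> cutoff R x" "cutoff R x \<le> 1" "\<bar>cutoff' R x\<bar> \<le> 4 / R" "\<bar>cutoff'' R x\<bar> \<le> 12 / R\<^sup>2"
proof -
  have r: "\<bar>x / R\<bar> \<le> 1" using assms by (simp add: field_simps)
  then have q: "0 \<le> (x / R)\<^sup>2" "(x / R)\<^sup>2 \<le> 1" by (auto simp: abs_square_le_1)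
  show "0 \<le> cutoff R x" "cutoff R x \<le> 1"
    using q by (auto simp: cutoff_def intro: power_le_one)
  have "\<bar>cutoff' R x\<bar> = 4 / R * (\<bar>x / R\<bar> * \<bar>1 - (x / R)\<^sup>2\<bar>)"
    using assms unfolding cutoff'_def by (simp add: abs_mult abs_divide power2_eq_square)
  also have "\<dots> \<le> 4 / R * (1 * 1)"
    using assms r q by (intro mult_left_mono mult_mono) auto
  finally show "\<bar>cutoff' R x\<bar> \<le> 4 / R" by simp
  have "\<bar>12 * (x / R)\<^sup>2 - 4\<bar> \<le> 12" using q by linarith
  then show "\<bar>cutoff'' R x\<bar> \<le> 12 / R\<^sup>2"
    using assms unfolding cutoff''_def abs_divide by (simp add: divide_right_mono)
qed

lemma cutoff'_minus [simp]: "cutoff' R (- x) = - cutoff' R x"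
  by (simp add: cutoff'_def)

text \<open>A weight of size \<open>1 / n\<close> on an interval of length \<open>n * d\<close> acts
  like an average, so an error that is small in mean is good enough.\<close>

lemma integral_weight_mean_zero:
  fixes v e :: "real \<Rightarrow> real" and w :: "nat \<Rightarrow> real \<Rightarrow> real"
  assumes d: "d > 0" and v: "continuous_on UNIV v" and e: "continuous_on UNIV e"
    and w: "\<And>n. continuous_on UNIV (w n)"
    and wb: "\<And>n x. n > 0 \<Longrightarrow> x \<in> {0..real n * d} \<Longrightarrow> \<bar>w n x\<bar> \<le> C / real n"
    and ev: "\<And>x. x \<ge> 0 \<Longrightarrow> \<bar>e x\<bar> \<le> v x"
    and lim: "(\<lambda>n. integral {0..real n * d} v / real n) \<longlonglongrightarrow> 0"
  shows "(\<lambda>n. integral {0..real n * d} (\<lambda>x. w n x * e x)) \<longlonglongrightarrow> 0"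
proof (rule Lim_null_comparison)
  show "(\<lambda>n. C * (integral {0..real n * d} v / real n)) \<longlonglongrightarrow> 0"
    using tendsto_mult_left[OF lim, of C] by simp
  show "\<forall>\<^sub>F n in sequentially. norm (integral {0..real n * d} (\<lambda>x. w n x * e x))
      \<le> C * (integral {0..real n * d} v / real n)"
    using eventually_gt_at_top[of 0]
  proof eventually_elim
    case (elim n)
    have *: "continuous_on {0..real n * d} g" if "continuous_on UNIV g" for g :: "real \<Rightarrow> real"
      using continuous_on_subset[OF that] by simp
    have "norm (integral {0..real n * d} (\<lambda>x. w n x * e x))
        \<le> integral {0..real n * d} (\<lambda>x. C / real n * v x)"
    proof (rule integral_norm_bound_integral)
      show "norm (w n x * e x) \<le> C / real n * v x" if "x \<in> {0..real n * d}" for x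
        unfolding real_norm_def abs_mult
        by (rule mult_mono[OF wb ev]) (use that elim wb[OF elim that] in auto)
    qed (use v e w elim in \<open>auto intro!: integrable_continuous_real continuous_intros *\<close>)
    then show ?case by simp
  qed
qed

text \<open>On \<open>[0, R]\<close> the slope of the cutoff is minus a probability density. It
  picks out the limiting flux \<open>J\<close> even if \<open>j\<close> approaches \<open>J\<close>
  only in mean.\<close>

lemma cutoff_flux_limit_right:
  assumes d: "d > 0" and j: "continuous_on UNIV j" and v: "continuous_on UNIV v"
    and jv: "\<And>x. x \<ge> 0 \<Longrightarrow> \<bar>j x - J\<bar> \<le> v x"
    and lim: "(\<lambda>n. integral {0..real n * d} v / real n) \<longlonglongrightarrow> 0"
  shows "(\<lambda>n. integral {0..real n * d} (\<lambda>x. cutoff' (real n * d) x * j x)) \<longlonglongrightarrow> - J"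
proof -
  let ?w = "\<lambda>n. cutoff' (real n * d)"
  have 1: "(\<lambda>n. integral {0..real n * d} (\<lambda>x. ?w n x * (j x - J))) \<longlonglongrightarrow> 0"
  proof (rule integral_weight_mean_zero[where v = v and C = "4 / d"])
    show "\<bar>?w n x\<bar> \<le> 4 / d / real n" if "n > 0" "x \<in> {0..real n * d}" for n x
      using cutoff_bounds(3)[of "real n * d" x] that d by (simp add: field_simps)
  qed (use assms in \<open>auto intro!: continuous_intros\<close>)
  have 2: "\<forall>\<^sub>F n in sequentially. integral {0..real n * d} (\<lambda>x. ?w n x * (j x - J)) - J
      = integral {0..real n * d} (\<lambda>x. ?w n x * j x)"
    using eventually_gt_at_top[of 0]
  proof eventually_elim
    case (elim n)
    have *: "continuous_on {0..real n * d} g" if "continuous_on UNIV g" for g :: "real \<Rightarrow> real"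
      using continuous_on_subset[OF that] by simp
    have "(?w n has_integral cutoff (real n * d) (real n * d) - cutoff (real n * d) 0) {0..real n * d}"
      by (rule fundamental_theorem_of_calculus)
        (use d in \<open>auto simp: has_real_derivative_iff_has_vector_derivative[symmetric]
           intro: cutoff_derivs DERIV_subset\<close>)
    then have w: "(?w n has_integral - 1) {0..real n * d}"
      using elim d by simp
    have "integral {0..real n * d} (\<lambda>x. ?w n x * j x)
        = integral {0..real n * d} (\<lambda>x. ?w n x * (j x - J) + ?w n x * J)"
      by (simp add: algebra_simps)
    also have "\<dots> = integral {0..real n * d} (\<lambda>x. ?w n x * (j x - J)) + integral {0..real n * d} (\<lambda>x. ?w n x * J)"
      using j by (intro integral_add) (auto intro!: integrable_continuous_real continuous_intros *)
    also have "integral {0..real n * d} (\<lambda>x. ?w n x * J) = - J"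
      using integral_unique[OF has_integral_mult_left[OF w, of J]] by simp
    finally show ?case by simp
  qed
  have "(\<lambda>n. integral {0..real n * d} (\<lambda>x. ?w n x * (j x - J)) - J) \<longlonglongrightarrow> 0 - J"
    by (intro tendsto_intros 1)
  then show ?thesis
    using 2 by (simp add: tendsto_cong)
qed

lemma integral_symmetric_split:
  fixes g :: "real \<Rightarrow> real"
  assumes "continuous_on UNIV g" "R \<ge> 0"
  shows "integral {- R..R} g = integral {0..R} g + integral {0..R} (\<lambda>x. g (- x))"
proof -
  have "integral {- R..R} g = integral {- R..0} g + integral {0..R} g"
    using assms by (intro Henstock_Kurzweil_Integration.integral_combine[symmetric]
        integrable_continuous_real continuous_on_subset[OF assms(1)]) auto
  moreover have "integral {0..R} (\<lambda>x. g (- x)) = integral {- R..0} g"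
    using Henstock_Kurzweil_Integration.integral_reflect_real[of 0 "-R" g] by simp
  ultimately show ?thesis by simp
qed

text \<open>The slope of the cutoff is odd, so the left half counts with the opposite sign: what
  remains is the limiting flux at the left end minus the one at the right end.\<close>

lemma cutoff_flux_limit:
  assumes d: "d > 0" and j: "continuous_on UNIV j"
    and v: "continuous_on UNIV v" and w: "continuous_on UNIV w"
    and jv: "\<And>x. x \<ge> 0 \<Longrightarrow> \<bar>j x - J0\<bar> \<le> v x" and jw: "\<And>x. x \<ge> 0 \<Longrightarrow> \<bar>j (- x) - J1\<bar> \<le> w x"
    and limv: "(\<lambda>n. integral {0..real n * d} v / real n) \<longlonglongrightarrow> 0"
    and limw: "(\<lambda>n. integral {0..real n * d} w / real n) \<longlonglongrightarrow> 0"
  shows "(\<lambda>n. integral {- (real n * d)..real n * d} (\<lambda>x. cutoff' (real n * d) x * j x)) \<longlonglongrightarrow> J1 - J0"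
proof -
  have 1: "(\<lambda>n. integral {0..real n * d} (\<lambda>x. cutoff' (real n * d) x * j x)) \<longlonglongrightarrow> - J0"
    by (rule cutoff_flux_limit_right[OF d j v jv limv])
  have j': "continuous_on UNIV (\<lambda>x. j (- x))"
    by (rule continuous_on_compose2[OF j]) (auto intro!: continuous_intros)
  have 2: "(\<lambda>n. integral {0..real n * d} (\<lambda>x. cutoff' (real n * d) x * j (- x))) \<longlonglongrightarrow> - J1"
    by (rule cutoff_flux_limit_right[OF d j' w jw limw])
  have "integral {- (real n * d)..real n * d} (\<lambda>x. cutoff' (real n * d) x * j x)
     = integral {0..real n * d} (\<lambda>x. cutoff' (real n * d) x * j x)
       - integral {0..real n * d} (\<lambda>x. cutoff' (real n * d) x * j (- x))" for n
    using d j by (subst integral_symmetric_split) (auto intro!: continuous_intros)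
  moreover have "(\<lambda>n. integral {0..real n * d} (\<lambda>x. cutoff' (real n * d) x * j x)
       - integral {0..real n * d} (\<lambda>x. cutoff' (real n * d) x * j (- x))) \<longlonglongrightarrow> - J0 - (- J1)"
    by (intro tendsto_diff 1 2)
  ultimately show ?thesis by simp
qed

text \<open>With the modulus of the slope nothing cancels, so both limiting values have to be zero.
  This serves for boundary terms with \<open>(G' (V p))\<^sup>2\<close>, which fades at both ends of
  the front.\<close>

lemma cutoff_abs_flux_limit:
  assumes d: "d > 0" and j: "continuous_on UNIV j"
    and v: "continuous_on UNIV v" and w: "continuous_on UNIV w"
    and jv: "\<And>x. x \<ge> 0 \<Longrightarrow> \<bar>j x\<bar> \<le> v x" and jw: "\<And>x. x \<ge> 0 \<Longrightarrow> \<bar>j (- x)\<bar> \<le> w x"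
    and limv: "(\<lambda>n. integral {0..real n * d} v / real n) \<longlonglongrightarrow> 0"
    and limw: "(\<lambda>n. integral {0..real n * d} w / real n) \<longlonglongrightarrow> 0"
  shows "(\<lambda>n. integral {- (real n * d)..real n * d} (\<lambda>x. \<bar>cutoff' (real n * d) x\<bar> * j x)) \<longlonglongrightarrow> 0"
proof -
  have b: "\<bar>\<bar>cutoff' (real n * d) x\<bar>\<bar> \<le> 4 / d / real n" if "n > 0" "x \<in> {0..real n * d}" for n x
    using cutoff_bounds(3)[of "real n * d" x] that d by (simp add: field_simps)
  have j': "continuous_on UNIV (\<lambda>x. j (- x))"
    by (rule continuous_on_compose2[OF j]) (auto intro!: continuous_intros)
  have 1: "(\<lambda>n. integral {0..real n * d} (\<lambda>x. \<bar>cutoff' (real n * d) x\<bar> * j x)) \<longlonglongrightarrow> 0"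
    by (rule integral_weight_mean_zero[OF d v j _ b jv limv]) (auto intro!: continuous_intros)
  have 2: "(\<lambda>n. integral {0..real n * d} (\<lambda>x. \<bar>cutoff' (real n * d) x\<bar> * j (- x))) \<longlonglongrightarrow> 0"
    by (rule integral_weight_mean_zero[OF d w j' _ b jw limw]) (auto intro!: continuous_intros)
  have "integral {- (real n * d)..real n * d} (\<lambda>x. \<bar>cutoff' (real n * d) x\<bar> * j x)
     = integral {0..real n * d} (\<lambda>x. \<bar>cutoff' (real n * d) x\<bar> * j x)
       + integral {0..real n * d} (\<lambda>x. \<bar>cutoff' (real n * d) x\<bar> * j (- x))" for n
    using d j by (subst integral_symmetric_split) (auto intro!: continuous_intros)
  then show ?thesis using tendsto_add[OF 1 2] by simp
qed

section \<open>A smooth step subordinate to the reaction\<close>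

text \<open>\<open>G'\<close> is the normalised square of the positive part of a parabola over
  \<open>[a, b]\<close>; squaring removes the kinks, so \<open>G\<close> has a continuous second
  derivative. The support is a place where \<open>f\<close> has a positive minimum, which gives the
  bound by \<open>f\<close>; its distance from \<open>0\<close> and from \<open>1\<close> gives the
  last two bounds.\<close>

lemma smooth_step_for_reaction:
  fixes f :: "real \<Rightarrow> real"
  assumes f: "continuous_on {0..1} f" and nn: "\<And>z. z \<in> {0..1} \<Longrightarrow> f z \<ge> 0"
    and ab: "0 < a" "a < b" "b < 1" and pos: "\<And>z. z \<in> {a..b} \<Longrightarrow> f z > 0"
  obtains G G' G'' :: "real \<Rightarrow> real" and K where
    "K \<ge> 1" "continuous_on UNIV G'" "continuous_on UNIV G''"
    "\<And>z. z \<in> {0..1} \<Longrightarrow> (G has_real_derivative G' z) (at z)"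
    "\<And>z. (G' has_real_derivative G'' z) (at z)"
    "\<And>z. z \<in> {0..1} \<Longrightarrow> (G' z)\<^sup>2 \<le> K * f z"
    "\<And>z. z \<in> {0..1} \<Longrightarrow> \<bar>G' z\<bar> \<le> K" "\<And>z. z \<in> {0..1} \<Longrightarrow> \<bar>G'' z\<bar> \<le> K"
    "\<And>z. z \<in> {0..1} \<Longrightarrow> \<bar>G z\<bar> \<le> K * z" "\<And>z. z \<in> {0..1} \<Longrightarrow> \<bar>G z - 1\<bar> \<le> K * (1 - z)"
    "\<And>z. z \<in> {0..1} \<Longrightarrow> (G' z)\<^sup>2 \<le> K * z" "\<And>z. z \<in> {0..1} \<Longrightarrow> (G' z)\<^sup>2 \<le> K * (1 - z)"
proof -
  define p where "p = (\<lambda>z. max 0 ((z - a) * (b - z)))"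
  have p_cont: "continuous_on S p" for S
    unfolding p_def by (intro continuous_intros)
  have p_nn: "p z \<ge> 0" for z by (simp add: p_def)
  have p_zero: "p z = 0" if "z \<notin> {a..b}" for z
  proof -
    have "(z - a) * (b - z) \<le> 0"
      using that ab by (cases "z < a") (auto simp: mult_le_0_iff)
    then show ?thesis by (simp add: p_def)
  qed
  have m: "((\<lambda>u::real. (max 0 u)\<^sup>2) has_real_derivative 2 * max 0 u) (at u)" for u :: real
  proof -
    consider "u > 0" | "u < 0" | "u = 0" by linarith
    then show ?thesis
    proof cases
      case 1
      have "((\<lambda>u::real. u\<^sup>2) has_real_derivative 2 * max 0 u) (at u)"
        using 1 by (auto intro!: derivative_eq_intros)
      then show ?thesis
        by (rule has_field_derivative_transform_within_open[of _ _ _ "{0<..}"]) (use 1 in auto)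
    next
      case 2
      have "((\<lambda>u::real. 0) has_real_derivative 2 * max 0 u) (at u)"
        using 2 by auto
      then show ?thesis
        by (rule has_field_derivative_transform_within_open[of _ _ _ "{..<0}"]) (use 2 in auto)
    next
      case 3
      have "((\<lambda>h::real. (max 0 h)\<^sup>2 / h) \<longlongrightarrow> 0) (at 0)"
      proof (rule Lim_null_comparison)
        show "\<forall>\<^sub>F h::real in at 0. norm ((max 0 h)\<^sup>2 / h) \<le> \<bar>h\<bar>"
          by (rule always_eventually) (auto simp: max_def power2_eq_square)
        show "((\<lambda>h::real. \<bar>h\<bar>) \<longlongrightarrow> 0) (at 0)"
          by (intro tendsto_rabs_zero tendsto_ident_at)
      qed
      then show ?thesis using 3 by (simp add: DERIV_def)
    qed
  qed
  have dp: "((\<lambda>z. (p z)\<^sup>2) has_real_derivative 2 * p z * (a + b - 2 * z)) (at z)" for z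
  proof -
    have "((\<lambda>z. (z - a) * (b - z)) has_real_derivative a + b - 2 * z) (at z)"
      by (auto intro!: derivative_eq_intros)
    from DERIV_chain2[OF m this] show ?thesis by (simp add: p_def)
  qed
  define I where "I = integral {0..1} (\<lambda>z. (p z)\<^sup>2)"
  have I: "I > 0"
  proof -
    have "I \<ge> 0" unfolding I_def by (rule integral_nonneg) (auto intro!: integrable_continuous_real continuous_intros p_cont)
    moreover have "I \<noteq> 0"
    proof
      assume "I = 0"
      then have "((\<lambda>z. (p z)\<^sup>2) has_integral 0) (cbox 0 1)"
        unfolding I_def by (metis box_real(2) integrable_continuous_real integrable_integral p_cont continuous_on_power)
      then have "(p ((a + b) / 2))\<^sup>2 = 0"
        by (rule has_integral_0_cbox_imp_0[rotated 2])
          (use ab in \<open>auto intro!: continuous_intros p_cont\<close>)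
      moreover have "p ((a + b) / 2) = ((b - a) / 2)\<^sup>2"
      proof -
        have "(a + b) / 2 - a = (b - a) / 2" "b - (a + b) / 2 = (b - a) / 2"
          by (simp_all add: field_simps)
        then show ?thesis unfolding p_def by (simp only: power2_eq_square) auto
      qed
      ultimately show False using ab by simp
    qed
    ultimately show ?thesis by simp
  qed
  define G' where "G' = (\<lambda>z. (p z)\<^sup>2 / I)"
  define G'' where "G'' = (\<lambda>z. 2 * p z * (a + b - 2 * z) / I)"
  \<comment> \<open>The lower limit \<open>-1\<close> makes every point of \<open>[0, 1]\<close>
    interior to the range of integration, hence a two-sided derivative also at \<open>0\<close>. The
    value \<open>G 0 = 0\<close> is not disturbed, since \<open>G'\<close> vanishes below
    \<open>a\<close>.\<close>
  define G where "G = (\<lambda>z. integral {-1..z} G')"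
  have G'c: "continuous_on S G'" for S
    unfolding G'_def using I by (intro continuous_intros p_cont) auto
  have G''c: "continuous_on S G''" for S
    unfolding G''_def using I by (intro continuous_intros p_cont) auto
  have dG: "(G has_real_derivative G' z) (at z)" if "z \<in> {0..1}" for z
  proof -
    have "(G has_real_derivative G' z) (at z within {-1..2})"
      unfolding G_def by (rule integral_has_real_derivative) (use that G'c in auto)
    moreover have "at z within {-1..2::real} = at z"
      by (rule at_within_interior) (use that in auto)
    ultimately show ?thesis by simp
  qed
  have dG': "(G' has_real_derivative G'' z) (at z)" for z
    unfolding G'_def G''_def using DERIV_cdivide[OF dp] by simp
  have bdd: "\<exists>B. \<forall>z\<in>{0..1}. \<bar>g z\<bar> \<le> B" if "continuous_on {0..1} g" for g :: "real \<Rightarrow> real"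
    using compact_imp_bounded[OF compact_continuous_image[OF that compact_Icc]]
    by (auto simp: bounded_iff)
  obtain B1 where B1: "\<And>z. z \<in> {0..1} \<Longrightarrow> \<bar>G' z\<bar> \<le> B1" using bdd[OF G'c] by blast
  obtain B2 where B2: "\<And>z. z \<in> {0..1} \<Longrightarrow> \<bar>G'' z\<bar> \<le> B2" using bdd[OF G''c] by blast
  have "continuous_on {a..b} f" using f by (rule continuous_on_subset) (use ab in auto)
  then obtain z0 where z0: "z0 \<in> {a..b}" "\<And>z. z \<in> {a..b} \<Longrightarrow> f z0 \<le> f z"
    using continuous_attains_inf[of "{a..b}" f] ab by auto
  have mpos: "f z0 > 0" using pos z0 by auto
  \<comment> \<open>\<open>B1\<close> and \<open>B2\<close> bound \<open>G'\<close> and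
    \<open>G''\<close>. The three quotients turn the bound by \<open>B1\<^sup>2\<close> into bounds
    by \<open>f z\<close>, \<open>z\<close> and \<open>1 - z\<close>, which on the support are at
    least \<open>f z0\<close>, \<open>a\<close> and \<open>1 - b\<close>.\<close>
  define K where "K = Max {1, B1, B2, B1\<^sup>2 / f z0, B1\<^sup>2 / a, B1\<^sup>2 / (1 - b)}"
  have K: "K \<ge> 1" "K \<ge> B1" "K \<ge> B2" "K \<ge> B1\<^sup>2 / f z0" "K \<ge> B1\<^sup>2 / a" "K \<ge> B1\<^sup>2 / (1 - b)"
    unfolding K_def by (rule Max_ge; simp)+
  have G'out: "G' z = 0" if "z \<notin> {a..b}" for z
    using p_zero[OF that] by (simp add: G'_def)
  have sq: "(G' z)\<^sup>2 \<le> B1\<^sup>2" if "z \<in> {0..1}" for z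
    using B1[OF that] abs_le_square_iff[of "G' z" B1] by linarith
  have G'i: "G' integrable_on {r..s}" for r s by (intro integrable_continuous_real G'c)
  have G'nn: "G' z \<ge> 0" for z using I by (simp add: G'_def)
  have Gdiff: "G z - G y = integral {y..z} G'" if "-1 \<le> y" "y \<le> z" for y z
    unfolding G_def using Henstock_Kurzweil_Integration.integral_combine[of "-1" y z G'] that G'i by auto
  have Gle: "0 \<le> integral {y..z} G' \<and> integral {y..z} G' \<le> K * (z - y)" if "0 \<le> y" "y \<le> z" "z \<le> 1" for y z
  proof
    show "0 \<le> integral {y..z} G'" by (rule integral_nonneg) (auto intro: G'i G'nn)
    have "integral {y..z} G' \<le> integral {y..z} (\<lambda>_. K)"
      by (rule integral_le) (use that in \<open>auto intro!: G'i order_trans[OF abs_ge_self order_trans[OF B1 K(2)]]\<close>)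
    then show "integral {y..z} G' \<le> K * (z - y)" using that by (simp add: mult.commute)
  qed
  have G0: "G 0 = 0"
  proof -
    have "G 0 = integral {-1..0::real} (\<lambda>_. 0)"
      unfolding G_def by (rule integral_cong) (use ab in \<open>auto intro: G'out\<close>)
    then show ?thesis by simp
  qed
  have G1: "G 1 = 1"
  proof -
    have "integral {0..1} G' = 1" unfolding G'_def using I by (simp add: I_def)
    then show ?thesis using Gdiff[of 0 1] G0 by simp
  qed
  show thesis
  proof (rule that[of K G' G'' G])
    fix z :: real assume z: "z \<in> {0..1}"
    show "\<bar>G z\<bar> \<le> K * z" using Gdiff[of 0 z] Gle[of 0 z] G0 z by auto
    show "\<bar>G z - 1\<bar> \<le> K * (1 - z)" using Gdiff[of z 1] Gle[of z 1] G1 z by auto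
    show "\<bar>G' z\<bar> \<le> K" "\<bar>G'' z\<bar> \<le> K" using B1[OF z] B2[OF z] K by auto
    show "(G has_real_derivative G' z) (at z)" by (rule dG[OF z])
    have "(G' z)\<^sup>2 \<le> K * f z \<and> (G' z)\<^sup>2 \<le> K * z \<and> (G' z)\<^sup>2 \<le> K * (1 - z)"
    proof (cases "z \<in> {a..b}")
      case True
      have *: "(G' z)\<^sup>2 \<le> K * r" if "r0 > 0" "B1\<^sup>2 / r0 \<le> K" "r0 \<le> r" for r0 r :: real
      proof -
        have "B1\<^sup>2 \<le> K * r0" using that by (simp add: field_simps)
        also have "\<dots> \<le> K * r" using K that by (intro mult_left_mono) auto
        finally show ?thesis using sq[OF z] by simp
      qed
      have "(G' z)\<^sup>2 \<le> K * f z" by (rule *[OF mpos K(4)]) (use z0 True in auto)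
      moreover have "(G' z)\<^sup>2 \<le> K * z" by (rule *[of a]) (use True ab K in auto)
      moreover have "(G' z)\<^sup>2 \<le> K * (1 - z)" by (rule *[of "1 - b"]) (use True ab K in auto)
      ultimately show ?thesis by blast
    next
      case False
      then show ?thesis using G'out z nn[OF z] K by auto
    qed
    then show "(G' z)\<^sup>2 \<le> K * f z" "(G' z)\<^sup>2 \<le> K * z" "(G' z)\<^sup>2 \<le> K * (1 - z)" by auto
  qed (use K G'c G''c dG' in auto)
qed

section \<open>Stream tubes and separatrix layers\<close>

text \<open>Both come from \<open>exp (z\<^sup>2) \<ge> 1 + z\<^sup>2\<close>. With
  \<open>z = sin X sin Y / d\<close> the first makes the weight of the stream tubes of size
  \<open>d\<close>, and the second bounds its gradient uniformly in \<open>d\<close>.\<close>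

lemma exp_square_bounds:
  fixes z :: real
  shows "\<bar>z\<bar> * exp (- z\<^sup>2) \<le> 1" "\<bar>1 - 2 * z\<^sup>2\<bar> * exp (- z\<^sup>2) \<le> 2"
proof -
  have e: "exp (- z\<^sup>2) * (1 + z\<^sup>2) \<le> 1"
  proof -
    have "exp (- z\<^sup>2) * (1 + z\<^sup>2) \<le> exp (- z\<^sup>2) * exp (z\<^sup>2)"
      by (intro mult_left_mono exp_ge_add_one_self) auto
    then show ?thesis by (simp add: exp_minus)
  qed
  have "\<bar>z\<bar> \<le> 1 + z\<^sup>2"
    using zero_le_power2[of "\<bar>z\<bar> - 1/2"] by (simp add: power2_eq_square algebra_simps)
  then have "\<bar>z\<bar> * exp (- z\<^sup>2) \<le> (1 + z\<^sup>2) * exp (- z\<^sup>2)" by (intro mult_right_mono) auto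
  with e show "\<bar>z\<bar> * exp (- z\<^sup>2) \<le> 1" by (simp only: mult.commute)
  have "\<bar>1 - 2 * z\<^sup>2\<bar> \<le> 2 * (1 + z\<^sup>2)" using zero_le_power2[of z] by (simp add: abs_le_iff)
  then have "\<bar>1 - 2 * z\<^sup>2\<bar> * exp (- z\<^sup>2) \<le> 2 * (1 + z\<^sup>2) * exp (- z\<^sup>2)" by (intro mult_right_mono) auto
  with e show "\<bar>1 - 2 * z\<^sup>2\<bar> * exp (- z\<^sup>2) \<le> 2" by (simp only: mult.commute mult.left_commute mult.assoc)
qed

lemma abs_mult_le_one:
  fixes a b :: real
  assumes "\<bar>a\<bar> \<le> 1" "\<bar>b\<bar> \<le> B"
  shows "\<bar>a * b\<bar> \<le> B"
  using mult_mono[OF assms] assms by (simp add: abs_mult)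

lemma integral_odd_reflection:
  fixes h :: "real \<Rightarrow> real"
  assumes "continuous_on {0..L} h" "\<And>y. h (L - y) = - h y"
  shows "integral {0..L} h = 0"
proof -
  have "integral {0..L} h = integral {-L..0} (\<lambda>y. h (- y))"
    using Henstock_Kurzweil_Integration.integral_reflect_real[of L 0 h] by simp
  also have "\<dots> = integral {0..L} (\<lambda>y. h (L - y))"
    using integral_shift_real_ivl[of "-L" "- L" 0 "\<lambda>y. h (- y)"] by simp
  also have "\<dots> = - integral {0..L} h" using assms(2) by simp
  finally show ?thesis by simp
qed

text \<open>\<open>sin (x / H) * sin (y / H)\<close> is the stream function of the flow up to the
  factor \<open>U0 * H\<close>. Hence this function is constant along streamlines, and for small
  \<open>d\<close> it is not small only on streamlines next to the cell boundaries.\<close>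

definition cell_layer :: "real \<Rightarrow> real \<Rightarrow> real \<Rightarrow> real \<Rightarrow> real" where
  "cell_layer H d x y = exp (- (sin (x / H) * sin (y / H) / d)\<^sup>2)"

definition layer_flux :: "real \<Rightarrow> real \<Rightarrow> real \<Rightarrow> real \<Rightarrow> real" where
  "layer_flux H d x y = sin (y / H) * cell_layer H d x y"

definition layer_flux_x :: "real \<Rightarrow> real \<Rightarrow> real \<Rightarrow> real \<Rightarrow> real" where
  "layer_flux_x H d x y = - 2 * sin (x / H) * cos (x / H) * sin (y / H) ^ 3 / (d\<^sup>2 * H) * cell_layer H d x y"

text \<open>The weight \<Phi> along the flow. The factor \<open>cos (y / H)\<close> is inherited
  from the stream function of the test field: that function takes opposite values at the two walls,
  which is the source of the net flux, while the weight itself is odd about the middle line of the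
  strip.\<close>

definition tube :: "real \<Rightarrow> real \<Rightarrow> real \<Rightarrow> real \<Rightarrow> real" where
  "tube H d x y = cos (y / H) * (sin (x / H) * sin (y / H)) * cell_layer H d x y"

text \<open>With \<open>z = sin X sin Y / d\<close> this is the derivative of
  \<open>z * exp (- z\<^sup>2)\<close>.\<close>

definition layer_slope :: "real \<Rightarrow> real \<Rightarrow> real \<Rightarrow> real \<Rightarrow> real" where
  "layer_slope H d x y = (1 - 2 * (sin (x / H) * sin (y / H) / d)\<^sup>2) * cell_layer H d x y"

definition tube_x :: "real \<Rightarrow> real \<Rightarrow> real \<Rightarrow> real \<Rightarrow> real" where
  "tube_x H d x y = cos (y / H) * (cos (x / H) * sin (y / H)) * layer_slope H d x y / H"

definition tube_y :: "real \<Rightarrow> real \<Rightarrow> real \<Rightarrow> real \<Rightarrow> real" where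
  "tube_y H d x y = (sin (x / H) * (cos (y / H))\<^sup>2 * layer_slope H d x y
     - sin (x / H) * (sin (y / H))\<^sup>2 * cell_layer H d x y) / H"

text \<open>Axis ratio \<open>k\<close> of the ellipse traced by
  \<open>cos X + \<i> k sin X\<close>. At height \<open>y\<close> the layer around
  \<open>sin X = 0\<close> has angular width about \<open>d / sin Y\<close>, which for large
  \<open>k\<close> is comparable with \<open>1 / k\<close>; the summand \<open>1\<close> keeps
  \<open>k \<ge> 1\<close> up to the walls.\<close>

definition layer_ratio :: "real \<Rightarrow> real \<Rightarrow> real \<Rightarrow> real" where
  "layer_ratio H d y = 1 + sin (y / H) / d"

text \<open>With \<open>k\<close> the layer ratio, this is the periodic function \<open>arg (cos X + \<i> k sin X) - X\<close>, \<open>X = x / H\<close>.\<close>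

definition angle_defect :: "real \<Rightarrow> real \<Rightarrow> real \<Rightarrow> real \<Rightarrow> real" where
  "angle_defect H d x y = arctan ((layer_ratio H d y - 1) * sin (x / H) * cos (x / H) /
     ((cos (x / H))\<^sup>2 + layer_ratio H d y * (sin (x / H))\<^sup>2))"

definition angle_defect_x :: "real \<Rightarrow> real \<Rightarrow> real \<Rightarrow> real \<Rightarrow> real" where
  "angle_defect_x H d x y = (layer_ratio H d y /
     ((cos (x / H))\<^sup>2 + (layer_ratio H d y)\<^sup>2 * (sin (x / H))\<^sup>2) - 1) / H"

lemma sin_strip_nonneg:
  assumes "H > 0" "y \<in> {0..pi * H}"
  shows "0 \<le> sin (y / H)"
  using assms by (intro sin_ge_zero) (auto simp: field_simps)

lemma layer_ratio_ge_1:
  assumes "H > 0" "d > 0" "y \<in> {0..pi * H}"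
  shows "layer_ratio H d y \<ge> 1"
  using sin_strip_nonneg[OF assms(1,3)] assms by (simp add: layer_ratio_def)

context
  fixes H d :: real
  assumes H: "H > 0" and d: "d > 0"
begin

lemma layer_continuous:
  fixes g h :: "'a::t2_space \<Rightarrow> real"
  assumes "continuous_on S g" "continuous_on S h"
  shows "continuous_on S (\<lambda>p. cell_layer H d (g p) (h p))"
    "continuous_on S (\<lambda>p. layer_flux H d (g p) (h p))"
    "continuous_on S (\<lambda>p. tube H d (g p) (h p))"
    "continuous_on S (\<lambda>p. tube_x H d (g p) (h p))"
    "continuous_on S (\<lambda>p. tube_y H d (g p) (h p))"
    "continuous_on S (\<lambda>p. layer_flux_x H d (g p) (h p))"
  using H d unfolding cell_layer_def layer_flux_def tube_def tube_x_def tube_y_def layer_slope_def layer_flux_x_def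
  by (intro continuous_intros assms; simp)+

lemma cell_layer_x:
  "((\<lambda>x. cell_layer H d x y) has_real_derivative
     - 2 * sin (x / H) * cos (x / H) * (sin (y / H))\<^sup>2 / (d\<^sup>2 * H) * cell_layer H d x y) (at x)"
  unfolding cell_layer_def using H d
  by (auto intro!: derivative_eq_intros simp: field_simps power2_eq_square)

lemma cell_layer_y:
  "((\<lambda>y. cell_layer H d x y) has_real_derivative
     - 2 * sin (y / H) * cos (y / H) * (sin (x / H))\<^sup>2 / (d\<^sup>2 * H) * cell_layer H d x y) (at y)"
  unfolding cell_layer_def using H d
  by (auto intro!: derivative_eq_intros simp: field_simps power2_eq_square)

lemma layer_flux_derivative:
  "((\<lambda>x. layer_flux H d x y) has_real_derivative layer_flux_x H d x y) (at x)"
  unfolding layer_flux_def layer_flux_x_def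
  by (rule derivative_eq_intros cell_layer_x refl)+ (simp add: power2_eq_square power3_eq_cube)

lemma tube_derivatives:
  "((\<lambda>x. tube H d x y) has_real_derivative tube_x H d x y) (at x)"
  "((\<lambda>y. tube H d x y) has_real_derivative tube_y H d x y) (at y)"
proof -
  show "((\<lambda>x. tube H d x y) has_real_derivative tube_x H d x y) (at x)"
    unfolding tube_def tube_x_def layer_slope_def using H d
    by (auto intro!: derivative_eq_intros cell_layer_x simp: field_simps power2_eq_square)
  show "((\<lambda>y. tube H d x y) has_real_derivative tube_y H d x y) (at y)"
    unfolding tube_def tube_y_def layer_slope_def using H d
    by (auto intro!: derivative_eq_intros cell_layer_y simp: field_simps power2_eq_square)
qed

text \<open>This says that the test field \<open>\<Phi> u + b e1\<close> is divergence-free: as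
  \<open>u\<close> has no divergence of its own, that amounts to
  \<open>u \<cdot> \<nabla>\<Phi> = - b_x\<close>, here divided by \<open>U0\<close>.\<close>

lemma tube_transport:
  "sin (x / H) * cos (y / H) * tube_x H d x y - cos (x / H) * sin (y / H) * tube_y H d x y
     = - (d\<^sup>2 / 2) * layer_flux_x H d x y"
  unfolding tube_x_def tube_y_def layer_flux_x_def using H d
  by (simp add: field_simps power2_eq_square power3_eq_cube)

lemma cell_layer_bounds: "0 < cell_layer H d x y" "cell_layer H d x y \<le> 1"
  by (auto simp: cell_layer_def)

lemma layer_slope_bound: "\<bar>layer_slope H d x y\<bar> \<le> 2"
  using exp_square_bounds(2)[of "sin (x / H) * sin (y / H) / d"]
  by (simp add: layer_slope_def cell_layer_def abs_mult)

text \<open>The weight is \<open>d * cos Y\<close> times \<open>z * exp (- z\<^sup>2)\<close> with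
  \<open>z = sin X sin Y / d\<close>. Differentiating \<open>z\<close> costs a factor
  \<open>1 / d\<close>, which the prefactor cancels, so thin tubes have no larger gradient bound
  than thick ones.\<close>

lemma tube_bounds:
  "\<bar>tube H d x y\<bar> \<le> d" "\<bar>tube H d x y\<bar> \<le> 1" "\<bar>tube_x H d x y\<bar> \<le> 3 / H" "\<bar>tube_y H d x y\<bar> \<le> 3 / H"
proof -
  let ?z = "sin (x / H) * sin (y / H) / d"
  have "\<bar>?z * exp (- ?z\<^sup>2)\<bar> \<le> 1"
    using exp_square_bounds(1)[of ?z] by (simp only: abs_mult abs_exp_cancel)
  then have "\<bar>d * (?z * exp (- ?z\<^sup>2))\<bar> \<le> d" using d by (simp add: abs_mult mult_left_le)
  from abs_mult_le_one[OF abs_cos_le_one[of "y / H"] this]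
  show "\<bar>tube H d x y\<bar> \<le> d" using d by (simp add: tube_def cell_layer_def)
  have b1: "\<bar>cos u * (sin v * sin w)\<bar> \<le> 1" "\<bar>cos u * (cos v * sin w)\<bar> \<le> 1" for u v w :: real
    by (intro abs_mult_le_one; simp)+
  have l1: "\<bar>cell_layer H d x y\<bar> \<le> 1" using cell_layer_bounds[of x y] by simp
  show "\<bar>tube H d x y\<bar> \<le> 1"
    unfolding tube_def by (rule abs_mult_le_one[OF b1(1) l1])
  have "\<bar>H * tube_x H d x y\<bar> \<le> 2"
    using abs_mult_le_one[OF b1(2) layer_slope_bound] H by (simp add: tube_x_def)
  then show "\<bar>tube_x H d x y\<bar> \<le> 3 / H" using H by (simp add: abs_mult field_simps)
  have b2: "\<bar>sin u * (cos v)\<^sup>2\<bar> \<le> 1" "\<bar>sin u * (sin v)\<^sup>2\<bar> \<le> 1" for u v :: real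
    by (intro abs_mult_le_one; simp add: abs_square_le_1)+
  have "\<bar>H * tube_y H d x y\<bar> \<le> 3"
    using abs_mult_le_one[OF b2(1)[of "x / H" "y / H"] layer_slope_bound[of x y]]
      abs_mult_le_one[OF b2(2)[of "x / H" "y / H"] l1] H by (simp add: tube_y_def)
  then show "\<bar>tube_y H d x y\<bar> \<le> 3 / H" using H by (simp add: abs_mult field_simps)
qed

lemma layer_flux_bounds:
  assumes y: "y \<in> {0..pi * H}"
  shows "0 \<le> layer_flux H d x y" "layer_flux H d x y \<le> 1"
  using sin_strip_nonneg[OF H y] cell_layer_bounds[of x y] mult_mono[of "sin (y / H)" 1 "cell_layer H d x y" 1]
  by (auto simp: layer_flux_def)

lemma tube_ends [simp]: "tube H d x 0 = 0" "tube H d x (pi * H) = 0"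
  using H by (auto simp: tube_def)

lemma tube_periodic:
  "tube H d (x + 2 * pi * H * of_int m) y = tube H d x y"
proof -
  have "(x + 2 * pi * H * of_int m) / H = x / H + 2 * pi * of_int m" using H by (simp add: field_simps)
  moreover have "sin (x / H + 2 * pi * of_int m) = sin (x / H)"
    unfolding sin_add sin_int_2pin cos_int_2pin by simp
  ultimately show ?thesis by (simp add: tube_def cell_layer_def)
qed

lemma reflect_trig:
  "sin ((pi * H - y) / H) = sin (y / H)" "cos ((pi * H - y) / H) = - cos (y / H)"
proof -
  have "(pi * H - y) / H = pi - y / H" using H by (simp add: field_simps)
  then show "sin ((pi * H - y) / H) = sin (y / H)" "cos ((pi * H - y) / H) = - cos (y / H)"
    by (simp_all add: sin_diff cos_diff)
qed

text \<open>Oddness about the middle line of the strip. Because of it, neither the frame speed nor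
  the diffusive end term with \<open>tube_x\<close> contributes to the limiting flux.\<close>

lemma tube_mean_zero:
  "integral {0..pi * H} (\<lambda>y. tube H d x y) = 0" "integral {0..pi * H} (\<lambda>y. tube_x H d x y) = 0"
  by (rule integral_odd_reflection; (intro layer_continuous continuous_intros)?;
      simp add: tube_def tube_x_def layer_slope_def cell_layer_def reflect_trig)+

lemma total_flux:
  "integral {0..pi * H} (\<lambda>y. sin (x / H) * cos (y / H) * tube H d x y + d\<^sup>2 / 2 * layer_flux H d x y) = d\<^sup>2 * H"
proof -
  \<comment> \<open>The stream function of the test field divided by \<open>U0\<close>. At both
    walls the layer function is \<open>1\<close> and the cosine has opposite signs, which gives the
    jump.\<close>
  let ?S = "\<lambda>y. - (d\<^sup>2 * H / 2) * (cos (y / H) * cell_layer H d x y)"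
  have "((\<lambda>y. sin (x / H) * cos (y / H) * tube H d x y + d\<^sup>2 / 2 * layer_flux H d x y)
      has_integral ?S (pi * H) - ?S 0) {0..pi * H}"
  proof (rule fundamental_theorem_of_calculus)
    fix y
    have "(?S has_real_derivative
        sin (x / H) * cos (y / H) * tube H d x y + d\<^sup>2 / 2 * layer_flux H d x y) (at y)"
      unfolding tube_def layer_flux_def using H d
      by (auto intro!: derivative_eq_intros cell_layer_y simp: field_simps power2_eq_square)
    then show "(?S has_vector_derivative
        sin (x / H) * cos (y / H) * tube H d x y + d\<^sup>2 / 2 * layer_flux H d x y) (at y within {0..pi * H})"
      by (auto simp: has_real_derivative_iff_has_vector_derivative[symmetric] intro: DERIV_subset)
  qed (use H in auto)
  moreover have "?S (pi * H) - ?S 0 = d\<^sup>2 * H"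
    using H by (simp add: cell_layer_def)
  ultimately show ?thesis by (simp add: integral_unique)
qed

section \<open>The angle defect and the concentration of the layer weight\<close>

lemma angle_defect_continuous:
  fixes g h :: "'a::t2_space \<Rightarrow> real"
  assumes "continuous_on S g" "continuous_on S h" "\<And>p. p \<in> S \<Longrightarrow> h p \<in> {0..pi * H}"
  shows "continuous_on S (\<lambda>p. angle_defect H d (g p) (h p))"
    "continuous_on S (\<lambda>p. angle_defect_x H d (g p) (h p))"
proof -
  have n: "(cos u)\<^sup>2 + k * (sin u)\<^sup>2 \<noteq> 0" if "k \<ge> 1" for u k :: real
  proof -
    have "1 * (sin u)\<^sup>2 \<le> k * (sin u)\<^sup>2" using that by (intro mult_right_mono) auto
    then have "1 \<le> (cos u)\<^sup>2 + k * (sin u)\<^sup>2" using sin_cos_squared_add[of u] by linarith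
    then show ?thesis by linarith
  qed
  have c: "continuous_on S (\<lambda>p. layer_ratio H d (h p))"
    unfolding layer_ratio_def using assms H d by (intro continuous_intros) auto
  have k: "layer_ratio H d (h p) \<ge> 1" if "p \<in> S" for p
    by (rule layer_ratio_ge_1[OF H d assms(3)[OF that]])
  then have k2: "(layer_ratio H d (h p))\<^sup>2 \<ge> 1" if "p \<in> S" for p using that by (simp add: one_le_power)
  show "continuous_on S (\<lambda>p. angle_defect H d (g p) (h p))"
    unfolding angle_defect_def using assms(1,2) H c k n by (intro continuous_intros) auto
  show "continuous_on S (\<lambda>p. angle_defect_x H d (g p) (h p))"
    unfolding angle_defect_x_def using assms(1,2) H c k2 n by (intro continuous_intros) auto
qed

lemma angle_defect_bound: "\<bar>angle_defect H d x y\<bar> \<le> 2"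
proof -
  have "\<bar>arctan u\<bar> \<le> 2" for u :: real
    using arctan_bounded[of u] pi_less_4 by linarith
  then show ?thesis by (simp add: angle_defect_def)
qed

text \<open>Numerator and denominator of the quotient are the imaginary and the real part of
  \<open>(cos X + \<i> k sin X) exp (- \<i> X)\<close>. So their squares add up to
  \<open>(cos X)\<^sup>2 + k\<^sup>2 (sin X)\<^sup>2\<close>, and the positive real part keeps the
  angle away from any branch cut.\<close>

lemma angle_defect_derivative:
  assumes y: "y \<in> {0..pi * H}"
  shows "((\<lambda>x. angle_defect H d x y) has_real_derivative angle_defect_x H d x y) (at x)"
proof -
  define k where "k = layer_ratio H d y"
  have k: "k \<ge> 1" unfolding k_def by (rule layer_ratio_ge_1[OF H d y])
  let ?s = "sin (x / H)" and ?c = "cos (x / H)"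
  have sc: "?c\<^sup>2 = 1 - ?s\<^sup>2" using sin_cos_squared_add[of "x / H"] by linarith
  have D: "?c\<^sup>2 + k * ?s\<^sup>2 \<ge> 1"
  proof -
    have "1 * ?s\<^sup>2 \<le> k * ?s\<^sup>2" using k by (intro mult_right_mono) auto
    then show ?thesis using sc by linarith
  qed
  have D2: "?c\<^sup>2 + k\<^sup>2 * ?s\<^sup>2 \<ge> 1"
  proof -
    have "1 * ?s\<^sup>2 \<le> k\<^sup>2 * ?s\<^sup>2" using k by (intro mult_right_mono) (auto simp: one_le_power)
    then show ?thesis using sc by linarith
  qed
  let ?N = "\<lambda>x. (k - 1) * sin (x / H) * cos (x / H)" and ?D = "\<lambda>x. (cos (x / H))\<^sup>2 + k * (sin (x / H))\<^sup>2"
  let ?q = "((k - 1) * (?c\<^sup>2 - k * ?s\<^sup>2) / H) / (?D x)\<^sup>2"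
  have N: "(?N has_real_derivative (k - 1) * (?c\<^sup>2 - ?s\<^sup>2) / H) (at x)"
    using H by (auto intro!: derivative_eq_intros simp: field_simps power2_eq_square)
  have Dd: "(?D has_real_derivative 2 * (k - 1) * ?s * ?c / H) (at x)"
    using H by (auto intro!: derivative_eq_intros simp: field_simps power2_eq_square)
  have alg: "(k - 1) * (C - S) * (C + k * S) - 2 * (k - 1)\<^sup>2 * S * C = (k - 1) * (C - k * S)"
    if "C = 1 - S" for C S :: real
    unfolding that by (simp add: power2_eq_square algebra_simps)
  have "((\<lambda>x. ?N x / ?D x) has_real_derivative
      ((k - 1) * (?c\<^sup>2 - ?s\<^sup>2) / H * ?D x - ?N x * (2 * (k - 1) * ?s * ?c / H)) / (?D x * ?D x)) (at x)"
    by (rule DERIV_divide[OF N Dd]) (use D in auto)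
  moreover have "(k - 1) * (?c\<^sup>2 - ?s\<^sup>2) / H * ?D x - ?N x * (2 * (k - 1) * ?s * ?c / H)
      = ((k - 1) * (?c\<^sup>2 - ?s\<^sup>2) * (?c\<^sup>2 + k * ?s\<^sup>2) - 2 * (k - 1)\<^sup>2 * ?s\<^sup>2 * ?c\<^sup>2) / H"
    using H by (simp add: field_simps power2_eq_square)
  ultimately have q: "((\<lambda>x. ?N x / ?D x) has_real_derivative ?q) (at x)"
    unfolding power2_eq_square[of "?D x"] by (simp only: alg[OF sc])
  have "((\<lambda>x. arctan (?N x / ?D x)) has_real_derivative inverse (1 + (?N x / ?D x)\<^sup>2) * ?q) (at x)"
    by (rule DERIV_chain2[OF DERIV_arctan q])
  moreover have "inverse (1 + (?N x / ?D x)\<^sup>2) * ?q = (k / (?c\<^sup>2 + k\<^sup>2 * ?s\<^sup>2) - 1) / H"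
  proof -
    have nd: "(?D x)\<^sup>2 + (?N x)\<^sup>2 = ?c\<^sup>2 + k\<^sup>2 * ?s\<^sup>2"
    proof -
      have "(C + k * S)\<^sup>2 + (k - 1)\<^sup>2 * S * C = C + k\<^sup>2 * S" if "C = 1 - S" for C S :: real
        unfolding that by (simp add: power2_eq_square algebra_simps)
      from this[OF sc] show ?thesis by (simp add: power_mult_distrib)
    qed
    have gen: "inverse (1 + (N / D)\<^sup>2) * (A / D\<^sup>2) = A / (D\<^sup>2 + N\<^sup>2)" if "D \<noteq> 0" for A D N :: real
    proof -
      have "1 + (N / D)\<^sup>2 = (D\<^sup>2 + N\<^sup>2) / D\<^sup>2" using that by (simp add: power_divide field_simps)
      then show ?thesis using that by simp
    qed
    have "?D x \<noteq> 0" using D by linarith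
    from gen[OF this, of "?N x" "(k - 1) * (?c\<^sup>2 - k * ?s\<^sup>2) / H"]
    have "inverse (1 + (?N x / ?D x)\<^sup>2) * ?q = ((k - 1) * (?c\<^sup>2 - k * ?s\<^sup>2) / H) / (?c\<^sup>2 + k\<^sup>2 * ?s\<^sup>2)"
      unfolding nd .
    moreover have "(k - 1) * (?c\<^sup>2 - k * ?s\<^sup>2) = k - (?c\<^sup>2 + k\<^sup>2 * ?s\<^sup>2)"
      unfolding sc by (simp add: power2_eq_square algebra_simps)
    moreover have "(k - A) / H / A = (k / A - 1) / H" if "A \<ge> 1" for A
      using that H by (simp add: field_simps)
    ultimately show ?thesis using D2 by metis
  qed
  ultimately show ?thesis
    unfolding angle_defect_def angle_defect_x_def k_def[symmetric] by simp
qed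

text \<open>
  Up to an \<open>x\<close>-derivative of a bounded function, the weight that concentrates near the separatrices is
  dominated by a constant of order \<open>d\<close>.
\<close>

lemma layer_flux_le_angle_defect:
  assumes y: "y \<in> {0..pi * H}"
  shows "layer_flux H d x y \<le> 2 * d * (1 + H * angle_defect_x H d x y)"
proof -
  define t where "t = sin (y / H) / d"
  let ?s = "sin (x / H)" and ?c = "cos (x / H)"
  have t: "t \<ge> 0" using sin_strip_nonneg[OF H y] d by (simp add: t_def)
  have sc: "?c\<^sup>2 = 1 - ?s\<^sup>2" using sin_cos_squared_add[of "x / H"] by linarith
  have pos: "(1 + t)\<^sup>2 * ?s\<^sup>2 + ?c\<^sup>2 > 0"
  proof -
    have "1 * ?s\<^sup>2 \<le> (1 + t)\<^sup>2 * ?s\<^sup>2" using t by (intro mult_right_mono) (auto simp: one_le_power)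
    then show ?thesis using sc by linarith
  qed
  have "exp (- (t * ?s)\<^sup>2) * (1 + (t * ?s)\<^sup>2) \<le> exp (- (t * ?s)\<^sup>2) * exp ((t * ?s)\<^sup>2)"
    by (intro mult_left_mono exp_ge_add_one_self) auto
  also have "\<dots> = 1" by (simp add: exp_minus)
  finally have e: "exp (- (t * ?s)\<^sup>2) * (1 + (t * ?s)\<^sup>2) \<le> 1" .
  \<comment> \<open>The Gaussian is at most \<open>1 / (1 + (t sin X)\<^sup>2)\<close>. This step
    compares that peak with \<open>2 / ((cos X)\<^sup>2 + k\<^sup>2 (sin X)\<^sup>2)\<close> for
    \<open>k = 1 + t\<close>, which up to the factor \<open>2 / k\<close> is the derivative of the
    angle.\<close>
  have "(1 + t)\<^sup>2 * ?s\<^sup>2 + ?c\<^sup>2 \<le> 2 * (1 + (t * ?s)\<^sup>2)"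
  proof -
    have "(1 + t)\<^sup>2 \<le> 2 * (1 + t\<^sup>2)" using zero_le_power2[of "1 - t"] by (simp add: power2_eq_square algebra_simps)
    then have "(1 + t)\<^sup>2 * ?s\<^sup>2 \<le> 2 * (1 + t\<^sup>2) * ?s\<^sup>2" by (intro mult_right_mono) auto
    also have "\<dots> = 2 * ?s\<^sup>2 + 2 * (t * ?s)\<^sup>2" by (simp add: power_mult_distrib algebra_simps)
    finally have "(1 + t)\<^sup>2 * ?s\<^sup>2 \<le> 2 * ?s\<^sup>2 + 2 * (t * ?s)\<^sup>2" .
    moreover have "A + C \<le> 2 * (1 + B)" if "A \<le> 2 * S + 2 * B" "C = 1 - S" "0 \<le> C" for A B C S :: real
      using that by simp
    ultimately show ?thesis using sc zero_le_power2[of ?c] by blast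
  qed
  then have "exp (- (t * ?s)\<^sup>2) * ((1 + t)\<^sup>2 * ?s\<^sup>2 + ?c\<^sup>2) \<le> exp (- (t * ?s)\<^sup>2) * (2 * (1 + (t * ?s)\<^sup>2))"
    by (intro mult_left_mono) auto
  also have "\<dots> = 2 * (exp (- (t * ?s)\<^sup>2) * (1 + (t * ?s)\<^sup>2))" by (simp only: mult.left_commute)
  also have "\<dots> \<le> 2" using mult_left_mono[OF e, of 2] by simp
  finally have "exp (- (t * ?s)\<^sup>2) \<le> 2 / (?c\<^sup>2 + (1 + t)\<^sup>2 * ?s\<^sup>2)"
    using pos by (simp add: field_simps)
  then have "t * exp (- (t * ?s)\<^sup>2) \<le> (1 + t) * (2 / (?c\<^sup>2 + (1 + t)\<^sup>2 * ?s\<^sup>2))"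
    using t by (intro mult_mono) auto
  then have "d * (t * exp (- (t * ?s)\<^sup>2)) \<le> d * ((1 + t) * (2 / (?c\<^sup>2 + (1 + t)\<^sup>2 * ?s\<^sup>2)))"
    using d by (intro mult_left_mono) auto
  moreover have "layer_flux H d x y = d * (t * exp (- (t * ?s)\<^sup>2))"
    using d by (simp add: layer_flux_def cell_layer_def t_def mult.commute)
  moreover have "2 * d * (1 + H * angle_defect_x H d x y) = d * ((1 + t) * (2 / (?c\<^sup>2 + (1 + t)\<^sup>2 * ?s\<^sup>2)))"
    using H by (simp add: angle_defect_x_def layer_ratio_def t_def)
  ultimately show ?thesis by simp
qed

end

section \<open>Energy identities for fronts\<close>

text \<open>All derivatives are treated as independent numbers. The two sides differ by
  \<open>\<phi> * \<Phi> * g'\<close> times the equation plus \<open>\<phi> * g\<close> times the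
  transport relation of the weight; the vertical velocity is \<open>- u2\<close>.\<close>

lemma flux_algebra:
  fixes \<phi> \<phi>' \<phi>'' \<Phi> \<Phi>x \<Phi>y b bx g g' g'' vt vx vy vxx vyy u1 u2 ux c \<kappa> q F :: real
  assumes "vt - c * vx + u1 * vx - u2 * vy = \<kappa> * (vxx + vyy) + q * F"
    and "u1 * \<Phi>x - u2 * \<Phi>y = - bx"
  shows "\<phi> * (\<Phi>x * c * g + \<Phi> * (g' * vt))
    + (\<phi>' * \<Phi> * ((u1 - c) * g - \<kappa> * (g' * vx)) + \<phi> * \<Phi>x * ((u1 - c) * g - \<kappa> * (g' * vx))
      + \<phi> * \<Phi> * (ux * g + (u1 - c) * (g' * vx) - \<kappa> * (g'' * vx * vx + g' * vxx))
      + \<kappa> * (\<phi>'' * \<Phi> * g + \<phi>' * \<Phi>x * g + \<phi>' * \<Phi> * (g' * vx))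
      + (\<phi>' * g * b + \<phi> * (g' * vx) * b + \<phi> * g * bx))
    + (\<phi> * \<Phi>y * (- u2 * g - \<kappa> * (g' * vy))
      + \<phi> * \<Phi> * (- ux * g - u2 * (g' * vy) - \<kappa> * (g'' * vy * vy + g' * vyy)))
    = q * \<phi> * \<Phi> * g' * F + \<phi>' * (\<Phi> * (u1 - c) + b) * g - \<kappa> * \<phi> * g' * (\<Phi>x * vx + \<Phi>y * vy)
      + \<phi> * b * g' * vx - \<kappa> * \<phi> * \<Phi> * g'' * (vx\<^sup>2 + vy\<^sup>2) + \<kappa> * \<phi>'' * \<Phi> * g + \<kappa> * \<phi>' * \<Phi>x * g"
    (is "?l = ?r")
proof -
  have "?l - ?r = \<phi> * \<Phi> * g' * (vt - c * vx + u1 * vx - u2 * vy - (\<kappa> * (vxx + vyy) + q * F))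
     + \<phi> * g * (u1 * \<Phi>x - u2 * \<Phi>y + bx)"
    by (simp add: power2_eq_square algebra_simps)
  then show ?thesis using assms by simp
qed

text \<open>
  A wave-type solution in the frame moving with speed \<open>c\<close>: \<open>V (x, y, t) = T (x + c t) y t\<close>. Over one
  period \<open>P\<close> the frame moves by \<open>N\<close> spatial periods of the flow, so that \<open>V\<close> is \<open>P\<close>-periodic in time.
\<close>

locale moving_front =
  fixes V Vt Vx Vy Vxx Vyy :: "real \<times> real \<times> real \<Rightarrow> real" and f :: "real \<Rightarrow> real"
    and H U0 \<kappa> q c P :: real and N :: int
  assumes H: "H > 0" and P: "P > 0" and \<kappa>: "\<kappa> > 0" and q: "q > 0"
    and cont: "continuous_on (UNIV \<times> {0..pi * H} \<times> UNIV) V"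
      "continuous_on (UNIV \<times> {0..pi * H} \<times> UNIV) Vx"
      "continuous_on (UNIV \<times> {0..pi * H} \<times> UNIV) Vy"
    and cont_int: "continuous_on (UNIV \<times> {0<..<pi * H} \<times> UNIV) Vt"
      "continuous_on (UNIV \<times> {0<..<pi * H} \<times> UNIV) Vxx"
      "continuous_on (UNIV \<times> {0<..<pi * H} \<times> UNIV) Vyy"
    and dVx: "\<And>x y t. y \<in> {0<..<pi * H} \<Longrightarrow> ((\<lambda>x. V (x, y, t)) has_real_derivative Vx (x, y, t)) (at x)"
    and dVy: "\<And>x y t. y \<in> {0<..<pi * H} \<Longrightarrow> ((\<lambda>y. V (x, y, t)) has_real_derivative Vy (x, y, t)) (at y)"
    and dVt: "\<And>x y t. y \<in> {0<..<pi * H} \<Longrightarrow> ((\<lambda>t. V (x, y, t)) has_real_derivative Vt (x, y, t)) (at t)"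
    and dVxx: "\<And>x y t. y \<in> {0<..<pi * H} \<Longrightarrow> ((\<lambda>x. Vx (x, y, t)) has_real_derivative Vxx (x, y, t)) (at x)"
    and dVyy: "\<And>x y t. y \<in> {0<..<pi * H} \<Longrightarrow> ((\<lambda>y. Vy (x, y, t)) has_real_derivative Vyy (x, y, t)) (at y)"
    and pde: "\<And>x y t. y \<in> {0<..<pi * H} \<Longrightarrow>
        Vt (x, y, t) - c * Vx (x, y, t) + U0 * sin ((x + c * t) / H) * cos (y / H) * Vx (x, y, t)
          - U0 * cos ((x + c * t) / H) * sin (y / H) * Vy (x, y, t)
        = \<kappa> * (Vxx (x, y, t) + Vyy (x, y, t)) + q * f (V (x, y, t))"
    and range: "\<And>p. p \<in> UNIV \<times> {0..pi * H} \<times> UNIV \<Longrightarrow> V p \<in> {0..1}"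
    and per: "\<And>x y. y \<in> {0..pi * H} \<Longrightarrow> V (x, y, P) = V (x, y, 0)"
    and cP: "c * P = 2 * pi * H * of_int N"
    and bc: "(\<forall>x t. Vy (x, 0, t) = 0 \<and> Vy (x, pi * H, t) = 0) \<or>
        (\<forall>x t. V (x, 0, t) = V (x, pi * H, t) \<and> Vy (x, 0, t) = Vy (x, pi * H, t))"
    and lim_right: "\<And>x y t. y \<in> {0..pi * H} \<Longrightarrow> (\<lambda>k. V (x + real k * (2 * pi * H), y, t)) \<longlonglongrightarrow> 0"
    and lim_left: "\<And>x y t. y \<in> {0..pi * H} \<Longrightarrow> (\<lambda>k. V (x - real k * (2 * pi * H), y, t)) \<longlonglongrightarrow> 1"
    and f: "continuous_on {0..1} f" and f_nonneg: "\<And>z. z \<in> {0..1} \<Longrightarrow> f z \<ge> 0"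
begin

abbreviation strip :: "(real \<times> real \<times> real) set" where
  "strip \<equiv> UNIV \<times> {0..pi * H} \<times> UNIV"

abbreviation radius :: "nat \<Rightarrow> real" where
  "radius n \<equiv> real n * (2 * pi * H)"

definition cylinder :: "nat \<Rightarrow> (real \<times> real \<times> real) set" where
  "cylinder n = cbox (- radius n, 0, 0) (radius n, pi * H, P)"

lemma radius_pos: "n > 0 \<Longrightarrow> radius n > 0"
  using H by simp

lemma cylinder_subset: "cylinder n \<subseteq> strip"
  by (auto simp: cylinder_def cbox_Pair_eq)

lemma cylinder_fst: "p \<in> cylinder n \<Longrightarrow> \<bar>fst p\<bar> \<le> radius n"
  by (auto simp: cylinder_def cbox_Pair_eq)

lemma cylinder_y: "p \<in> cylinder n \<Longrightarrow> fst (snd p) \<in> {0..pi * H}"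
  by (auto simp: cylinder_def cbox_Pair_eq)

lemma integrable_cylinder:
  fixes h :: "real \<times> real \<times> real \<Rightarrow> real"
  assumes "continuous_on strip h"
  shows "h integrable_on cylinder n"
  unfolding cylinder_def
  by (rule integrable_continuous) (rule continuous_on_subset[OF assms], use cylinder_subset in \<open>auto simp: cylinder_def\<close>)

lemma range_cylinder: "p \<in> cylinder n \<Longrightarrow> V p \<in> {0..1}"
  using range cylinder_subset by blast

lemma comp_V_cont:
  fixes h :: "real \<Rightarrow> real"
  assumes "continuous_on {0..1} h"
  shows "continuous_on strip (\<lambda>p. h (V p))"
  by (rule continuous_on_compose2[OF assms cont(1)]) (use range in blast)

text \<open>
  The terms \<open>\<kappa> \<phi>' \<Phi> G\<close> and \<open>\<phi> G b\<close> added to the horizontal flux turn \<open>\<phi>' G' V\<^sub>x\<close> into \<open>\<phi>'' G\<close>, for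
  which no gradient bound is needed, and remove the advection term \<open>\<phi> G u \<cdot> \<nabla>\<Phi>\<close>.
\<close>

lemma weighted_identity:
  fixes \<Phi> \<Phi>x \<Phi>y b bx :: "real \<Rightarrow> real \<Rightarrow> real" and G G' G'' :: "real \<Rightarrow> real"
  assumes n: "n > 0"
    and cw: "\<And>(S :: (real \<times> real \<times> real) set) g h. continuous_on S g \<Longrightarrow> continuous_on S h \<Longrightarrow> continuous_on S (\<lambda>p. \<Phi> (g p) (h p))"
      "\<And>(S :: (real \<times> real \<times> real) set) g h. continuous_on S g \<Longrightarrow> continuous_on S h \<Longrightarrow> continuous_on S (\<lambda>p. \<Phi>x (g p) (h p))"
      "\<And>(S :: (real \<times> real \<times> real) set) g h. continuous_on S g \<Longrightarrow> continuous_on S h \<Longrightarrow> continuous_on S (\<lambda>p. \<Phi>y (g p) (h p))"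
      "\<And>(S :: (real \<times> real \<times> real) set) g h. continuous_on S g \<Longrightarrow> continuous_on S h \<Longrightarrow> continuous_on S (\<lambda>p. b (g p) (h p))"
      "\<And>(S :: (real \<times> real \<times> real) set) g h. continuous_on S g \<Longrightarrow> continuous_on S h \<Longrightarrow> continuous_on S (\<lambda>p. bx (g p) (h p))"
    and d\<Phi>: "\<And>x y. ((\<lambda>x. \<Phi> x y) has_real_derivative \<Phi>x x y) (at x)"
      "\<And>x y. ((\<lambda>y. \<Phi> x y) has_real_derivative \<Phi>y x y) (at y)"
    and db: "\<And>x y. ((\<lambda>x. b x y) has_real_derivative bx x y) (at x)"
    and transport: "\<And>x y. U0 * sin (x / H) * cos (y / H) * \<Phi>x x y - U0 * cos (x / H) * sin (y / H) * \<Phi>y x y = - bx x y"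
    and \<Phi>_per: "\<And>x y m. \<Phi> (x + 2 * pi * H * of_int m) y = \<Phi> x y"
    and \<Phi>_ends: "\<And>x. \<Phi> x 0 = \<Phi> x (pi * H)"
    and dG: "\<And>z. z \<in> {0..1} \<Longrightarrow> (G has_real_derivative G' z) (at z)"
      "\<And>z. z \<in> {0..1} \<Longrightarrow> (G' has_real_derivative G'' z) (at z)"
    and cG: "continuous_on {0..1} G''"
  shows "integral (cylinder n) (\<lambda>(x, y, t).
      q * cutoff (radius n) x * \<Phi> (x + c * t) y * G' (V (x, y, t)) * f (V (x, y, t))
      + cutoff' (radius n) x * (\<Phi> (x + c * t) y * (U0 * sin ((x + c * t) / H) * cos (y / H) - c) + b (x + c * t) y) * G (V (x, y, t))
      - \<kappa> * cutoff (radius n) x * G' (V (x, y, t)) * (\<Phi>x (x + c * t) y * Vx (x, y, t) + \<Phi>y (x + c * t) y * Vy (x, y, t))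
      + cutoff (radius n) x * b (x + c * t) y * G' (V (x, y, t)) * Vx (x, y, t)
      - \<kappa> * cutoff (radius n) x * \<Phi> (x + c * t) y * G'' (V (x, y, t)) * ((Vx (x, y, t))\<^sup>2 + (Vy (x, y, t))\<^sup>2)
      + \<kappa> * cutoff'' (radius n) x * \<Phi> (x + c * t) y * G (V (x, y, t))
      + \<kappa> * cutoff' (radius n) x * \<Phi>x (x + c * t) y * G (V (x, y, t))) = 0"
proof -
  let ?R = "radius n"
  let ?L = "pi * H"
  let ?D = "{- ?R..?R} \<times> {0..?L} \<times> {0..P}" and ?I = "{- ?R..?R} \<times> {0<..<?L} \<times> {0..P}"
  let ?X = "\<lambda>p :: real \<times> real \<times> real. fst p + c * snd (snd p)" and ?y = "\<lambda>p :: real \<times> real \<times> real. fst (snd p)"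
  let ?\<phi> = "\<lambda>p. cutoff ?R (fst p)" and ?\<phi>' = "\<lambda>p. cutoff' ?R (fst p)" and ?\<phi>'' = "\<lambda>p. cutoff'' ?R (fst p)"
  let ?\<Phi> = "\<lambda>p. \<Phi> (?X p) (?y p)" and ?\<Phi>x = "\<lambda>p. \<Phi>x (?X p) (?y p)" and ?\<Phi>y = "\<lambda>p. \<Phi>y (?X p) (?y p)"
  let ?b = "\<lambda>p. b (?X p) (?y p)" and ?bx = "\<lambda>p. bx (?X p) (?y p)"
  let ?u1 = "\<lambda>p. U0 * sin (?X p / H) * cos (?y p / H)" and ?u2 = "\<lambda>p. U0 * cos (?X p / H) * sin (?y p / H)"
  let ?ux = "\<lambda>p. U0 * cos (?X p / H) * cos (?y p / H) / H"
  define F0 where "F0 = (\<lambda>p. ?\<phi> p * (?\<Phi> p * G (V p)))"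
  define F0t where "F0t = (\<lambda>p. ?\<phi> p * (?\<Phi>x p * c * G (V p) + ?\<Phi> p * (G' (V p) * Vt p)))"
  define F1 where "F1 = (\<lambda>p. ?\<phi> p * ?\<Phi> p * ((?u1 p - c) * G (V p) - \<kappa> * (G' (V p) * Vx p))
     + \<kappa> * (?\<phi>' p * ?\<Phi> p * G (V p)) + ?\<phi> p * G (V p) * ?b p)"
  define F1x where "F1x = (\<lambda>p. ?\<phi>' p * ?\<Phi> p * ((?u1 p - c) * G (V p) - \<kappa> * (G' (V p) * Vx p))
      + ?\<phi> p * ?\<Phi>x p * ((?u1 p - c) * G (V p) - \<kappa> * (G' (V p) * Vx p))
      + ?\<phi> p * ?\<Phi> p * (?ux p * G (V p) + (?u1 p - c) * (G' (V p) * Vx p)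
          - \<kappa> * (G'' (V p) * Vx p * Vx p + G' (V p) * Vxx p))
      + \<kappa> * (?\<phi>'' p * ?\<Phi> p * G (V p) + ?\<phi>' p * ?\<Phi>x p * G (V p) + ?\<phi>' p * ?\<Phi> p * (G' (V p) * Vx p))
      + (?\<phi>' p * G (V p) * ?b p + ?\<phi> p * (G' (V p) * Vx p) * ?b p + ?\<phi> p * G (V p) * ?bx p))"
  define F2 where "F2 = (\<lambda>p. ?\<phi> p * ?\<Phi> p * (- ?u2 p * G (V p) - \<kappa> * (G' (V p) * Vy p)))"
  define F2y where "F2y = (\<lambda>p. ?\<phi> p * ?\<Phi>y p * (- ?u2 p * G (V p) - \<kappa> * (G' (V p) * Vy p))
      + ?\<phi> p * ?\<Phi> p * (- ?ux p * G (V p) - ?u2 p * (G' (V p) * Vy p)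
          - \<kappa> * (G'' (V p) * Vy p * Vy p + G' (V p) * Vyy p)))"
  define S where "S = (\<lambda>p. q * ?\<phi> p * ?\<Phi> p * G' (V p) * f (V p) + ?\<phi>' p * (?\<Phi> p * (?u1 p - c) + ?b p) * G (V p)
      - \<kappa> * ?\<phi> p * G' (V p) * (?\<Phi>x p * Vx p + ?\<Phi>y p * Vy p)
      + ?\<phi> p * ?b p * G' (V p) * Vx p - \<kappa> * ?\<phi> p * ?\<Phi> p * G'' (V p) * ((Vx p)\<^sup>2 + (Vy p)\<^sup>2)
      + \<kappa> * ?\<phi>'' p * ?\<Phi> p * G (V p) + \<kappa> * ?\<phi>' p * ?\<Phi>x p * G (V p))"
  have G01: "continuous_on {0..1} G" "continuous_on {0..1} G'"
    using DERIV_isCont[OF dG(1)] DERIV_isCont[OF dG(2)]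
    by (intro continuous_at_imp_continuous_on ballI; blast)+
  have R: "?R > 0" using n H by simp
  have D_sub: "?D \<subseteq> strip" and I_sub: "?I \<subseteq> ?D" and I_sub': "?I \<subseteq> UNIV \<times> {0<..<?L} \<times> UNIV" by auto
  note cV = cont[THEN continuous_on_subset, OF D_sub]
  note cG = comp_V_cont[OF G01(1), THEN continuous_on_subset, OF D_sub]
    comp_V_cont[OF G01(2), THEN continuous_on_subset, OF D_sub]
    comp_V_cont[OF cG, THEN continuous_on_subset, OF D_sub]
    comp_V_cont[OF f, THEN continuous_on_subset, OF D_sub]
  note ints = cV[THEN continuous_on_subset, OF I_sub] cG[THEN continuous_on_subset, OF I_sub]
    cont_int[THEN continuous_on_subset, OF I_sub']
  note ci = cutoff_continuous cw continuous_intros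
  have "integral (cbox (- ?R, 0, 0) (?R, ?L, P)) S = 0"
  proof (rule box_flux_zero[of "- ?R" ?R ?L P S F2 F0t F1x F2y F0 F1])
    show "continuous_on ?D S" unfolding S_def
      by (intro ci cV cG; use H in simp)
    show "continuous_on ?D F2" unfolding F2_def
      by (intro ci cV cG; use H in simp)
    show "continuous_on ?I F0t" unfolding F0t_def
      by (intro ci ints; use H in simp)
    show "continuous_on ?I F1x" unfolding F1x_def
      by (intro ci ints; use H in simp)
    show "continuous_on ?I F2y" unfolding F2y_def
      by (intro ci ints; use H in simp)
  next
    fix x y t :: real
    assume x: "x \<in> {- ?R..?R}" and y: "y \<in> {0<..<?L}" and t: "t \<in> {0..P}"
    let ?p = "(x, y, t)"
    have vr: "V ?p \<in> {0..1}" using range[of ?p] y by auto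
    note gx = DERIV_chain2[OF dG(1)[OF vr] dVx[OF y]] DERIV_chain2[OF dG(2)[OF vr] dVx[OF y]]
    note gy = DERIV_chain2[OF dG(1)[OF vr] dVy[OF y]] DERIV_chain2[OF dG(2)[OF vr] dVy[OF y]]
    note gt = DERIV_chain2[OF dG(1)[OF vr] dVt[OF y]]
    have Xx: "((\<lambda>x. x + c * t) has_real_derivative 1) (at x)" and Xt: "((\<lambda>t. x + c * t) has_real_derivative c) (at t)"
      by (auto intro!: derivative_eq_intros)
    have Bx: "((\<lambda>x. \<Phi> (x + c * t) y) has_real_derivative \<Phi>x (x + c * t) y) (at x)"
      "((\<lambda>x. b (x + c * t) y) has_real_derivative bx (x + c * t) y) (at x)"
      using DERIV_chain2[OF d\<Phi>(1) Xx] DERIV_chain2[OF db Xx] by simp_all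
    have Bt: "((\<lambda>t. \<Phi> (x + c * t) y) has_real_derivative \<Phi>x (x + c * t) y * c) (at t)"
      by (rule DERIV_chain2[OF d\<Phi>(1) Xt])
    have u1: "((\<lambda>x. U0 * sin ((x + c * t) / H) * cos (y / H)) has_real_derivative
        U0 * cos ((x + c * t) / H) * cos (y / H) / H) (at x)"
      using H by (auto intro!: derivative_eq_intros simp: field_simps)
    have u2: "((\<lambda>y. U0 * cos ((x + c * t) / H) * sin (y / H)) has_real_derivative
        U0 * cos ((x + c * t) / H) * cos (y / H) / H) (at y)"
      using H by (auto intro!: derivative_eq_intros simp: field_simps)
    show "((\<lambda>t. F0 (x, y, t)) has_real_derivative F0t ?p) (at t)"
      unfolding F0_def F0t_def fst_conv snd_conv
      by (rule gt Bt derivative_eq_intros refl)+ (simp add: algebra_simps)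
    show "((\<lambda>x. F1 (x, y, t)) has_real_derivative F1x ?p) (at x)"
      unfolding F1_def F1x_def fst_conv snd_conv
      by (rule gx dVxx[OF y] Bx u1 cutoff_derivs derivative_eq_intros refl)+ (simp add: algebra_simps)
    show "((\<lambda>y. F2 (x, y, t)) has_real_derivative F2y ?p) (at y)"
      unfolding F2_def F2y_def fst_conv snd_conv
      by (rule gy dVyy[OF y] d\<Phi>(2) u2 derivative_eq_intros refl)+ (simp add: algebra_simps)
    show "F0t ?p + F1x ?p + F2y ?p = S ?p"
      unfolding F0t_def F1x_def F2y_def S_def
      by (rule flux_algebra) (use pde[OF y] transport in simp_all)
  next
    fix x y :: real assume x: "x \<in> {- ?R..?R}" and y: "y \<in> {0<..<?L}"
    \<comment> \<open>Over one period the argument of the weight moves by \<open>c * P\<close>, a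
      whole number of flow periods.\<close>
    show "F0 (x, y, P) = F0 (x, y, 0)"
      using per[of y x] y \<Phi>_per[of x N y] by (simp add: F0_def cP)
  next
    fix y t :: real
    show "F1 (?R, y, t) = F1 (- ?R, y, t)"
      using R by (simp only: F1_def fst_conv snd_conv cutoff_ends[OF less_imp_neq[OF R, symmetric]])
  next
    fix x t :: real
    \<comment> \<open>The vertical velocity vanishes at both walls. In the Neumann case both fluxes
      are then zero; in the periodic case \<open>V\<close>, \<open>Vy\<close> and the weight agree
      at the two walls. The opposite signs of the horizontal velocity there do not enter.\<close>
    show "F2 (x, ?L, t) = F2 (x, 0, t)"
      using bc \<Phi>_ends[of "x + c * t"] H by (auto simp: F2_def)
  qed (use R H P in auto)
  then show ?thesis
    unfolding cylinder_def S_def by (simp add: case_prod_unfold)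
qed

section \<open>Fluxes through cross-sections far to the left and to the right\<close>

abbreviation slice :: "(real \<times> real) set" where
  "slice \<equiv> cbox (0, 0) (pi * H, P)"

lemma slice_cont:
  fixes h :: "real \<times> real \<times> real \<Rightarrow> real"
  assumes "continuous_on strip h"
  shows "continuous_on slice (\<lambda>r. h (x, r))"
  by (rule continuous_on_compose2[OF assms]) (auto simp: cbox_Pair_eq intro!: continuous_intros)

lemma slice_integrable:
  fixes h :: "real \<times> real \<times> real \<Rightarrow> real"
  assumes "continuous_on strip h"
  shows "(\<lambda>r. h (x, r)) integrable_on slice"
  by (rule integrable_continuous[OF slice_cont[OF assms]])

lemma slice_integral_cont:
  fixes h :: "real \<times> real \<times> real \<Rightarrow> real"
  assumes "continuous_on strip h"
  shows "continuous_on UNIV (\<lambda>x. integral slice (\<lambda>r. h (x, r)))"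
  by (rule integral_continuous_on_param)
    (auto simp: cbox_Pair_eq case_prod_unfold intro!: continuous_on_compose2[OF assms] continuous_intros)

lemma integral_slices:
  fixes h :: "real \<times> real \<times> real \<Rightarrow> real"
  assumes "continuous_on strip h"
  shows "integral (cbox (a, 0, 0) (b, pi * H, P)) h = integral {a..b} (\<lambda>x. integral slice (\<lambda>r. h (x, r)))"
proof -
  have "continuous_on (cbox (a, 0, 0) (b, pi * H, P)) h"
    by (rule continuous_on_subset[OF assms]) (auto simp: cbox_Pair_eq)
  from integral_prod_continuous[OF this] show ?thesis by simp
qed

text \<open>Dominated convergence on one space-time cell: limits along shifts by whole periods,
  pointwise in the cell and with the common bound \<open>1\<close>, make the cell integrals tend to
  zero, and their means follow.\<close>

lemma slice_mean_zero:
  fixes Z :: "real \<times> real \<times> real \<Rightarrow> real"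
  assumes Z: "continuous_on strip Z" and b: "\<And>p. p \<in> strip \<Longrightarrow> \<bar>Z p\<bar> \<le> 1"
    and lim: "\<And>x y t. y \<in> {0..pi * H} \<Longrightarrow> (\<lambda>k. Z (x + radius k, y, t)) \<longlonglongrightarrow> 0"
  shows "(\<lambda>n. integral {0..radius n} (\<lambda>x. integral slice (\<lambda>r. Z (x, r))) / real n) \<longlonglongrightarrow> 0"
proof (rule integral_cells_mean_zero)
  let ?C = "cbox (0, 0, 0) (2 * pi * H, pi * H, P)"
  have Zk: "continuous_on strip (\<lambda>p. Z (fst p + radius k, snd p))" for k
    by (rule continuous_on_compose2[OF Z]) (auto intro!: continuous_intros)
  have "(\<lambda>k. integral ?C (\<lambda>p. Z (fst p + radius k, snd p))) \<longlonglongrightarrow> integral ?C (\<lambda>p. 0)"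
  proof (rule dominated_convergence(2))
    show "(\<lambda>p. Z (fst p + radius k, snd p)) integrable_on ?C" for k
      by (rule integrable_continuous, rule continuous_on_subset[OF Zk]) (auto simp: cbox_Pair_eq)
    show "(\<lambda>p. 1::real) integrable_on ?C" by (rule integrable_const)
    show "norm (Z (fst p + radius k, snd p)) \<le> 1" if "p \<in> ?C" for k p
      using b[of "(fst p + radius k, snd p)"] that by (auto simp: cbox_Pair_eq)
    show "(\<lambda>k. Z (fst p + radius k, snd p)) \<longlonglongrightarrow> 0" if "p \<in> ?C" for p
      using lim[of "fst (snd p)" "fst p" "snd (snd p)"] that by (auto simp: cbox_Pair_eq)
  qed
  moreover have "integral ?C (\<lambda>p. Z (fst p + radius k, snd p))
      = integral {0..2 * pi * H} (\<lambda>x. integral slice (\<lambda>r. Z (x + radius k, r)))" for k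
    using integral_slices[OF Zk[of k], of 0 "2 * pi * H"] by simp
  ultimately show "(\<lambda>k. integral {0..2 * pi * H} (\<lambda>x. integral slice (\<lambda>r. Z (x + radius k, r)))) \<longlonglongrightarrow> 0"
    by simp
qed (use slice_integral_cont[OF Z] H in auto)

text \<open>Together with \<open>left_mass\<close> this measures how far the front is from its limit
  state on a cross-section. The left one is reflected, so that both ends are treated on the same
  half-line.\<close>

definition right_mass :: "real \<Rightarrow> real" where
  "right_mass x = integral slice (\<lambda>r. V (x, r))"

definition left_mass :: "real \<Rightarrow> real" where
  "left_mass x = integral slice (\<lambda>r. 1 - V (- x, r))"

lemma V_reflected_cont: "continuous_on strip (\<lambda>p. 1 - V (- fst p, snd p))"
  by (intro continuous_on_diff continuous_on_const continuous_on_compose2[OF cont(1)]) (auto intro!: continuous_intros)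

lemma masses_cont: "continuous_on UNIV right_mass" "continuous_on UNIV left_mass"
  using slice_integral_cont[OF cont(1)] slice_integral_cont[OF V_reflected_cont]
  by (simp_all add: right_mass_def[abs_def] left_mass_def[abs_def])

lemma masses_mean_zero:
  "(\<lambda>n. integral {0..radius n} right_mass / real n) \<longlonglongrightarrow> 0"
  "(\<lambda>n. integral {0..radius n} left_mass / real n) \<longlonglongrightarrow> 0"
proof -
  show "(\<lambda>n. integral {0..radius n} right_mass / real n) \<longlonglongrightarrow> 0"
    using slice_mean_zero[OF cont(1)] range lim_right
    by (force simp: right_mass_def[abs_def])
  have "(\<lambda>n. integral {0..radius n} (\<lambda>x. integral slice (\<lambda>r. 1 - V (- fst (x, r), snd (x, r)))) / real n) \<longlonglongrightarrow> 0"
  proof (rule slice_mean_zero[OF V_reflected_cont])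
    show "\<bar>1 - V (- fst p, snd p)\<bar> \<le> 1" if "p \<in> strip" for p
      using range[of "(- fst p, snd p)"] that by auto
    show "(\<lambda>k. 1 - V (- fst (x + radius k, y, t), snd (x + radius k, y, t))) \<longlonglongrightarrow> 0" if "y \<in> {0..pi * H}" for x y t
      using tendsto_diff[OF tendsto_const[of 1] lim_left[OF that, of "- x" t]] by simp
  qed
  then show "(\<lambda>n. integral {0..radius n} left_mass / real n) \<longlonglongrightarrow> 0"
    by (simp add: left_mass_def[abs_def])
qed

lemma slice_integral_const:
  fixes a :: "real \<times> real \<times> real \<Rightarrow> real"
  assumes a: "continuous_on strip a" and m: "\<And>t. integral {0..pi * H} (\<lambda>y. a (x, y, t)) = m"
  shows "integral slice (\<lambda>r. a (x, r)) = m * P"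
proof -
  have "integral slice (\<lambda>r. a (x, r)) = integral {0..pi * H} (\<lambda>y. integral {0..P} (\<lambda>t. a (x, y, t)))"
    using integral_prod_continuous[OF slice_cont[OF a]] by simp
  also have "\<dots> = integral {0..P} (\<lambda>t. integral {0..pi * H} (\<lambda>y. a (x, y, t)))"
    using integral_swap_continuous[of 0 0 "pi * H" P "\<lambda>y t. a (x, y, t)"] slice_cont[OF a]
    by (simp add: case_prod_unfold)
  also have "\<dots> = m * P" using P by (simp add: m)
  finally show ?thesis .
qed

lemma slice_deviation:
  fixes a :: "real \<times> real \<times> real \<Rightarrow> real"
  assumes a: "continuous_on strip a" and A: "\<And>p. p \<in> strip \<Longrightarrow> \<bar>a p\<bar> \<le> A"
    and m: "\<And>t. integral {0..pi * H} (\<lambda>y. a (x, y, t)) = m"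
    and h: "continuous_on {0..1} h" and \<rho>: "continuous_on {0..1} \<rho>"
    and dev: "\<And>z. z \<in> {0..1} \<Longrightarrow> \<bar>h z - h0\<bar> \<le> K * \<rho> z"
  shows "\<bar>integral slice (\<lambda>r. a (x, r) * h (V (x, r))) - h0 * (m * P)\<bar>
    \<le> A * K * integral slice (\<lambda>r. \<rho> (V (x, r)))"
proof -
  have i: "integral slice (\<lambda>r. a (x, r) * h (V (x, r))) - h0 * (m * P)
      = integral slice (\<lambda>r. a (x, r) * (h (V (x, r)) - h0))"
  proof -
    have "integral slice (\<lambda>r. a (x, r) * (h (V (x, r)) - h0))
        = integral slice (\<lambda>r. a (x, r) * h (V (x, r)) - h0 * a (x, r))"
      by (simp add: algebra_simps)
    also have "\<dots> = integral slice (\<lambda>r. a (x, r) * h (V (x, r))) - integral slice (\<lambda>r. h0 * a (x, r))"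
      by (intro integral_diff slice_integrable[of "\<lambda>p. a p * h (V p)", simplified]
          slice_integrable[of "\<lambda>p. h0 * a p", simplified] continuous_intros a comp_V_cont[OF h])
    finally show ?thesis using slice_integral_const[OF a m] by simp
  qed
  have "norm (integral slice (\<lambda>r. a (x, r) * (h (V (x, r)) - h0)))
      \<le> integral slice (\<lambda>r. A * K * \<rho> (V (x, r)))"
  proof (rule integral_norm_bound_integral)
    show "(\<lambda>r. a (x, r) * (h (V (x, r)) - h0)) integrable_on slice"
      by (intro slice_integrable[of "\<lambda>p. a p * (h (V p) - h0)"] continuous_intros a comp_V_cont[OF h])
    show "(\<lambda>r. A * K * \<rho> (V (x, r))) integrable_on slice"
      by (intro slice_integrable[of "\<lambda>p. A * K * \<rho> (V p)"] continuous_intros comp_V_cont[OF \<rho>])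
    fix r assume "r \<in> slice"
    then have s: "(x, r) \<in> strip" by (auto simp: cbox_Pair_eq)
    show "norm (a (x, r) * (h (V (x, r)) - h0)) \<le> A * K * \<rho> (V (x, r))"
      using mult_mono[OF A[OF s] dev[OF range[OF s]]] order_trans[OF abs_ge_zero A[OF s]]
      by (simp add: abs_mult)
  qed
  then show ?thesis unfolding i by simp
qed

text \<open>Far out, \<open>h (V p)\<close> may be replaced by its end values at a cost bounded by
  the masses; after that only the mean \<open>m\<close> of the weight across the strip matters.
  \<open>h0\<close> belongs to the right end, where \<open>V\<close> tends to \<open>0\<close>, and
  \<open>h1\<close> to the left end.\<close>

lemma flux_limit:
  fixes a :: "real \<times> real \<times> real \<Rightarrow> real"
  assumes a: "continuous_on strip a" and A: "\<And>p. p \<in> strip \<Longrightarrow> \<bar>a p\<bar> \<le> A"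
    and m: "\<And>x t. integral {0..pi * H} (\<lambda>y. a (x, y, t)) = m"
    and h: "continuous_on {0..1} h"
    and h0: "\<And>z. z \<in> {0..1} \<Longrightarrow> \<bar>h z - h0\<bar> \<le> K * z"
    and h1: "\<And>z. z \<in> {0..1} \<Longrightarrow> \<bar>h z - h1\<bar> \<le> K * (1 - z)"
  shows "(\<lambda>n. integral (cylinder n) (\<lambda>p. cutoff' (radius n) (fst p) * (a p * h (V p)))) \<longlonglongrightarrow> (h1 - h0) * (m * P)"
proof -
  define j where "j = (\<lambda>x. integral slice (\<lambda>r. a (x, r) * h (V (x, r))))"
  have c: "continuous_on strip (\<lambda>p. a p * h (V p))"
    by (intro continuous_intros a comp_V_cont[OF h])
  have j: "continuous_on UNIV j"
    unfolding j_def by (rule slice_integral_cont[OF c])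
  have "(\<lambda>n. integral {- radius n..radius n} (\<lambda>x. cutoff' (radius n) x * j x)) \<longlonglongrightarrow> h1 * (m * P) - h0 * (m * P)"
  proof (rule cutoff_flux_limit[where v = "\<lambda>x. A * K * right_mass x" and w = "\<lambda>x. A * K * left_mass x"])
    show "\<bar>j x - h0 * (m * P)\<bar> \<le> A * K * right_mass x" for x
      unfolding j_def right_mass_def
      by (rule slice_deviation[OF a A m h, where \<rho> = "\<lambda>z. z"]) (use h0 in auto)
    show "\<bar>j (- x) - h1 * (m * P)\<bar> \<le> A * K * left_mass x" for x
      unfolding j_def left_mass_def
      by (rule slice_deviation[OF a A m h, where \<rho> = "\<lambda>z. 1 - z"]) (use h1 in \<open>auto intro!: continuous_intros\<close>)
    show "(\<lambda>n. integral {0..radius n} (\<lambda>x. A * K * right_mass x) / real n) \<longlonglongrightarrow> 0"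
      using tendsto_mult_left[OF masses_mean_zero(1), of "A * K"] by simp
    show "(\<lambda>n. integral {0..radius n} (\<lambda>x. A * K * left_mass x) / real n) \<longlonglongrightarrow> 0"
      using tendsto_mult_left[OF masses_mean_zero(2), of "A * K"] by simp
  qed (use H j masses_cont in \<open>auto intro!: continuous_intros\<close>)
  moreover have "integral (cylinder n) (\<lambda>p. cutoff' (radius n) (fst p) * (a p * h (V p)))
      = integral {- radius n..radius n} (\<lambda>x. cutoff' (radius n) x * j x)" for n
    unfolding cylinder_def j_def
    by (subst integral_slices) (auto intro!: continuous_intros c)
  ultimately show ?thesis by (simp add: left_diff_distrib)
qed

lemma abs_flux_limit:
  assumes h: "continuous_on {0..1} h"
    and h0: "\<And>z. z \<in> {0..1} \<Longrightarrow> \<bar>h z\<bar> \<le> K * z"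
    and h1: "\<And>z. z \<in> {0..1} \<Longrightarrow> \<bar>h z\<bar> \<le> K * (1 - z)"
  shows "(\<lambda>n. integral (cylinder n) (\<lambda>p. \<bar>cutoff' (radius n) (fst p)\<bar> * h (V p))) \<longlonglongrightarrow> 0"
proof -
  define j where "j = (\<lambda>x. integral slice (\<lambda>r. h (V (x, r))))"
  note c = comp_V_cont[OF h]
  have j: "continuous_on UNIV j"
    unfolding j_def by (rule slice_integral_cont[OF c])
  have one: "integral {0..pi * H} (\<lambda>y. 1) = pi * H" using H by simp
  have "(\<lambda>n. integral {- radius n..radius n} (\<lambda>x. \<bar>cutoff' (radius n) x\<bar> * j x)) \<longlonglongrightarrow> 0"
  proof (rule cutoff_abs_flux_limit[where v = "\<lambda>x. K * right_mass x" and w = "\<lambda>x. K * left_mass x"])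
    show "\<bar>j x\<bar> \<le> K * right_mass x" for x
      using slice_deviation[of "\<lambda>_. 1" 1 x "pi * H" h "\<lambda>z. z" 0 K, OF _ _ one h] h0
      by (simp add: j_def right_mass_def)
    show "\<bar>j (- x)\<bar> \<le> K * left_mass x" for x
      using slice_deviation[of "\<lambda>_. 1" 1 "- x" "pi * H" h "\<lambda>z. 1 - z" 0 K, OF _ _ one h] h1
      by (simp add: j_def left_mass_def continuous_on_diff continuous_on_id)
    show "(\<lambda>n. integral {0..radius n} (\<lambda>x. K * right_mass x) / real n) \<longlonglongrightarrow> 0"
      using tendsto_mult_left[OF masses_mean_zero(1), of K] by simp
    show "(\<lambda>n. integral {0..radius n} (\<lambda>x. K * left_mass x) / real n) \<longlonglongrightarrow> 0"
      using tendsto_mult_left[OF masses_mean_zero(2), of K] by simp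
  qed (use H j masses_cont in \<open>auto intro!: continuous_intros\<close>)
  moreover have "integral (cylinder n) (\<lambda>p. \<bar>cutoff' (radius n) (fst p)\<bar> * h (V p))
      = integral {- radius n..radius n} (\<lambda>x. \<bar>cutoff' (radius n) x\<bar> * j x)" for n
    unfolding cylinder_def j_def
    by (subst integral_slices) (auto intro!: continuous_intros c)
  ultimately show ?thesis by simp
qed

text \<open>The second derivative of the cutoff is of order \<open>1 / R\<^sup>2\<close>, while the
  volume of the cylinder grows only like \<open>R\<close>.\<close>

lemma second_cutoff_limit:
  fixes a :: "real \<times> real \<times> real \<Rightarrow> real"
  assumes a: "continuous_on strip a" and A: "\<And>p. p \<in> strip \<Longrightarrow> \<bar>a p\<bar> \<le> A"
  shows "(\<lambda>n. integral (cylinder n) (\<lambda>p. cutoff'' (radius n) (fst p) * a p)) \<longlonglongrightarrow> 0"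
proof (rule Lim_null_comparison)
  show "(\<lambda>n. 12 * A * P / real n) \<longlonglongrightarrow> 0"
    using tendsto_mult_left[OF lim_inverse_n[where 'a = real], of "12 * A * P"] by (simp add: divide_inverse)
  show "\<forall>\<^sub>F n in sequentially. norm (integral (cylinder n) (\<lambda>p. cutoff'' (radius n) (fst p) * a p)) \<le> 12 * A * P / real n"
    using eventually_gt_at_top[of 0]
  proof eventually_elim
    case (elim n)
    have R: "radius n > 0" using elim H by simp
    have "norm (integral (cylinder n) (\<lambda>p. cutoff'' (radius n) (fst p) * a p))
        \<le> integral (cylinder n) (\<lambda>p. 12 / (radius n)\<^sup>2 * A)"
    proof (rule integral_norm_bound_integral)
      show "(\<lambda>p. cutoff'' (radius n) (fst p) * a p) integrable_on cylinder n"
        by (intro integrable_cylinder continuous_intros a)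
      show "(\<lambda>p. 12 / (radius n)\<^sup>2 * A) integrable_on cylinder n"
        by (intro integrable_cylinder continuous_on_const)
      show "norm (cutoff'' (radius n) (fst p) * a p) \<le> 12 / (radius n)\<^sup>2 * A" if "p \<in> cylinder n" for p
        unfolding real_norm_def abs_mult
        by (rule mult_mono[OF cutoff_bounds(4)[OF R cylinder_fst[OF that]] A])
          (use that cylinder_subset in auto)
    qed
    also have "\<dots> = 12 / (radius n)\<^sup>2 * A * (2 * radius n * (pi * H) * P)"
      using R H P unfolding cylinder_def by (simp add: content_Pair)
    also have "\<dots> = 12 * A * P / real n"
      using elim H by (simp add: field_simps power2_eq_square)
    finally show ?case .
  qed
qed

section \<open>Reaction and dissipation under the cutoff\<close>

definition reaction :: "nat \<Rightarrow> real" where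
  "reaction n = integral (cylinder n) (\<lambda>p. cutoff (radius n) (fst p) * f (V p))"

definition dissipation :: "nat \<Rightarrow> real" where
  "dissipation n = integral (cylinder n) (\<lambda>p. cutoff (radius n) (fst p) * ((Vx p)\<^sup>2 + (Vy p)\<^sup>2))"

definition swept :: real where
  "swept = c * (pi * H) * P"

lemma integral_cylinder_add:
  fixes g h :: "real \<times> real \<times> real \<Rightarrow> real"
  assumes "continuous_on strip g" "continuous_on strip h"
  shows "integral (cylinder n) (\<lambda>p. g p + h p) = integral (cylinder n) g + integral (cylinder n) h"
  using assms by (intro integral_add integrable_cylinder)

lemma integral_cylinder_add4:
  fixes g h k l :: "real \<times> real \<times> real \<Rightarrow> real"
  assumes "continuous_on strip g" "continuous_on strip h" "continuous_on strip k" "continuous_on strip l"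
  shows "integral (cylinder n) (\<lambda>p. g p + h p + k p + l p)
    = integral (cylinder n) g + integral (cylinder n) h + integral (cylinder n) k + integral (cylinder n) l"
  using assms by (simp add: integral_cylinder_add continuous_on_add)

lemma integral_cylinder_mono:
  fixes g h :: "real \<times> real \<times> real \<Rightarrow> real"
  assumes "continuous_on strip g" "continuous_on strip h" "\<And>p. p \<in> cylinder n \<Longrightarrow> g p \<le> h p"
  shows "integral (cylinder n) g \<le> integral (cylinder n) h"
  using assms by (intro integral_le integrable_cylinder)

lemma cutoff_nonneg: "n > 0 \<Longrightarrow> p \<in> cylinder n \<Longrightarrow> 0 \<le> cutoff (radius n) (fst p)"
  using cutoff_bounds(1)[of "radius n" "fst p"] cylinder_fst radius_pos by blast

text \<open>\<open>a\<close> is the horizontal velocity seen in the moving frame. The flow has no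
  mean flux through a cross-section, so only \<open>- c\<close> survives the average.\<close>

lemma frame_drift:
  defines "a \<equiv> \<lambda>p :: real \<times> real \<times> real. U0 * sin ((fst p + c * snd (snd p)) / H) * cos (fst (snd p) / H) - c"
  shows "continuous_on strip a" "\<And>p. \<bar>a p\<bar> \<le> \<bar>U0\<bar> + \<bar>c\<bar>" "integral {0..pi * H} (\<lambda>y. a (x, y, t)) = - (c * (pi * H))"
proof -
  show "continuous_on strip a" unfolding a_def by (intro continuous_intros; use H in simp)
  show "\<bar>a p\<bar> \<le> \<bar>U0\<bar> + \<bar>c\<bar>" for p
  proof -
    have "\<bar>sin u * cos v\<bar> \<le> 1" for u v :: real
      using mult_mono[OF abs_sin_le_one[of u] abs_cos_le_one[of v]] by (simp add: abs_mult)
    then have "\<bar>U0\<bar> * \<bar>sin ((fst p + c * snd (snd p)) / H) * cos (fst (snd p) / H)\<bar> \<le> \<bar>U0\<bar>"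
      by (intro mult_left_le) auto
    then show ?thesis unfolding a_def
      using abs_triangle_ineq4[of "U0 * sin ((fst p + c * snd (snd p)) / H) * cos (fst (snd p) / H)" c]
      by (simp add: abs_mult mult.assoc)
  qed
  let ?s = "U0 * sin ((x + c * t) / H)"
  let ?A = "\<lambda>y. ?s * H * sin (y / H) - c * y"
  have "((\<lambda>y. a (x, y, t)) has_integral ?A (pi * H) - ?A 0) {0..pi * H}"
  proof (rule fundamental_theorem_of_calculus)
    fix y
    have "(?A has_real_derivative a (x, y, t)) (at y)"
      unfolding a_def using H by (auto intro!: derivative_eq_intros simp: field_simps)
    then show "(?A has_vector_derivative a (x, y, t)) (at y within {0..pi * H})"
      by (auto simp: has_real_derivative_iff_has_vector_derivative[symmetric] intro: DERIV_subset)
  qed (use H in simp)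
  then show "integral {0..pi * H} (\<lambda>y. a (x, y, t)) = - (c * (pi * H))"
    using H by (simp add: integral_unique)
qed

text \<open>The weighted identity with weight \<open>1\<close> and \<open>G z = z\<close>: the
  advective end flux tends to minus \<open>swept\<close> and must be balanced by the reaction, while
  the diffusive end term fades with the second derivative of the cutoff.\<close>

lemma reaction_limit: "reaction \<longlonglongrightarrow> swept / q"
proof -
  let ?a = "\<lambda>p :: real \<times> real \<times> real. U0 * sin ((fst p + c * snd (snd p)) / H) * cos (fst (snd p) / H) - c"
  let ?f1 = "\<lambda>n. integral (cylinder n) (\<lambda>p. cutoff' (radius n) (fst p) * (?a p * V p))"
  let ?f2 = "\<lambda>n. integral (cylinder n) (\<lambda>p. cutoff'' (radius n) (fst p) * V p)"
  have f1: "?f1 \<longlonglongrightarrow> (1 - 0) * (- (c * (pi * H)) * P)"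
    by (rule flux_limit[where K = 1 and h = "\<lambda>z. z", OF frame_drift]) (auto intro!: continuous_intros)
  have f2: "?f2 \<longlonglongrightarrow> 0"
    by (rule second_cutoff_limit[where A = 1, OF cont(1)]) (use range in fastforce)
  have "reaction n = (- ?f1 n - \<kappa> * ?f2 n) / q" if n: "n > 0" for n
  proof -
    have "integral (cylinder n) (\<lambda>p. q * (cutoff (radius n) (fst p) * f (V p))
        + cutoff' (radius n) (fst p) * (?a p * V p) + \<kappa> * (cutoff'' (radius n) (fst p) * V p)) = 0"
      using weighted_identity[OF n, of "\<lambda>_ _. 1" "\<lambda>_ _. 0" "\<lambda>_ _. 0" "\<lambda>_ _. 0" "\<lambda>_ _. 0" "\<lambda>z. z" "\<lambda>_. 1" "\<lambda>_. 0"]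
      by (simp add: case_prod_unfold mult.assoc)
    also have "integral (cylinder n) (\<lambda>p. q * (cutoff (radius n) (fst p) * f (V p))
        + cutoff' (radius n) (fst p) * (?a p * V p) + \<kappa> * (cutoff'' (radius n) (fst p) * V p))
        = q * reaction n + ?f1 n + \<kappa> * ?f2 n"
      unfolding reaction_def integral_mult_right[symmetric]
      by (subst integral_cylinder_add integral_cylinder_add,
          intro continuous_intros frame_drift cont comp_V_cont[OF f],
          intro continuous_intros frame_drift cont comp_V_cont[OF f])+ simp
    finally show ?thesis using q by (simp add: field_simps)
  qed
  then have "\<forall>\<^sub>F n in sequentially. (- ?f1 n - \<kappa> * ?f2 n) / q = reaction n"
    by (intro eventually_mono[OF eventually_gt_at_top[of 0]]) simp
  moreover have "(\<lambda>n. (- ?f1 n - \<kappa> * ?f2 n) / q) \<longlonglongrightarrow> (- ((1 - 0) * (- (c * (pi * H)) * P)) - \<kappa> * 0) / q"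
    using q by (intro tendsto_intros f1 f2) auto
  ultimately show ?thesis
    unfolding swept_def by (simp add: tendsto_cong)
qed

text \<open>Testing with the solution itself, that is \<open>G z = z\<^sup>2 / 2\<close>: the end
  flux now accounts for half of \<open>swept\<close>, and \<open>V f(V) \<le> f(V)\<close> bounds
  the source by the full reaction, so half of \<open>swept\<close> is left to pay for the
  dissipation. This is an upper bound only, hence the convergent majorant \<open>r\<close> in place
  of a limit.\<close>

lemma dissipation_bound:
  obtains r where "r \<longlonglongrightarrow> swept / (2 * \<kappa>)" "\<And>n. n > 0 \<Longrightarrow> dissipation n \<le> r n"
proof -
  let ?a = "\<lambda>p :: real \<times> real \<times> real. U0 * sin ((fst p + c * snd (snd p)) / H) * cos (fst (snd p) / H) - c"
  let ?f1 = "\<lambda>n. integral (cylinder n) (\<lambda>p. cutoff' (radius n) (fst p) * (?a p * ((V p)\<^sup>2 / 2)))"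
  let ?f2 = "\<lambda>n. integral (cylinder n) (\<lambda>p. cutoff'' (radius n) (fst p) * ((V p)\<^sup>2 / 2))"
  let ?f3 = "\<lambda>n. integral (cylinder n) (\<lambda>p. cutoff (radius n) (fst p) * (V p * f (V p)))"
  have f1: "?f1 \<longlonglongrightarrow> (1 / 2 - 0) * (- (c * (pi * H)) * P)"
  proof (rule flux_limit[where K = 1 and h = "\<lambda>z. z\<^sup>2 / 2", OF frame_drift])
    fix z :: real assume z: "z \<in> {0..1}"
    then have "z\<^sup>2 \<le> z" by (simp add: power2_eq_square mult_left_le)
    then show "\<bar>z\<^sup>2 / 2 - 0\<bar> \<le> 1 * z" using z by simp
    have "z * (2 - z) \<le> 1" using zero_le_power2[of "1 - z"] by (simp add: power2_eq_square algebra_simps)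
    then show "\<bar>z\<^sup>2 / 2 - 1 / 2\<bar> \<le> 1 * (1 - z)" using z \<open>z\<^sup>2 \<le> z\<close>
      by (simp add: abs_if power2_eq_square algebra_simps)
  qed (auto intro!: continuous_intros)
  have f2: "?f2 \<longlonglongrightarrow> 0"
  proof (rule second_cutoff_limit[where A = 1])
    show "continuous_on strip (\<lambda>p. (V p)\<^sup>2 / 2)" by (intro continuous_intros cont) auto
    show "\<bar>(V p)\<^sup>2 / 2\<bar> \<le> 1" if "p \<in> strip" for p
      using range[OF that] power_le_one[of "V p" 2] by auto
  qed
  show thesis
  proof (rule that)
    show "(\<lambda>n. (q * reaction n + ?f1 n + \<kappa> * ?f2 n) / \<kappa>) \<longlonglongrightarrow> swept / (2 * \<kappa>)"
    proof -
      have "(\<lambda>n. (q * reaction n + ?f1 n + \<kappa> * ?f2 n) / \<kappa>) \<longlonglongrightarrow>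
          (q * (swept / q) + (1 / 2 - 0) * (- (c * (pi * H)) * P) + \<kappa> * 0) / \<kappa>"
        using \<kappa> by (intro tendsto_intros f1 f2 reaction_limit) auto
      also have "(q * (swept / q) + (1 / 2 - 0) * (- (c * (pi * H)) * P) + \<kappa> * 0) / \<kappa> = swept / (2 * \<kappa>)"
        using q \<kappa> unfolding swept_def by (simp add: field_simps)
      finally show ?thesis .
    qed
    fix n :: nat assume n: "n > 0"
    have d: "((\<lambda>z. z\<^sup>2 / 2) has_real_derivative z) (at z)" for z :: real
      by (auto intro!: derivative_eq_intros)
    have "integral (cylinder n) (\<lambda>p. q * (cutoff (radius n) (fst p) * (V p * f (V p)))
        + cutoff' (radius n) (fst p) * (?a p * ((V p)\<^sup>2 / 2))
        + (- \<kappa>) * (cutoff (radius n) (fst p) * ((Vx p)\<^sup>2 + (Vy p)\<^sup>2))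
        + \<kappa> * (cutoff'' (radius n) (fst p) * ((V p)\<^sup>2 / 2))) = 0"
      using weighted_identity[OF n, of "\<lambda>_ _. 1" "\<lambda>_ _. 0" "\<lambda>_ _. 0" "\<lambda>_ _. 0" "\<lambda>_ _. 0" "\<lambda>z. z\<^sup>2 / 2" "\<lambda>z. z" "\<lambda>_. 1"]
      by (simp add: d case_prod_unfold algebra_simps)
    also have "integral (cylinder n) (\<lambda>p. q * (cutoff (radius n) (fst p) * (V p * f (V p)))
        + cutoff' (radius n) (fst p) * (?a p * ((V p)\<^sup>2 / 2))
        + (- \<kappa>) * (cutoff (radius n) (fst p) * ((Vx p)\<^sup>2 + (Vy p)\<^sup>2))
        + \<kappa> * (cutoff'' (radius n) (fst p) * ((V p)\<^sup>2 / 2)))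
        = q * ?f3 n + ?f1 n + (- \<kappa>) * dissipation n + \<kappa> * ?f2 n"
      unfolding dissipation_def integral_mult_right[symmetric]
      by (rule integral_cylinder_add4; intro continuous_intros frame_drift cont comp_V_cont[OF f]; simp)
    finally have e: "\<kappa> * dissipation n = q * ?f3 n + ?f1 n + \<kappa> * ?f2 n" by simp
    have "?f3 n \<le> reaction n"
      unfolding reaction_def
    proof (rule integral_cylinder_mono)
      fix p assume p: "p \<in> cylinder n"
      show "cutoff (radius n) (fst p) * (V p * f (V p)) \<le> cutoff (radius n) (fst p) * f (V p)"
        using range_cylinder[OF p] f_nonneg[OF range_cylinder[OF p]]
        by (intro mult_left_mono cutoff_nonneg[OF n p]) (auto intro: mult_right_le_one_le mult_left_le_one_le)
    qed (intro continuous_intros cont comp_V_cont[OF f])+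
    then have "\<kappa> * dissipation n \<le> q * reaction n + ?f1 n + \<kappa> * ?f2 n"
      unfolding e using q by simp
    then show "dissipation n \<le> (q * reaction n + ?f1 n + \<kappa> * ?f2 n) / \<kappa>"
      using \<kappa> by (simp add: field_simps)
  qed
qed

end

section \<open>Lower bounds for the front speed\<close>

lemma young_abs_mult:
  fixes a b l :: real
  assumes "l > 0"
  shows "\<bar>a * b\<bar> \<le> a\<^sup>2 / (2 * l) + l * b\<^sup>2 / 2"
proof -
  have "0 \<le> (\<bar>a\<bar> - l * \<bar>b\<bar>)\<^sup>2 / (2 * l)" using assms by simp
  also have "\<dots> = a\<^sup>2 / (2 * l) + l * b\<^sup>2 / 2 - \<bar>a\<bar> * \<bar>b\<bar>"
    using assms by (simp add: field_simps power2_diff power_mult_distrib) (simp add: power2_eq_square)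
  finally show ?thesis by (simp add: abs_mult)
qed

locale front_with_step = moving_front +
  fixes G G' G'' :: "real \<Rightarrow> real" and K :: real
  assumes K: "K \<ge> 1"
    and G'c: "continuous_on UNIV G'" and G''c: "continuous_on UNIV G''"
    and dG: "\<And>z. z \<in> {0..1} \<Longrightarrow> (G has_real_derivative G' z) (at z)"
    and dG': "\<And>z. (G' has_real_derivative G'' z) (at z)"
    and G'_sq: "\<And>z. z \<in> {0..1} \<Longrightarrow> (G' z)\<^sup>2 \<le> K * f z"
    and G'_le: "\<And>z. z \<in> {0..1} \<Longrightarrow> \<bar>G' z\<bar> \<le> K" and G''_le: "\<And>z. z \<in> {0..1} \<Longrightarrow> \<bar>G'' z\<bar> \<le> K"
    and G_0: "\<And>z. z \<in> {0..1} \<Longrightarrow> \<bar>G z\<bar> \<le> K * z" and G_1: "\<And>z. z \<in> {0..1} \<Longrightarrow> \<bar>G z - 1\<bar> \<le> K * (1 - z)"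
    and G'_0: "\<And>z. z \<in> {0..1} \<Longrightarrow> (G' z)\<^sup>2 \<le> K * z" and G'_1: "\<And>z. z \<in> {0..1} \<Longrightarrow> (G' z)\<^sup>2 \<le> K * (1 - z)"
begin

lemma step_cont: "continuous_on {0..1} G" "continuous_on {0..1} G'" "continuous_on {0..1} G''"
proof -
  show "continuous_on {0..1} G"
    by (intro continuous_at_imp_continuous_on ballI DERIV_isCont[OF dG])
  show "continuous_on {0..1} G'" "continuous_on {0..1} G''"
    using continuous_on_subset[OF G'c] continuous_on_subset[OF G''c] by simp_all
qed

lemmas comp_step = comp_V_cont[OF step_cont(1)] comp_V_cont[OF step_cont(2)] comp_V_cont[OF step_cont(3)] comp_V_cont[OF f]

text \<open>Young's inequality with a free length \<open>l\<close>. Through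
  \<open>(G')\<^sup>2 \<le> K f\<close> the gradient of \<open>G (V p)\<close> is paid for by
  reaction and dissipation, the two quantities that \<open>c\<close> controls.\<close>

lemma step_gradient:
  assumes "l > 0" "p \<in> cylinder n"
  shows "\<bar>G' (V p) * Vx p\<bar> \<le> K * f (V p) / (2 * l) + l * (Vx p)\<^sup>2 / 2"
    "\<bar>G' (V p) * Vy p\<bar> \<le> K * f (V p) / (2 * l) + l * (Vy p)\<^sup>2 / 2"
proof -
  have "(G' (V p))\<^sup>2 / (2 * l) \<le> K * f (V p) / (2 * l)"
    using G'_sq[OF range_cylinder[OF assms(2)]] assms(1) by (intro divide_right_mono) auto
  then show "\<bar>G' (V p) * Vx p\<bar> \<le> K * f (V p) / (2 * l) + l * (Vx p)\<^sup>2 / 2"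
    "\<bar>G' (V p) * Vy p\<bar> \<le> K * f (V p) / (2 * l) + l * (Vy p)\<^sup>2 / 2"
    using young_abs_mult[OF assms(1), of "G' (V p)" "Vx p"] young_abs_mult[OF assms(1), of "G' (V p)" "Vy p"] by linarith+
qed

lemma integral_cylinder_diff_zero:
  fixes g h :: "real \<times> real \<times> real \<Rightarrow> real"
  assumes "continuous_on strip g" "continuous_on strip h" "integral (cylinder n) (\<lambda>p. g p + h p) = 0"
  shows "integral (cylinder n) g = integral (cylinder n) (\<lambda>p. - h p)"
  using assms by (simp add: integral_cylinder_add)

lemma mult_reaction:
  "integral (cylinder n) (\<lambda>p. cutoff (radius n) (fst p) * (A * f (V p) + B * ((Vx p)\<^sup>2 + (Vy p)\<^sup>2)))
     = A * reaction n + B * dissipation n"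
proof -
  have "integral (cylinder n) (\<lambda>p. cutoff (radius n) (fst p) * (A * f (V p) + B * ((Vx p)\<^sup>2 + (Vy p)\<^sup>2)))
    = integral (cylinder n) (\<lambda>p. A * (cutoff (radius n) (fst p) * f (V p))
       + B * (cutoff (radius n) (fst p) * ((Vx p)\<^sup>2 + (Vy p)\<^sup>2)))"
    by (simp add: algebra_simps)
  also have "\<dots> = A * reaction n + B * dissipation n"
    unfolding reaction_def dissipation_def integral_mult_right[symmetric]
    by (rule integral_cylinder_add; intro continuous_intros cont comp_step)
  finally show ?thesis .
qed

text \<open>The weight is zero and the test field is the constant \<open>b = 1\<close>, so the
  identity only records the drop of \<open>G (V p)\<close> by one across the front. For
  \<open>l = \<kappa> / v0\<close> the right-hand side becomes a multiple of
  \<open>(c / v0) * (pi * H * P)\<close>, which yields \<open>c \<ge> C v0\<close>.\<close>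

lemma burning_bound:
  assumes l: "l > 0"
  shows "pi * H * P \<le> K * swept / (2 * l * q) + l * swept / (4 * \<kappa>)"
proof -
  let ?f1 = "\<lambda>n. integral (cylinder n) (\<lambda>p. cutoff' (radius n) (fst p) * (1 * G (V p)))"
  have f1: "?f1 \<longlonglongrightarrow> (1 - 0) * (pi * H * P)"
    by (rule flux_limit[where A = 1]) (use G_0 G_1 H step_cont in \<open>auto intro!: continuous_intros\<close>)
  obtain r where r: "r \<longlonglongrightarrow> swept / (2 * \<kappa>)" "\<And>n. n > 0 \<Longrightarrow> dissipation n \<le> r n"
    using dissipation_bound by blast
  have "?f1 n \<le> K / (2 * l) * reaction n + l / 2 * r n" if n: "n > 0" for n
  proof -
    have "integral (cylinder n) (\<lambda>p. cutoff' (radius n) (fst p) * (1 * G (V p))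
        + cutoff (radius n) (fst p) * (G' (V p) * Vx p)) = 0"
      using weighted_identity[OF n, of "\<lambda>_ _. 0" "\<lambda>_ _. 0" "\<lambda>_ _. 0" "\<lambda>_ _. 1" "\<lambda>_ _. 0" G G' G''] dG dG' step_cont(3)
      by (simp add: case_prod_unfold mult.assoc)
    then have "?f1 n = integral (cylinder n) (\<lambda>p. - (cutoff (radius n) (fst p) * (G' (V p) * Vx p)))"
      by (intro integral_cylinder_diff_zero continuous_intros cont comp_step)
    also have "\<dots> \<le> integral (cylinder n) (\<lambda>p. cutoff (radius n) (fst p) * (K / (2 * l) * f (V p) + l / 2 * ((Vx p)\<^sup>2 + (Vy p)\<^sup>2)))"
    proof (rule integral_cylinder_mono)
      fix p assume p: "p \<in> cylinder n"
      have "- (G' (V p) * Vx p) \<le> K / (2 * l) * f (V p) + l / 2 * (Vx p)\<^sup>2"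
        using step_gradient(1)[OF l p] by simp
      also have "\<dots> \<le> K / (2 * l) * f (V p) + l / 2 * ((Vx p)\<^sup>2 + (Vy p)\<^sup>2)"
        using l by simp
      finally have "cutoff (radius n) (fst p) * (- (G' (V p) * Vx p)) \<le> cutoff (radius n) (fst p) * (K / (2 * l) * f (V p) + l / 2 * ((Vx p)\<^sup>2 + (Vy p)\<^sup>2))"
        by (intro mult_left_mono cutoff_nonneg[OF n p])
      then show "- (cutoff (radius n) (fst p) * (G' (V p) * Vx p)) \<le> cutoff (radius n) (fst p) * (K / (2 * l) * f (V p) + l / 2 * ((Vx p)\<^sup>2 + (Vy p)\<^sup>2))"
        by simp
    qed (intro continuous_intros cont comp_step)+
    also have "\<dots> = K / (2 * l) * reaction n + l / 2 * dissipation n"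
      by (rule mult_reaction)
    also have "\<dots> \<le> K / (2 * l) * reaction n + l / 2 * r n"
      using r(2)[OF n] l by (simp add: mult_left_mono)
    finally show ?thesis .
  qed
  then have ev: "\<forall>\<^sub>F n in sequentially. ?f1 n \<le> K / (2 * l) * reaction n + l / 2 * r n"
    by (intro eventually_mono[OF eventually_gt_at_top[of 0]]) simp
  have "(\<lambda>n. K / (2 * l) * reaction n + l / 2 * r n) \<longlonglongrightarrow> K / (2 * l) * (swept / q) + l / 2 * (swept / (2 * \<kappa>))"
    by (intro tendsto_intros reaction_limit r(1))
  from tendsto_le[OF sequentially_bot this f1 ev]
  show ?thesis by simp
qed

section \<open>The share of the reaction zone inside the separatrix layers\<close>

definition layer_reaction :: "real \<Rightarrow> nat \<Rightarrow> real" where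
  "layer_reaction d n = integral (cylinder n) (\<lambda>p. cutoff (radius n) (fst p) *
     (layer_flux H d (fst p + c * snd (snd p)) (fst (snd p)) * (G' (V p))\<^sup>2))"

text \<open>The layer weight is at most \<open>2 d (1 + H m_x)\<close> with \<open>m\<close> the
  bounded angle defect. The constant part contributes the share of order \<open>d\<close>; in the
  other part the \<open>x\<close>-derivative is moved onto \<open>(G')\<^sup>2\<close>, where
  \<open>G' V_x\<close> is paid for by reaction and dissipation. So the reaction zone can sit inside
  the layers only at the price of a steep gradient. The sequence \<open>e\<close> collects the end
  terms of the cutoff.\<close>

lemma layer_reaction_bound:
  assumes d: "d > 0" and l: "l > 0"
  obtains e where "e \<longlonglongrightarrow> (0::real)"
    "\<And>n. n > 0 \<Longrightarrow> layer_reaction d n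
        \<le> (2 * d * K + 4 * d * H * K\<^sup>2 / l) * reaction n + 4 * d * H * K * l * dissipation n + e n"
proof -
  let ?X = "\<lambda>p :: real \<times> real \<times> real. fst p + c * snd (snd p)" and ?y = "\<lambda>p :: real \<times> real \<times> real. fst (snd p)"
  let ?g = "\<lambda>p. (G' (V p))\<^sup>2" and ?gx = "\<lambda>p. 2 * G' (V p) * (G'' (V p) * Vx p)"
  let ?m = "\<lambda>p. angle_defect H d (?X p) (?y p)" and ?mx = "\<lambda>p. angle_defect_x H d (?X p) (?y p)"
  let ?e = "\<lambda>n. integral (cylinder n) (\<lambda>p. \<bar>cutoff' (radius n) (fst p)\<bar> * (G' (V p))\<^sup>2)"
  have e: "?e \<longlonglongrightarrow> 0"
    by (rule abs_flux_limit[where K = K]) (use G'_0 G'_1 step_cont(2) in \<open>auto intro!: continuous_intros\<close>)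
  have X: "continuous_on strip ?X" and y: "continuous_on strip ?y" by (intro continuous_intros)+
  have mc: "continuous_on strip ?m" "continuous_on strip ?mx"
    by (rule angle_defect_continuous[OF H d X y]; auto)+
  have Wc: "continuous_on strip (\<lambda>p. layer_flux H d (?X p) (?y p))"
    by (rule layer_continuous[OF H d X y])
  show thesis
  proof (rule that)
    show "(\<lambda>n. 4 * d * H * ?e n) \<longlonglongrightarrow> 0"
      using tendsto_mult_left[OF e, of "4 * d * H"] by simp
    fix n :: nat assume n: "n > 0"
    let ?R = "radius n"
    let ?\<phi> = "\<lambda>p :: real \<times> real \<times> real. cutoff ?R (fst p)" and ?\<phi>' = "\<lambda>p :: real \<times> real \<times> real. cutoff' ?R (fst p)"
    have R: "?R > 0" using n H by simp
    \<comment> \<open>The \<open>x\<close>-derivative of cutoff times \<open>(G')\<^sup>2\<close>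
      times angle defect; it integrates to zero because the cutoff vanishes at both ends.\<close>
    define S where "S = (\<lambda>p. ?\<phi> p * ?g p * ?mx p + (?\<phi>' p * ?g p + ?\<phi> p * ?gx p) * ?m p)"
    have Sc: "continuous_on strip S"
      unfolding S_def by (intro continuous_intros cont comp_step mc)
    have S0: "integral (cylinder n) S = 0"
      unfolding cylinder_def
    proof (rule box_flux_zero[of "- ?R" ?R "pi * H" P S "\<lambda>_. 0" "\<lambda>_. 0" S "\<lambda>_. 0" "\<lambda>_. 0"
          "\<lambda>p. ?\<phi> p * ?g p * ?m p"])
      show "continuous_on ({- ?R..?R} \<times> {0<..<pi * H} \<times> {0..P}) S"
        by (rule continuous_on_subset[OF Sc]) auto
      show "continuous_on ({- ?R..?R} \<times> {0..pi * H} \<times> {0..P}) S"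
        by (rule continuous_on_subset[OF Sc]) auto
    next
      fix x y t :: real assume y: "y \<in> {0<..<pi * H}"
      let ?p = "(x, y, t)"
      have y': "y \<in> {0..pi * H}" using y by auto
      have gx: "((\<lambda>x. (G' (V (x, y, t)))\<^sup>2) has_real_derivative ?gx ?p) (at x)"
        by (rule DERIV_chain2[OF dG' dVx[OF y]] derivative_eq_intros refl)+ simp
      have Xx: "((\<lambda>x. x + c * t) has_real_derivative 1) (at x)" by (auto intro!: derivative_eq_intros)
      have mx: "((\<lambda>x. angle_defect H d (x + c * t) y) has_real_derivative angle_defect_x H d (x + c * t) y) (at x)"
        using DERIV_chain2[OF angle_defect_derivative[OF H d y'] Xx] by simp
      show "((\<lambda>x. ?\<phi> (x, y, t) * ?g (x, y, t) * ?m (x, y, t)) has_real_derivative S ?p) (at x)"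
        unfolding S_def fst_conv snd_conv
        by (rule gx mx cutoff_derivs derivative_eq_intros refl)+ (simp add: algebra_simps)
    next
      fix y t :: real
      show "?\<phi> (?R, y, t) * ?g (?R, y, t) * ?m (?R, y, t) = ?\<phi> (- ?R, y, t) * ?g (- ?R, y, t) * ?m (- ?R, y, t)"
        by (simp only: fst_conv snd_conv cutoff_ends[OF less_imp_neq[OF R, symmetric]])
    qed (use R H P in \<open>auto intro!: continuous_intros\<close>)
    have "layer_reaction d n \<le> integral (cylinder n) (\<lambda>p. ?\<phi> p * (2 * d * ?g p) + 2 * d * H * (?\<phi> p * ?g p * ?mx p))"
      unfolding layer_reaction_def
    proof (rule integral_cylinder_mono)
      fix p assume p: "p \<in> cylinder n"
      have "layer_flux H d (?X p) (?y p) * ?g p \<le> 2 * d * (1 + H * ?mx p) * ?g p"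
        by (intro mult_right_mono layer_flux_le_angle_defect[OF H d cylinder_y[OF p]]) auto
      then have "?\<phi> p * (layer_flux H d (?X p) (?y p) * ?g p) \<le> ?\<phi> p * (2 * d * (1 + H * ?mx p) * ?g p)"
        by (intro mult_left_mono cutoff_nonneg[OF n p])
      then show "?\<phi> p * (layer_flux H d (?X p) (?y p) * ?g p)
          \<le> ?\<phi> p * (2 * d * ?g p) + 2 * d * H * (?\<phi> p * ?g p * ?mx p)"
        by (simp add: algebra_simps)
    qed (intro continuous_intros cont comp_step mc Wc)+
    \<comment> \<open>Subtracting the vanishing integral of \<open>S\<close> cancels the
      unbounded-in-\<open>1/d\<close> derivative \<open>?mx\<close> and leaves only
      \<open>?m\<close>, which is at most \<open>2\<close> in modulus.\<close>
    also have "\<dots> = integral (cylinder n) (\<lambda>p. ?\<phi> p * (2 * d * ?g p) + 2 * d * H * (?\<phi> p * ?g p * ?mx p)) 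
        - 2 * d * H * integral (cylinder n) S" using S0 by simp
    also have "\<dots> = integral (cylinder n) (\<lambda>p. (?\<phi> p * (2 * d * ?g p) + 2 * d * H * (?\<phi> p * ?g p * ?mx p)) - 2 * d * H * S p)"
      unfolding integral_mult_right[symmetric]
      by (rule integral_diff[symmetric]; intro integrable_cylinder continuous_intros cont comp_step mc Sc)
    also have "\<dots> \<le> integral (cylinder n) (\<lambda>p. ?\<phi> p * ((2 * d * K + 4 * d * H * K\<^sup>2 / l) * f (V p) + 4 * d * H * K * l * ((Vx p)\<^sup>2 + (Vy p)\<^sup>2))
        + 4 * d * H * (\<bar>?\<phi>' p\<bar> * ?g p))"
    proof (rule integral_cylinder_mono)
      fix p assume p: "p \<in> cylinder n"
      note v = range_cylinder[OF p]
      have absb: "u * - w \<le> \<bar>u\<bar> * \<bar>w\<bar>" for u w :: real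
        using abs_ge_self[of "u * - w"] by (simp add: abs_mult)
      have g: "?g p \<le> K * f (V p)" by (rule G'_sq[OF v])
      have gx: "\<bar>?gx p\<bar> \<le> K * (K * f (V p) / l + l * ((Vx p)\<^sup>2 + (Vy p)\<^sup>2))"
      proof -
        have "\<bar>?gx p\<bar> = 2 * (\<bar>G'' (V p)\<bar> * \<bar>G' (V p) * Vx p\<bar>)" by (simp add: abs_mult)
        also have "\<dots> \<le> 2 * (K * (K * f (V p) / (2 * l) + l * (Vx p)\<^sup>2 / 2))"
          using K by (intro mult_left_mono mult_mono G''_le[OF v] step_gradient(1)[OF l p]) auto
        also have "\<dots> = K * (K * f (V p) / l + l * (Vx p)\<^sup>2)" by (simp add: field_simps)
        also have "\<dots> \<le> K * (K * f (V p) / l + l * ((Vx p)\<^sup>2 + (Vy p)\<^sup>2))"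
          using K l by (intro mult_left_mono add_left_mono) auto
        finally show ?thesis .
      qed
      have "(?\<phi>' p * ?g p + ?\<phi> p * ?gx p) * - ?m p \<le> \<bar>?\<phi>' p * ?g p + ?\<phi> p * ?gx p\<bar> * \<bar>?m p\<bar>"
        by (rule absb)
      also have "\<dots> \<le> (\<bar>?\<phi>' p\<bar> * ?g p + ?\<phi> p * \<bar>?gx p\<bar>) * 2"
      proof (intro mult_mono angle_defect_bound)
        show "\<bar>?\<phi>' p * ?g p + ?\<phi> p * ?gx p\<bar> \<le> \<bar>?\<phi>' p\<bar> * ?g p + ?\<phi> p * \<bar>?gx p\<bar>"
          using abs_triangle_ineq[of "?\<phi>' p * ?g p" "?\<phi> p * ?gx p"] cutoff_nonneg[OF n p]
          by (simp add: abs_mult)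
        show "0 \<le> \<bar>?\<phi>' p\<bar> * ?g p + ?\<phi> p * \<bar>?gx p\<bar>" using cutoff_nonneg[OF n p] by simp
      qed (use H d in auto)
      also have "\<dots> \<le> (\<bar>?\<phi>' p\<bar> * ?g p + ?\<phi> p * (K * (K * f (V p) / l + l * ((Vx p)\<^sup>2 + (Vy p)\<^sup>2)))) * 2"
        by (intro mult_right_mono add_left_mono mult_left_mono gx cutoff_nonneg[OF n p]) auto
      finally have 1: "2 * d * H * ((?\<phi>' p * ?g p + ?\<phi> p * ?gx p) * - ?m p)
          \<le> 2 * d * H * ((\<bar>?\<phi>' p\<bar> * ?g p + ?\<phi> p * (K * (K * f (V p) / l + l * ((Vx p)\<^sup>2 + (Vy p)\<^sup>2)))) * 2)"
        using d H by (intro mult_left_mono) auto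
      have "?\<phi> p * (2 * d * ?g p) \<le> ?\<phi> p * (2 * d * (K * f (V p)))"
        using d by (intro mult_left_mono g cutoff_nonneg[OF n p]) auto
      with 1 show "?\<phi> p * (2 * d * ?g p) + 2 * d * H * (?\<phi> p * ?g p * ?mx p) - 2 * d * H * S p
          \<le> ?\<phi> p * ((2 * d * K + 4 * d * H * K\<^sup>2 / l) * f (V p) + 4 * d * H * K * l * ((Vx p)\<^sup>2 + (Vy p)\<^sup>2))
            + 4 * d * H * (\<bar>?\<phi>' p\<bar> * ?g p)"
        unfolding S_def by (simp add: algebra_simps power2_eq_square)
    qed (intro continuous_intros cont comp_step mc Sc)+
    also have "\<dots> = (2 * d * K + 4 * d * H * K\<^sup>2 / l) * reaction n + 4 * d * H * K * l * dissipation n + 4 * d * H * ?e n"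
      unfolding mult_reaction[symmetric] integral_mult_right[symmetric]
      by (rule integral_cylinder_add; intro continuous_intros cont comp_step)
    finally show "layer_reaction d n
        \<le> (2 * d * K + 4 * d * H * K\<^sup>2 / l) * reaction n + 4 * d * H * K * l * dissipation n + 4 * d * H * ?e n" .
  qed
qed

text \<open>On the left is the drop of \<open>G\<close> by one, carried by the total flux of the
  test field over a period. On the right, the terms with \<epsilon> are the cost of the layers,
  split by Young's inequality into dissipation and \<open>layer_reaction\<close>; all others are the
  cost of the tubes: the source, diffusion against the gradient of the weight, and the second
  derivative of \<open>G\<close>. The numbers \<open>d\<close> and \<epsilon> stay free until both
  costs are balanced.\<close>

lemma tube_inequality:
  assumes U0: "U0 > 0" and d: "d > 0" and l: "l > 0" and \<epsilon>: "\<epsilon> > 0"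
  shows "U0 * (d\<^sup>2 * H) * P \<le> (q * d * K + 3 * \<kappa> * K / (H * l)) * (swept / q)
    + (3 * \<kappa> * l / (2 * H) + U0 * d\<^sup>2 * \<epsilon> / 4 + \<kappa> * d * K) * (swept / (2 * \<kappa>))
    + U0 * d\<^sup>2 / (4 * \<epsilon>) * ((2 * d * K + 4 * d * H * K\<^sup>2 / l) * (swept / q) + 4 * d * H * K * l * (swept / (2 * \<kappa>)))"
proof -
  let ?X = "\<lambda>p :: real \<times> real \<times> real. fst p + c * snd (snd p)" and ?y = "\<lambda>p :: real \<times> real \<times> real. fst (snd p)"
  let ?t = "\<lambda>p. tube H d (?X p) (?y p)" and ?tx = "\<lambda>p. tube_x H d (?X p) (?y p)" and ?ty = "\<lambda>p. tube_y H d (?X p) (?y p)"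
  let ?W = "\<lambda>p. layer_flux H d (?X p) (?y p)"
  let ?u = "\<lambda>p. U0 * sin (?X p / H) * cos (?y p / H) - c"
  let ?a = "\<lambda>p. ?t p * ?u p + U0 * d\<^sup>2 / 2 * ?W p"
  let ?f1 = "\<lambda>n. integral (cylinder n) (\<lambda>p. cutoff' (radius n) (fst p) * (?a p * G (V p)))"
  let ?f2 = "\<lambda>n. integral (cylinder n) (\<lambda>p. cutoff'' (radius n) (fst p) * (?t p * G (V p)))"
  let ?f3 = "\<lambda>n. integral (cylinder n) (\<lambda>p. cutoff' (radius n) (fst p) * (?tx p * G (V p)))"
  let ?A1 = "q * d * K + 3 * \<kappa> * K / (H * l)"
  let ?A2 = "3 * \<kappa> * l / (2 * H) + U0 * d\<^sup>2 * \<epsilon> / 4 + \<kappa> * d * K"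
  let ?A3 = "U0 * d\<^sup>2 / (4 * \<epsilon>)"
  have A: "?A1 > 0" "?A2 > 0" "?A3 > 0"
    using q d K \<kappa> H l U0 \<epsilon> by (auto intro!: add_pos_pos)
  have X: "continuous_on S ?X" and y: "continuous_on S ?y" for S by (intro continuous_intros)+
  note wc = layer_continuous[OF H d X y]
  have ac: "continuous_on strip ?a"
    by (intro continuous_on_add continuous_on_mult continuous_on_const wc frame_drift(1))
  have bnd_W: "\<bar>?W p\<bar> \<le> 1" if "p \<in> strip" for p
    using layer_flux_bounds[OF H d, of "?y p" "?X p"] that by (auto simp: abs_le_iff)
  have f1: "?f1 \<longlonglongrightarrow> (1 - 0) * (U0 * (d\<^sup>2 * H) * P)"
  proof (rule flux_limit[where A = "d * (\<bar>U0\<bar> + \<bar>c\<bar>) + U0 * d\<^sup>2 / 2 * 1", OF ac])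
    show "\<bar>?a p\<bar> \<le> d * (\<bar>U0\<bar> + \<bar>c\<bar>) + U0 * d\<^sup>2 / 2 * 1" if "p \<in> strip" for p
    proof -
      have "\<bar>?t p * ?u p\<bar> \<le> d * (\<bar>U0\<bar> + \<bar>c\<bar>)"
        unfolding abs_mult using tube_bounds(1)[OF H d] frame_drift(2) d by (intro mult_mono) auto
      moreover have "\<bar>U0 * d\<^sup>2 / 2 * ?W p\<bar> \<le> U0 * d\<^sup>2 / 2 * 1"
        unfolding abs_mult using bnd_W[OF that] U0 by (intro mult_mono) auto
      ultimately show ?thesis by linarith
    qed
    \<comment> \<open>The mean of the weight is the total flux of the test field; the frame speed
      drops out because the tube weight has mean zero.\<close>
    show "integral {0..pi * H} (\<lambda>y. ?a (x, y, t)) = U0 * (d\<^sup>2 * H)" for x t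
    proof -
      let ?x = "x + c * t"
      let ?s = "\<lambda>y. sin (?x / H) * cos (y / H) * tube H d ?x y + d\<^sup>2 / 2 * layer_flux H d ?x y"
      have i1: "?s integrable_on {0..pi * H}"
        by (intro integrable_continuous_real continuous_intros layer_continuous[OF H d]; use H in simp)
      have i2: "(\<lambda>y. tube H d ?x y) integrable_on {0..pi * H}"
        by (intro integrable_continuous_real continuous_intros layer_continuous[OF H d])
      have "integral {0..pi * H} (\<lambda>y. ?a (x, y, t)) = integral {0..pi * H} (\<lambda>y. U0 * ?s y - c * tube H d ?x y)"
        by (simp add: algebra_simps)
      also have "\<dots> = integral {0..pi * H} (\<lambda>y. U0 * ?s y) - integral {0..pi * H} (\<lambda>y. c * tube H d ?x y)"
        by (intro integral_diff integrable_on_mult_right i1 i2)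
      also have "\<dots> = U0 * (d\<^sup>2 * H)"
        unfolding integral_mult_right total_flux[OF H d] tube_mean_zero[OF H d] by simp
      finally show ?thesis .
    qed
  qed (use G_0 G_1 step_cont in auto)
  have f2: "?f2 \<longlonglongrightarrow> 0"
  proof (rule second_cutoff_limit[where A = "1 * K"])
    show "continuous_on strip (\<lambda>p. ?t p * G (V p))" by (intro continuous_on_mult wc comp_step)
    show "\<bar>?t p * G (V p)\<bar> \<le> 1 * K" if "p \<in> strip" for p
    proof -
      have "\<bar>G (V p)\<bar> \<le> K * V p" by (rule G_0[OF range[OF that]])
      also have "\<dots> \<le> K" using range[OF that] K by (simp add: mult_left_le)
      finally show ?thesis unfolding abs_mult using tube_bounds(2)[OF H d] by (intro mult_mono) auto
    qed
  qed
  have f3: "?f3 \<longlonglongrightarrow> (1 - 0) * (0 * P)"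
  proof (rule flux_limit[where A = "3 / H", OF wc(4)])
    show "integral {0..pi * H} (\<lambda>y. ?tx (x, y, t)) = 0" for x t
      using tube_mean_zero(2)[OF H d] by simp
  qed (use G_0 G_1 step_cont tube_bounds(3)[OF H d] in auto)
  obtain r where r: "r \<longlonglongrightarrow> swept / (2 * \<kappa>)" "\<And>n. n > 0 \<Longrightarrow> dissipation n \<le> r n"
    using dissipation_bound by blast
  let ?Q1 = "2 * d * K + 4 * d * H * K\<^sup>2 / l" and ?Q2 = "4 * d * H * K * l"
  obtain e where e: "e \<longlonglongrightarrow> (0::real)"
    "\<And>n. n > 0 \<Longrightarrow> layer_reaction d n \<le> ?Q1 * reaction n + ?Q2 * dissipation n + e n"
    using layer_reaction_bound[OF d l] by blast
  let ?B = "\<lambda>n. ?A1 * reaction n + ?A2 * r n + ?A3 * (?Q1 * reaction n + ?Q2 * r n + e n)"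
  have "?f1 n + \<kappa> * ?f2 n + \<kappa> * ?f3 n \<le> ?B n" if n: "n > 0" for n
  proof -
    let ?\<phi> = "\<lambda>p :: real \<times> real \<times> real. cutoff (radius n) (fst p)"
    let ?S = "\<lambda>p. q * ?t p * G' (V p) * f (V p) - \<kappa> * G' (V p) * (?tx p * Vx p + ?ty p * Vy p)
      + U0 * d\<^sup>2 / 2 * ?W p * G' (V p) * Vx p - \<kappa> * ?t p * G'' (V p) * ((Vx p)\<^sup>2 + (Vy p)\<^sup>2)"
    have Sc: "continuous_on strip ?S" by (intro continuous_intros wc cont comp_step H d)
    let ?T = "\<lambda>p. cutoff' (radius n) (fst p) * (?a p * G (V p))
        + \<kappa> * (cutoff'' (radius n) (fst p) * (?t p * G (V p)))
        + \<kappa> * (cutoff' (radius n) (fst p) * (?tx p * G (V p))) + ?\<phi> p * ?S p"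
    have zero: "integral (cylinder n) ?T = 0"
    proof -
      have "U0 * sin (x / H) * cos (y / H) * tube_x H d x y - U0 * cos (x / H) * sin (y / H) * tube_y H d x y
          = - (U0 * d\<^sup>2 / 2 * layer_flux_x H d x y)" for x y
        using arg_cong[OF tube_transport[OF H d, of x y], of "\<lambda>z. U0 * z"] by (simp add: algebra_simps)
      moreover have "((\<lambda>x. U0 * d\<^sup>2 / 2 * layer_flux H d x y) has_real_derivative U0 * d\<^sup>2 / 2 * layer_flux_x H d x y) (at x)" for x y
        by (rule DERIV_cmult[OF layer_flux_derivative[OF H d]])
      ultimately have "integral (cylinder n) (\<lambda>(x, y, t).
          q * cutoff (radius n) x * tube H d (x + c * t) y * G' (V (x, y, t)) * f (V (x, y, t))
          + cutoff' (radius n) x * (tube H d (x + c * t) y * (U0 * sin ((x + c * t) / H) * cos (y / H) - c)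
              + U0 * d\<^sup>2 / 2 * layer_flux H d (x + c * t) y) * G (V (x, y, t))
          - \<kappa> * cutoff (radius n) x * G' (V (x, y, t)) * (tube_x H d (x + c * t) y * Vx (x, y, t) + tube_y H d (x + c * t) y * Vy (x, y, t))
          + cutoff (radius n) x * (U0 * d\<^sup>2 / 2 * layer_flux H d (x + c * t) y) * G' (V (x, y, t)) * Vx (x, y, t)
          - \<kappa> * cutoff (radius n) x * tube H d (x + c * t) y * G'' (V (x, y, t)) * ((Vx (x, y, t))\<^sup>2 + (Vy (x, y, t))\<^sup>2)
          + \<kappa> * cutoff'' (radius n) x * tube H d (x + c * t) y * G (V (x, y, t))
          + \<kappa> * cutoff' (radius n) x * tube_x H d (x + c * t) y * G (V (x, y, t))) = 0"
        by (intro weighted_identity[OF n, where \<Phi>y = "tube_y H d" and bx = "\<lambda>x y. U0 * d\<^sup>2 / 2 * layer_flux_x H d x y"]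
            layer_continuous[OF H d] continuous_on_mult continuous_on_const
            tube_derivatives[OF H d] tube_periodic[OF H d] dG dG' step_cont) (use H d in simp_all)
      then show ?thesis
        by (simp add: case_prod_unfold algebra_simps)
    qed
    have "integral (cylinder n) ?T = integral (cylinder n) (\<lambda>p. cutoff' (radius n) (fst p) * (?a p * G (V p)))
        + integral (cylinder n) (\<lambda>p. \<kappa> * (cutoff'' (radius n) (fst p) * (?t p * G (V p))))
        + integral (cylinder n) (\<lambda>p. \<kappa> * (cutoff' (radius n) (fst p) * (?tx p * G (V p))))
        + integral (cylinder n) (\<lambda>p. ?\<phi> p * ?S p)"
      by (rule integral_cylinder_add4; intro continuous_on_mult continuous_on_const cutoff_continuous
            continuous_on_fst continuous_on_id ac wc comp_step Sc)
    then have "?f1 n + \<kappa> * ?f2 n + \<kappa> * ?f3 n + integral (cylinder n) (\<lambda>p. ?\<phi> p * ?S p) = 0"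
      unfolding zero integral_mult_right by (rule sym)
    then have "?f1 n + \<kappa> * ?f2 n + \<kappa> * ?f3 n = integral (cylinder n) (\<lambda>p. - (?\<phi> p * ?S p))"
      unfolding integral_neg by linarith
    also have "\<dots> \<le> integral (cylinder n) (\<lambda>p. ?\<phi> p * (?A1 * f (V p) + ?A2 * ((Vx p)\<^sup>2 + (Vy p)\<^sup>2)) + ?A3 * (?\<phi> p * (?W p * (G' (V p))\<^sup>2)))"
    proof (rule integral_cylinder_mono)
      fix p assume p: "p \<in> cylinder n"
      note v = range_cylinder[OF p]
      define g where "g = G' (V p)"
      define vx where "vx = Vx p"
      define vy where "vy = Vy p"
      define F where "F = f (V p)"
      define w where "w = ?W p"
      have F: "F \<ge> 0" unfolding F_def by (rule f_nonneg[OF v])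
      have w: "0 \<le> w" "w \<le> 1" unfolding w_def using layer_flux_bounds[OF H d cylinder_y[OF p]] by auto
      have gx: "\<bar>g * vx\<bar> \<le> K * F / (2 * l) + l * vx\<^sup>2 / 2" and gy: "\<bar>g * vy\<bar> \<le> K * F / (2 * l) + l * vy\<^sup>2 / 2"
        unfolding g_def vx_def vy_def F_def by (rule step_gradient[OF l p])+
      have 1: "- (q * ?t p * g * F) \<le> q * d * K * F"
      proof -
        have "\<bar>?t p * g\<bar> \<le> d * K"
          unfolding abs_mult g_def using tube_bounds(1)[OF H d] G'_le[OF v] d by (intro mult_mono) auto
        then have "- (?t p * g) * (q * F) \<le> d * K * (q * F)" using q F by (intro mult_right_mono) auto
        then show ?thesis by (simp add: mult_ac)
      qed
      have 2: "\<kappa> * g * (?tx p * vx + ?ty p * vy) \<le> 3 * \<kappa> * K / (H * l) * F + 3 * \<kappa> * l / (2 * H) * (vx\<^sup>2 + vy\<^sup>2)"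
      proof -
        have "?tx p * (g * vx) \<le> 3 / H * (K * F / (2 * l) + l * vx\<^sup>2 / 2)" 
          using mult_mono[OF tube_bounds(3)[OF H d, of "?X p" "?y p"] gx] H abs_ge_self[of "?tx p * (g * vx)"] by (simp add: abs_mult)
        moreover have "?ty p * (g * vy) \<le> 3 / H * (K * F / (2 * l) + l * vy\<^sup>2 / 2)" 
          using mult_mono[OF tube_bounds(4)[OF H d, of "?X p" "?y p"] gy] H abs_ge_self[of "?ty p * (g * vy)"] by (simp add: abs_mult)
        ultimately have "?tx p * (g * vx) + ?ty p * (g * vy)
            \<le> 3 / H * (K * F / (2 * l) + l * vx\<^sup>2 / 2) + 3 / H * (K * F / (2 * l) + l * vy\<^sup>2 / 2)" by linarith
        then have "\<kappa> * (?tx p * (g * vx) + ?ty p * (g * vy))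
            \<le> \<kappa> * (3 / H * (K * F / (2 * l) + l * vx\<^sup>2 / 2) + 3 / H * (K * F / (2 * l) + l * vy\<^sup>2 / 2))"
          using \<kappa> by (intro mult_left_mono) auto
        also have "\<dots> = 3 * \<kappa> * K / (H * l) * F + 3 * \<kappa> * l / (2 * H) * (vx\<^sup>2 + vy\<^sup>2)"
          using H l by (simp add: field_simps)
        finally show ?thesis by (simp add: algebra_simps)
      qed
      \<comment> \<open>The layer term. As \<open>w \<le> 1\<close>, the square of the layer weight
        from Young's inequality is replaced by its first power, the weight that occurs in
        \<open>layer_reaction\<close>.\<close>
      have 3: "- (U0 * d\<^sup>2 / 2 * w * g * vx) \<le> ?A3 * (w * g\<^sup>2) + U0 * d\<^sup>2 * \<epsilon> / 4 * (vx\<^sup>2 + vy\<^sup>2)"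
      proof -
        have "w\<^sup>2 * g\<^sup>2 \<le> w * g\<^sup>2" using w by (intro mult_right_mono) (auto simp: power2_eq_square mult_left_le)
        then have "(w * g)\<^sup>2 / (2 * \<epsilon>) \<le> w * g\<^sup>2 / (2 * \<epsilon>)"
          using \<epsilon> by (intro divide_right_mono) (auto simp: power_mult_distrib)
        moreover have "- (w * g * vx) \<le> (w * g)\<^sup>2 / (2 * \<epsilon>) + \<epsilon> * vx\<^sup>2 / 2"
          using young_abs_mult[OF \<epsilon>, of "w * g" vx] by linarith
        moreover have "\<epsilon> * vx\<^sup>2 / 2 \<le> \<epsilon> * (vx\<^sup>2 + vy\<^sup>2) / 2" using \<epsilon> by simp
        ultimately have "- (w * g * vx) \<le> w * g\<^sup>2 / (2 * \<epsilon>) + \<epsilon> * (vx\<^sup>2 + vy\<^sup>2) / 2" by linarith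
        then have "U0 * d\<^sup>2 / 2 * - (w * g * vx) \<le> U0 * d\<^sup>2 / 2 * (w * g\<^sup>2 / (2 * \<epsilon>) + \<epsilon> * (vx\<^sup>2 + vy\<^sup>2) / 2)"
          using U0 by (intro mult_left_mono) auto
        also have "\<dots> = ?A3 * (w * g\<^sup>2) + U0 * d\<^sup>2 * \<epsilon> / 4 * (vx\<^sup>2 + vy\<^sup>2)"
          using \<epsilon> by (simp add: field_simps)
        finally show ?thesis by (simp add: mult_ac)
      qed
      have 4: "\<kappa> * ?t p * G'' (V p) * (vx\<^sup>2 + vy\<^sup>2) \<le> \<kappa> * d * K * (vx\<^sup>2 + vy\<^sup>2)"
      proof -
        have "\<bar>?t p * G'' (V p)\<bar> \<le> d * K"
          unfolding abs_mult using tube_bounds(1)[OF H d] G''_le[OF v] d by (intro mult_mono) auto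
        then have "\<kappa> * (?t p * G'' (V p)) * (vx\<^sup>2 + vy\<^sup>2) \<le> \<kappa> * (d * K) * (vx\<^sup>2 + vy\<^sup>2)"
          using \<kappa> by (intro mult_right_mono mult_left_mono) auto
        then show ?thesis by (simp add: mult.assoc)
      qed
      have "- ?S p \<le> ?A1 * F + ?A2 * (vx\<^sup>2 + vy\<^sup>2) + ?A3 * (w * g\<^sup>2)"
        using 1 2 3 4 unfolding g_def[symmetric] vx_def[symmetric] vy_def[symmetric] F_def[symmetric] w_def[symmetric]
        by (simp only: distrib_right)
      then have "?\<phi> p * - ?S p \<le> ?\<phi> p * (?A1 * F + ?A2 * (vx\<^sup>2 + vy\<^sup>2) + ?A3 * (w * g\<^sup>2))"
        by (intro mult_left_mono cutoff_nonneg[OF n p])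
      then show "- (?\<phi> p * ?S p) \<le> ?\<phi> p * (?A1 * f (V p) + ?A2 * ((Vx p)\<^sup>2 + (Vy p)\<^sup>2)) + ?A3 * (?\<phi> p * (?W p * (G' (V p))\<^sup>2))"
        unfolding g_def[symmetric] vx_def[symmetric] vy_def[symmetric] F_def[symmetric] w_def[symmetric]
        by (simp only: mult_minus_right distrib_left mult.left_commute[of ?A3])
    qed (intro continuous_intros wc cont comp_step H d)+
    also have "\<dots> = ?A1 * reaction n + ?A2 * dissipation n + ?A3 * layer_reaction d n"
      unfolding mult_reaction[symmetric] layer_reaction_def integral_mult_right[symmetric]
      by (rule integral_cylinder_add; intro continuous_intros wc cont comp_step H d)
    also have "\<dots> \<le> ?B n"
    proof -
      have "layer_reaction d n \<le> ?Q1 * reaction n + ?Q2 * r n + e n"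
      proof -
        have "?Q2 * dissipation n \<le> ?Q2 * r n"
          using r(2)[OF n] H d K l by (intro mult_left_mono) auto
        then show ?thesis using e(2)[OF n] by linarith
      qed
      then have "?A3 * layer_reaction d n \<le> ?A3 * (?Q1 * reaction n + ?Q2 * r n + e n)"
        using A(3) by (intro mult_left_mono) auto
      moreover have "?A2 * dissipation n \<le> ?A2 * r n" using r(2)[OF n] A(2) by (intro mult_left_mono) auto
      ultimately show ?thesis by linarith
    qed
    finally show ?thesis .
  qed
  then have ev: "\<forall>\<^sub>F n in sequentially. ?f1 n + \<kappa> * ?f2 n + \<kappa> * ?f3 n \<le> ?B n"
    by (intro eventually_mono[OF eventually_gt_at_top[of 0]]) simp
  have L: "(\<lambda>n. ?f1 n + \<kappa> * ?f2 n + \<kappa> * ?f3 n) \<longlonglongrightarrow> (1 - 0) * (U0 * (d\<^sup>2 * H) * P) + \<kappa> * 0 + \<kappa> * ((1 - 0) * (0 * P))"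
    by (intro tendsto_intros f1 f2 f3)
  have R: "?B \<longlonglongrightarrow> ?A1 * (swept / q) + ?A2 * (swept / (2 * \<kappa>))
      + ?A3 * (?Q1 * (swept / q) + ?Q2 * (swept / (2 * \<kappa>)) + 0)"
    by (intro tendsto_add tendsto_mult_left reaction_limit r(1) e(1))
  from tendsto_le[OF sequentially_bot R L ev]
  show ?thesis by simp
qed

end

text \<open>Optimises \<open>d\<close> and \<epsilon>. With \<gamma> = c / v0 and \<rho> the ratio
  of the two time scales, the tube costs absorb half of the flux and the layer costs are a multiple
  of \<gamma> s, where \<open>s\<^sup>2 = d H / l\<close>. In \<open>B\<close> the factor
  \<open>24 K\<^sup>2\<close> comes from \<open>1 \<le> 24 K\<^sup>2 \<gamma> s\<close>, raised to
  the fourth power, and \<open>48 K\<close> majorises \<open>12 pi K\<close> from the choice of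
  \<open>d\<close>.\<close>

lemma cellular_speed_algebra:
  fixes c H P l v0 U0 K :: real
  assumes K: "K \<ge> 1" and pos: "H > 0" "P > 0" "l > 0" "v0 > 0" "U0 > 0" and lH: "l \<le> H"
    and \<kappa>: "\<kappa> = l * v0" and q: "q = v0 / l" and M: "M = c * (pi * H) * P"
    and burn: "pi * H * P \<le> K * M / (2 * l * q) + l * M / (4 * \<kappa>)"
    and tube: "\<And>d \<epsilon>. d > 0 \<Longrightarrow> \<epsilon> > 0 \<Longrightarrow>
      U0 * (d\<^sup>2 * H) * P \<le> (q * d * K + 3 * \<kappa> * K / (H * l)) * (M / q)
      + (3 * \<kappa> * l / (2 * H) + U0 * d\<^sup>2 * \<epsilon> / 4 + \<kappa> * d * K) * (M / (2 * \<kappa>))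
      + U0 * d\<^sup>2 / (4 * \<epsilon>) * ((2 * d * K + 4 * d * H * K\<^sup>2 / l) * (M / q) + 4 * d * H * K * l * (M / (2 * \<kappa>)))"
    and \<rho>: "\<rho> = l * U0 / (v0 * H)"
  defines "B \<equiv> 48 * K * (24 * K\<^sup>2) ^ 4"
  shows "1 \<le> B * (c / v0)" and "\<rho> \<le> B * (c / v0) \<or> \<rho> \<le> B * (c / v0) ^ 5"
proof -
  define \<gamma> where "\<gamma> = c / v0"
  have K2: "1 \<le> K\<^sup>2" "K \<le> K\<^sup>2" using K by (simp_all add: one_le_power self_le_power)
  have Kq: "M / q = M * l / v0" "M / (2 * \<kappa>) = M / (2 * l * v0)" using q \<kappa> by auto
  have MP: "M / v0 = \<gamma> * (pi * H * P)" using pos by (simp add: M \<gamma>_def)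
  have PH: "pi * H * P > 0" using pos by simp
  have "K * M / (2 * l * q) + l * M / (4 * \<kappa>) = (K / 2 + 1 / 4) * \<gamma> * (pi * H * P)"
    using pos unfolding q \<kappa> M \<gamma>_def by (simp add: field_simps)
  with burn have "1 * (pi * H * P) \<le> (K / 2 + 1 / 4) * \<gamma> * (pi * H * P)" by simp
  then have b1: "1 \<le> (K / 2 + 1 / 4) * \<gamma>" using PH by (rule mult_right_le_imp_le)
  \<comment> \<open>No sign of \<open>c\<close> is presupposed; the burning bound forces it.\<close>
  have \<gamma>: "\<gamma> > 0"
  proof (rule ccontr)
    assume "\<not> \<gamma> > 0"
    then have "(K / 2 + 1 / 4) * \<gamma> \<le> 0" using K by (intro mult_nonneg_nonpos) auto
    with b1 show False by simp
  qed
  have "(K / 2 + 1 / 4) * \<gamma> \<le> K * \<gamma>" using K \<gamma> by (intro mult_right_mono) auto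
  with b1 have b2: "1 \<le> K * \<gamma>" by simp
  have B1: "48 * K \<le> B"
  proof -
    have "1 \<le> (24 * K\<^sup>2) ^ 4" using K2 by (intro one_le_power) simp
    then have "48 * K * 1 \<le> 48 * K * (24 * K\<^sup>2) ^ 4" using K by (intro mult_left_mono) auto
    then show ?thesis by (simp add: B_def)
  qed
  have KB: "K * \<gamma> \<le> B * \<gamma>" using B1 K \<gamma> by (intro mult_right_mono) auto
  show "1 \<le> B * (c / v0)" using KB b2 unfolding \<gamma>_def by simp
  have c: "c > 0" using \<gamma> pos by (simp add: \<gamma>_def zero_less_divide_iff)
  have \<rho>0: "\<rho> > 0" using pos by (simp add: \<rho>)
  have M0: "M > 0" using c pos by (simp add: M)
  \<comment> \<open>Makes \<open>6 (l / H) K M\<close>, a bound for the tube costs once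
    \<open>d \<le> l / H\<close>, exactly half of the left-hand side
    \<open>U0 d\<^sup>2 H P\<close>.\<close>
  define d where "d = sqrt (12 * pi * K * l * c / (U0 * H))"
  have d0: "d > 0" using pos c K by (simp add: d_def)
  have d2: "d\<^sup>2 = 12 * pi * K * l * c / (U0 * H)" using pos c K by (simp add: d_def)
  have dH2: "(d * H / l)\<^sup>2 = 12 * pi * K * \<gamma> / \<rho>"
  proof -
    have "(d * H / l)\<^sup>2 = d\<^sup>2 * (H / l)\<^sup>2" by (simp add: power_mult_distrib power_divide)
    also have "\<dots> = 12 * pi * K * \<gamma> / \<rho>"
      using pos unfolding d2 \<gamma>_def \<rho> by (simp add: field_simps power2_eq_square)
    finally show ?thesis .
  qed
  have pi4: "12 * pi * K * \<gamma> / \<rho> \<le> 48 * K * \<gamma> / \<rho>"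
    using K \<gamma> \<rho>0 pi_less_4 by (intro divide_right_mono mult_right_mono) auto
  show "\<rho> \<le> B * (c / v0) \<or> \<rho> \<le> B * (c / v0) ^ 5"
  \<comment> \<open>Compares the layer width \<open>d * H\<close> with the reaction length
    \<open>l\<close>. Wider layers already mean \<open>\<rho> \<le> 48 K \<gamma>\<close>; thinner
    ones make the costs of order \<open>d\<close> subordinate to those of order
    \<open>l / H\<close>.\<close>
  proof (cases "d \<le> l / H")
    case False
    then have "1 < d * H / l" using pos by (simp add: field_simps)
    then have "1 < (d * H / l)\<^sup>2" by (simp add: one_less_power)
    with dH2 pi4 have "1 < 48 * K * \<gamma> / \<rho>" by linarith
    then have "\<rho> \<le> 48 * K * \<gamma>" using \<rho>0 by (simp add: field_simps)
    also have "\<dots> \<le> B * \<gamma>" using B1 \<gamma> by (intro mult_right_mono) auto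
    finally show ?thesis by (simp add: \<gamma>_def)
  next
    case True
    \<comment> \<open>Balances the two layer costs: \<open>\<epsilon> / l\<close> and
      \<open>d H / \<epsilon>\<close> are then both equal to \<open>s\<close>.\<close>
    define \<epsilon> where "\<epsilon> = sqrt (d * H * l)"
    define s where "s = sqrt (d * H / l)"
    have \<epsilon>0: "\<epsilon> > 0" using d0 pos by (simp add: \<epsilon>_def)
    have s0: "s > 0" using d0 pos by (simp add: s_def)
    have \<epsilon>2: "\<epsilon>\<^sup>2 = d * H * l" using d0 pos by (simp add: \<epsilon>_def)
    have s2: "s\<^sup>2 = d * H / l" using d0 pos by (simp add: s_def)
    have "(s * l)\<^sup>2 = \<epsilon>\<^sup>2" unfolding power_mult_distrib s2 \<epsilon>2 using pos by (simp add: power2_eq_square)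
    then have sl: "s * l = \<epsilon>" using s0 \<epsilon>0 pos by (simp add: power2_eq_iff_nonneg)
    then have \<epsilon>l: "\<epsilon> / l = s" using pos by (simp add: field_simps)
    have dHe: "d * H / \<epsilon> = s"
    proof -
      have "s * \<epsilon> = d * H" unfolding sl[symmetric] using s2 pos by (simp add: power2_eq_square field_simps)
      then show ?thesis using \<epsilon>0 by (simp add: field_simps)
    qed
    have i1: "(q * d * K + 3 * \<kappa> * K / (H * l)) * (M / q) = d * K * M + 3 * K * (l / H) * M"
      using pos unfolding q \<kappa> by (simp add: field_simps)
    have i2: "(3 * \<kappa> * l / (2 * H) + U0 * d\<^sup>2 * \<epsilon> / 4 + \<kappa> * d * K) * (M / (2 * \<kappa>))
        = 3 / 4 * (l / H) * M + U0 * d\<^sup>2 * (M / v0) * (\<epsilon> / l) / 8 + d * K * M / 2"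
      using pos unfolding \<kappa> by (simp add: field_simps)
    have i3: "U0 * d\<^sup>2 / (4 * \<epsilon>) * ((2 * d * K + 4 * d * H * K\<^sup>2 / l) * (M / q) + 4 * d * H * K * l * (M / (2 * \<kappa>)))
        = U0 * d\<^sup>2 * (M / v0) / (4 * \<epsilon>) * (d * (2 * K * l + 4 * H * K\<^sup>2 + 2 * H * K))"
      using pos \<epsilon>0 unfolding \<kappa> q by (simp add: field_simps power2_eq_square)
    have "d * K * M \<le> (l / H) * K * M" using True K M0 by (intro mult_right_mono) auto
    moreover have "3 / 4 * (l / H) * M \<le> 3 / 4 * ((l / H) * K * M)"
      using K pos M0 mult_left_mono[of 1 K "(l / H) * M"] by (simp add: algebra_simps)
    ultimately have j1: "d * K * M + 3 * K * (l / H) * M + 3 / 4 * (l / H) * M + d * K * M / 2 \<le> 6 * ((l / H) * K * M)"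
    proof -
      assume a: "d * K * M \<le> (l / H) * K * M" "3 / 4 * (l / H) * M \<le> 3 / 4 * ((l / H) * K * M)"
      have "3 * K * (l / H) * M = 3 * ((l / H) * K * M)" by simp
      moreover have "0 \<le> (l / H) * K * M" using pos K M0 by simp
      ultimately show ?thesis using a by linarith
    qed
    have "2 * K * l + 4 * H * K\<^sup>2 + 2 * H * K \<le> 8 * (H * K\<^sup>2)"
    proof -
      have "K * l \<le> K\<^sup>2 * H" using K2 lH pos K by (intro mult_mono) auto
      moreover have "H * K \<le> H * K\<^sup>2" using K2 pos by (intro mult_left_mono) auto
      ultimately have "2 * (K * l) + 4 * (H * K\<^sup>2) + 2 * (H * K) \<le> 8 * (H * K\<^sup>2)"
        unfolding mult.commute[of "K\<^sup>2" H] by linarith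
      then show ?thesis by (simp add: mult.assoc)
    qed
    then have "U0 * d\<^sup>2 * (M / v0) / (4 * \<epsilon>) * (d * (2 * K * l + 4 * H * K\<^sup>2 + 2 * H * K))
        \<le> U0 * d\<^sup>2 * (M / v0) / (4 * \<epsilon>) * (d * (8 * (H * K\<^sup>2)))"
      using pos d0 M0 \<epsilon>0 by (intro mult_left_mono) auto
    also have "\<dots> = U0 * d\<^sup>2 * (M / v0) * (2 * K\<^sup>2 * (d * H / \<epsilon>))"
      using \<epsilon>0 by (simp add: field_simps)
    finally have j2: "U0 * d\<^sup>2 * (M / v0) / (4 * \<epsilon>) * (d * (2 * K * l + 4 * H * K\<^sup>2 + 2 * H * K))
        \<le> U0 * d\<^sup>2 * (M / v0) * (2 * K\<^sup>2 * s)" unfolding dHe .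
    have "U0 * (d\<^sup>2 * H) * P \<le> 6 * ((l / H) * K * M) + U0 * d\<^sup>2 * (M / v0) * s / 8 + U0 * d\<^sup>2 * (M / v0) * (2 * K\<^sup>2 * s)"
      using tube[OF d0 \<epsilon>0] j1 j2 unfolding i1 i2 i3 \<epsilon>l by linarith
    moreover have "6 * ((l / H) * K * M) = U0 * d\<^sup>2 * H * P / 2"
      using pos unfolding d2 M by (simp add: field_simps)
    ultimately have "U0 * d\<^sup>2 * H * P / 2 \<le> U0 * d\<^sup>2 * (M / v0) * (s * (1 / 8 + 2 * K\<^sup>2))"
      by (simp add: algebra_simps)
    also have "\<dots> = U0 * d\<^sup>2 * H * P * (pi * \<gamma> * (s * (1 / 8 + 2 * K\<^sup>2)))"
      unfolding MP by simp
    finally have "U0 * d\<^sup>2 * H * P * (1 / 2) \<le> U0 * d\<^sup>2 * H * P * (pi * \<gamma> * (s * (1 / 8 + 2 * K\<^sup>2)))" by simp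
    moreover have "U0 * d\<^sup>2 * H * P > 0" using pos d0 by simp
    ultimately have "1 / 2 \<le> pi * \<gamma> * (s * (1 / 8 + 2 * K\<^sup>2))" by (rule mult_left_le_imp_le)
    also have "\<dots> \<le> 4 * \<gamma> * (s * (3 * K\<^sup>2))"
      using pi_less_4 \<gamma> s0 K2 by (intro mult_mono mult_nonneg_nonneg) auto
    finally have "1 \<le> 24 * K\<^sup>2 * \<gamma> * s" by (simp add: algebra_simps)
    \<comment> \<open>The fourth power of \<open>s\<close> is \<open>(d H / l)\<^sup>2\<close>, a
      multiple of \<gamma> / \<rho>; together with \<open>\<gamma> ^ 4\<close> this produces the
      fifth power.\<close>
    then have "1 \<le> (24 * K\<^sup>2 * \<gamma> * s) ^ 4" by (rule one_le_power)
    also have "\<dots> = (24 * K\<^sup>2) ^ 4 * \<gamma> ^ 4 * (s\<^sup>2)\<^sup>2" by (simp add: power_mult_distrib)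
    also have "\<dots> = (24 * K\<^sup>2) ^ 4 * \<gamma> ^ 4 * (12 * pi * K * \<gamma> / \<rho>)" unfolding s2 dH2 ..
    also have "\<dots> \<le> (24 * K\<^sup>2) ^ 4 * \<gamma> ^ 4 * (48 * K * \<gamma> / \<rho>)"
      using \<gamma> by (intro mult_left_mono pi4) auto
    also have "\<dots> = B * \<gamma> ^ 5 / \<rho>" by (simp add: B_def eval_nat_numeral)
    finally have "\<rho> \<le> B * \<gamma> ^ 5" using \<rho>0 by (simp add: field_simps)
    then show ?thesis by (simp add: \<gamma>_def)
  qed
qed

section \<open>Traveling waves\<close>

text \<open>The chain rule along a line needs joint differentiability, for which continuity of one
  partial derivative and existence of the other suffice. Here the time derivative is the continuous
  one.\<close>

lemma DERIV_along_line:
  fixes F Fx Ft :: "real \<Rightarrow> real \<Rightarrow> real"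
  assumes x: "\<And>x t. ((\<lambda>x. F x t) has_real_derivative Fx x t) (at x)"
    and t: "\<And>x t. ((\<lambda>t. F x t) has_real_derivative Ft x t) (at t)"
    and c: "continuous_on UNIV (\<lambda>p. Ft (fst p) (snd p))"
  shows "((\<lambda>t. F (x + c * t) t) has_real_derivative Ft (x + c * t) t + c * Fx (x + c * t) t) (at t)"
proof -
  have "((\<lambda>(x, t). F x t) has_derivative (\<lambda>(h, k). Fx (x + c * t) t * h + blinfun_mult_right (Ft (x + c * t) t) k))
      (at (x + c * t, t) within UNIV \<times> UNIV)"
  proof (rule has_derivative_partialsI)
    show "((\<lambda>x. F x t) has_derivative (*) (Fx (x + c * t) t)) (at (x + c * t) within UNIV)"
      using x by (simp add: has_field_derivative_def)
    show "((\<lambda>t. F x t) has_derivative blinfun_apply (blinfun_mult_right (Ft x t))) (at t within UNIV)" for x t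
      using t by (simp add: has_field_derivative_def blinfun_mult_right.rep_eq)
    have "continuous_on UNIV (\<lambda>p. blinfun_mult_right (Ft (fst p) (snd p)))"
      by (rule bounded_linear.continuous_on[OF bounded_linear_blinfun_mult_right c])
    then show "continuous (at (x + c * t, t) within UNIV \<times> UNIV) (\<lambda>(x, t). blinfun_mult_right (Ft x t))"
      by (simp add: case_prod_unfold continuous_on_eq_continuous_at)
  qed auto
  then have F: "((\<lambda>(x, t). F x t) has_derivative (\<lambda>(h, k). Fx (x + c * t) t * h + Ft (x + c * t) t * k)) (at (x + c * t, t))"
    by (simp add: blinfun_mult_right.rep_eq)
  have g: "((\<lambda>s. (x + c * s, s)) has_derivative (\<lambda>h. (c * h, h))) (at t)"
    by (auto intro!: derivative_eq_intros)
  from has_derivative_compose[OF g F]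
  have "((\<lambda>s. F (x + c * s) s) has_derivative (\<lambda>h. Fx (x + c * t) t * (c * h) + Ft (x + c * t) t * h)) (at t)"
    by simp
  then show ?thesis
    unfolding has_field_derivative_def by (rule has_derivative_eq_rhs) (auto simp: algebra_simps)
qed

lemma int_periodic:
  fixes h :: "real \<Rightarrow> 'a"
  assumes "\<And>x. h (x + d) = h x"
  shows "h (x + d * of_int m) = h x"
proof (induction m rule: int_induct[of _ 0])
  case (step1 i)
  then show ?case using assms[of "x + d * of_int i"] by (simp add: algebra_simps)
next
  case (step2 i)
  then show ?case using assms[of "x + d * of_int (i - 1)"] by (simp add: algebra_simps)
qed simp

text \<open>In the moving frame the solution is \<open>U x (x + c * t) y\<close>: time enters
  through the periodic argument only, so spatial periodicity of the profile becomes periodicity in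
  time.\<close>

lemma traveling_wave_moving_front:
  assumes pos: "U0 > 0" "H > 0" "\<kappa> > 0" "v0 > 0"
    and f: "continuous_on {0..1} f" "\<And>z. z \<in> {0..1} \<Longrightarrow> f z \<ge> 0"
    and tw: "traveling_wave f U0 H \<kappa> v0 c U"
  obtains V Vt Vx Vy Vxx Vyy P N where
    "moving_front V Vt Vx Vy Vxx Vyy f H U0 \<kappa> (v0\<^sup>2 / \<kappa>) c P N"
proof -
  let ?L = "pi * H"
  define T where "T = (\<lambda>x y t. U (x - c * t) x y)"
  have lim: "\<And>x y. y \<in> {0..?L} \<Longrightarrow> ((\<lambda>s. U s x y) \<longlongrightarrow> 1) at_bot"
      "\<And>x y. y \<in> {0..?L} \<Longrightarrow> ((\<lambda>s. U s x y) \<longlongrightarrow> 0) at_top"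
    and rng: "\<And>s x y. y \<in> {0..?L} \<Longrightarrow> U s x y \<in> {0..1}"
    and Uper: "\<And>s x y. y \<in> {0..?L} \<Longrightarrow> U s (x + 2 * pi * H) y = U s x y"
    and sol: "classical_solution ?L (cellular_flow U0 H) \<kappa> (\<lambda>z. v0\<^sup>2 / \<kappa> * f z) T"
    and bdry: "neumann_bc ?L T \<or> periodic_bc ?L T"
    using tw unfolding traveling_wave_def T_def by (auto simp: Let_def)
  have Uint: "U s (x + 2 * pi * H * of_int m) y = U s x y" if "y \<in> {0..?L}" for s x y m
    by (rule int_periodic[of "\<lambda>x. U s x y"]) (rule Uper[OF that])
  from sol[unfolded classical_solution_def] obtain Tt Tx Ty Txx Tyy where
    A: "\<forall>F\<in>{T, Tx, Ty}. continuous_on (UNIV \<times> {0..?L} \<times> UNIV) (\<lambda>(x, y, t). F x y t)"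
    and B: "\<forall>F\<in>{Tt, Txx, Tyy}. continuous_on (UNIV \<times> {0<..<?L} \<times> UNIV) (\<lambda>(x, y, t). F x y t)"
    and C: "\<forall>x t. \<forall>y\<in>{0..?L}. ((\<lambda>x. T x y t) has_real_derivative Tx x y t) (at x) \<and>
        ((\<lambda>y. T x y t) has_real_derivative Ty x y t) (at y within {0..?L})"
    and D: "\<forall>x t. \<forall>y\<in>{0<..<?L}. ((\<lambda>t. T x y t) has_real_derivative Tt x y t) (at t) \<and>
        ((\<lambda>x. Tx x y t) has_real_derivative Txx x y t) (at x) \<and>
        ((\<lambda>y. Ty x y t) has_real_derivative Tyy x y t) (at y) \<and>
        Tt x y t + cellular_flow U0 H x y \<bullet> (Tx x y t, Ty x y t)
          = \<kappa> * (Txx x y t + Tyy x y t) + v0\<^sup>2 / \<kappa> * f (T x y t)"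
    by (elim exE conjE) (rule that)
  note cc = bspec[OF A] and ci = bspec[OF B]
  have d1: "((\<lambda>x. T x y t) has_real_derivative Tx x y t) (at x)"
      "((\<lambda>y. T x y t) has_real_derivative Ty x y t) (at y within {0..?L})" if "y \<in> {0..?L}" for x y t
    using C that by auto
  have d2: "((\<lambda>t. T x y t) has_real_derivative Tt x y t) (at t)"
      "((\<lambda>x. Tx x y t) has_real_derivative Txx x y t) (at x)"
      "((\<lambda>y. Ty x y t) has_real_derivative Tyy x y t) (at y)"
    and eq: "Tt x y t + cellular_flow U0 H x y \<bullet> (Tx x y t, Ty x y t)
        = \<kappa> * (Txx x y t + Tyy x y t) + v0\<^sup>2 / \<kappa> * f (T x y t)" if "y \<in> {0<..<?L}" for x y t
    using D that by auto
  have L: "0 < ?L" using pos by simp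
  \<comment> \<open>In time \<open>P\<close> the frame moves by one flow period, in the direction
    given by the sign of \<open>c\<close>. For \<open>c = 0\<close> the solution is stationary in
    the frame and any period serves; the choice is \<open>P = 1\<close>,
    \<open>N = 0\<close>.\<close>
  define N :: int where "N = (if c = 0 then 0 else if c > 0 then 1 else - 1)"
  define P where "P = (if c = 0 then 1 else 2 * pi * H / \<bar>c\<bar>)"
  define lift where "lift = (\<lambda>(F :: real \<Rightarrow> real \<Rightarrow> real \<Rightarrow> real) (x, y, t). F (x + c * t) y t)"
  have lift: "lift F (x, y, t) = F (x + c * t) y t" for F x y t by (simp add: lift_def)
  have lift_cont: "continuous_on (UNIV \<times> Y \<times> UNIV) (lift F)"
    if "continuous_on (UNIV \<times> Y \<times> UNIV) (\<lambda>(x, y, t). F x y t)" for F Y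
  proof -
    have "continuous_on (UNIV \<times> Y \<times> UNIV) (\<lambda>p. (\<lambda>(x, y, t). F x y t) (fst p + c * snd (snd p), fst (snd p), snd (snd p)))"
      by (rule continuous_on_compose2[OF that]) (auto intro!: continuous_intros)
    then show ?thesis by (simp add: lift_def case_prod_unfold)
  qed
  have lift_dx: "((\<lambda>x. lift F (x, y, t)) has_real_derivative lift Fx (x, y, t)) (at x)"
    if "\<And>x. ((\<lambda>x. F x y t) has_real_derivative Fx x y t) (at x)" for F Fx :: "real \<Rightarrow> real \<Rightarrow> real \<Rightarrow> real" and x y t
    unfolding lift using that[of "x + c * t"] by (simp add: DERIV_shift)
  have Vc: "lift T (x, y, t) = U x (x + c * t) y" for x y t by (simp add: lift T_def)
  show thesis
  proof (rule that)
    show "moving_front (lift T) (lift (\<lambda>x y t. Tt x y t + c * Tx x y t)) (lift Tx) (lift Ty) (lift Txx) (lift Tyy)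
        f H U0 \<kappa> (v0\<^sup>2 / \<kappa>) c P N"
    proof
      show "0 < P" using pos by (simp add: P_def)
      show "0 < v0\<^sup>2 / \<kappa>" using pos by simp
      show "continuous_on (UNIV \<times> {0..?L} \<times> UNIV) (lift T)" "continuous_on (UNIV \<times> {0..?L} \<times> UNIV) (lift Tx)"
        "continuous_on (UNIV \<times> {0..?L} \<times> UNIV) (lift Ty)"
        by (rule lift_cont, rule cc, simp)+
      show "continuous_on (UNIV \<times> {0<..<?L} \<times> UNIV) (lift Txx)" "continuous_on (UNIV \<times> {0<..<?L} \<times> UNIV) (lift Tyy)"
        by (rule lift_cont, rule ci, simp)+
      have "continuous_on (UNIV \<times> {0<..<?L} \<times> UNIV) (\<lambda>(x, y, t). Tx x y t)"
        by (rule continuous_on_subset[OF cc[of Tx]]) auto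
      then show "continuous_on (UNIV \<times> {0<..<?L} \<times> UNIV) (lift (\<lambda>x y t. Tt x y t + c * Tx x y t))"
        using ci[of Tt] by (intro lift_cont) (auto intro!: continuous_intros simp: case_prod_unfold)
      show "c * P = 2 * pi * H * of_int N" by (simp add: P_def N_def)
      show "lift T p \<in> {0..1}" if "p \<in> UNIV \<times> {0..?L} \<times> UNIV" for p
        using rng that by (cases p) (auto simp: Vc)
    next
      fix x y t :: real assume y: "y \<in> {0<..<?L}"
      then have y': "y \<in> {0..?L}" by auto
      show "((\<lambda>x. lift T (x, y, t)) has_real_derivative lift Tx (x, y, t)) (at x)"
        by (rule lift_dx) (rule d1(1)[OF y'])
      show "((\<lambda>x. lift Tx (x, y, t)) has_real_derivative lift Txx (x, y, t)) (at x)"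
        by (rule lift_dx) (rule d2(2)[OF y])
      show "((\<lambda>y. lift T (x, y, t)) has_real_derivative lift Ty (x, y, t)) (at y)"
        using d1(2)[OF y'] y by (simp add: lift at_within_Icc_at)
      show "((\<lambda>y. lift Ty (x, y, t)) has_real_derivative lift Tyy (x, y, t)) (at y)"
        using d2(3)[OF y] by (simp add: lift)
      have "continuous_on UNIV (\<lambda>p. (\<lambda>(x, y, t). Tt x y t) (fst p, y, snd p))"
        by (rule continuous_on_compose2[OF ci[of Tt]]) (use y in \<open>auto intro!: continuous_intros\<close>)
      then show "((\<lambda>t. lift T (x, y, t)) has_real_derivative lift (\<lambda>x y t. Tt x y t + c * Tx x y t) (x, y, t)) (at t)"
        unfolding lift using d1(1)[OF y'] d2(1)[OF y] by (intro DERIV_along_line) simp_all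
      show "lift (\<lambda>x y t. Tt x y t + c * Tx x y t) (x, y, t) - c * lift Tx (x, y, t)
          + U0 * sin ((x + c * t) / H) * cos (y / H) * lift Tx (x, y, t)
          - U0 * cos ((x + c * t) / H) * sin (y / H) * lift Ty (x, y, t)
        = \<kappa> * (lift Txx (x, y, t) + lift Tyy (x, y, t)) + v0\<^sup>2 / \<kappa> * f (lift T (x, y, t))"
        using eq[OF y, of "x + c * t" t] by (simp add: lift cellular_flow_def inner_prod_def algebra_simps)
    next
      fix x y t :: real assume y: "y \<in> {0..?L}"
      have cP: "c * P = 2 * pi * H * of_int N" by (simp add: P_def N_def)
      show "lift T (x, y, P) = lift T (x, y, 0)"
        unfolding Vc cP by (simp add: Uint[OF y])
      \<comment> \<open>A shift by whole flow periods affects the first argument of \<open>U\<close>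
        alone, which turns the limits in \<open>s\<close> into limits along such shifts.\<close>
      have shift: "lift T (x + 2 * pi * H * of_int m, y, t) = U (x + 2 * pi * H * of_int m) (x + c * t) y" for m
      proof -
        have "x + 2 * pi * H * of_int m + c * t = (x + c * t) + 2 * pi * H * of_int m" by simp
        then show ?thesis unfolding Vc using Uint[OF y] by metis
      qed
      have k: "filterlim (\<lambda>k. real k * (2 * pi * H)) at_top sequentially"
      proof -
        have "filterlim (\<lambda>k. (2 * pi * H) * real k) at_top sequentially"
          by (rule filterlim_tendsto_pos_mult_at_top[OF tendsto_const _ filterlim_real_sequentially]) (use pos in simp)
        then show ?thesis by (simp only: mult.commute)
      qed
      show "(\<lambda>k. lift T (x + real k * (2 * pi * H), y, t)) \<longlonglongrightarrow> 0"
      proof -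
        have "filterlim (\<lambda>k. x + real k * (2 * pi * H)) at_top sequentially"
          by (rule filterlim_tendsto_add_at_top[OF tendsto_const k])
        from filterlim_compose[OF lim(2)[OF y, of "x + c * t"] this]
        show ?thesis using shift[of "int k" for k] by (simp add: mult.commute)
      qed
      show "(\<lambda>k. lift T (x - real k * (2 * pi * H), y, t)) \<longlonglongrightarrow> 1"
      proof -
        have "filterlim (\<lambda>k. - (- x + real k * (2 * pi * H))) at_bot sequentially"
          unfolding filterlim_uminus_at_bot by (simp, rule filterlim_tendsto_add_at_top[OF tendsto_const[of "- x"] k, simplified])
        from filterlim_compose[OF lim(1)[OF y, of "x + c * t"] this]
        show ?thesis using shift[of "- int k" for k] by (simp add: mult.commute)
      qed
    next
      \<comment> \<open>The boundary conditions speak of some one-sided derivative; uniqueness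
        identifies it with \<open>Ty\<close>.\<close>
      have uniq: "d = e" if "(h has_real_derivative d) (at y within {0..?L})"
        "(h has_real_derivative e) (at y within {0..?L})" "y \<in> {0..?L}" for h :: "real \<Rightarrow> real" and d e y
        by (rule has_field_derivative_unique[OF that(1,2)])
          (use that(3) L in \<open>simp add: trivial_limit_within\<close>)
      have e: "0 \<in> {0..?L}" "?L \<in> {0..?L}" using L by auto
      from bdry show "(\<forall>x t. lift Ty (x, 0, t) = 0 \<and> lift Ty (x, ?L, t) = 0) \<or>
          (\<forall>x t. lift T (x, 0, t) = lift T (x, ?L, t) \<and> lift Ty (x, 0, t) = lift Ty (x, ?L, t))"
      proof
        assume "neumann_bc ?L T"
        then have "Ty x 0 t = 0 \<and> Ty x ?L t = 0" for x t
          using uniq[OF d1(2)[OF e(1)] _ e(1)] uniq[OF d1(2)[OF e(2)] _ e(2)]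
          unfolding neumann_bc_def by blast
        then show ?thesis by (simp add: lift)
      next
        assume "periodic_bc ?L T"
        then have "T x 0 t = T x ?L t \<and> Ty x 0 t = Ty x ?L t" for x t
          using uniq[OF d1(2)[OF e(1)] _ e(1)] uniq[OF d1(2)[OF e(2)] _ e(2)]
          unfolding periodic_bc_def by metis
        then show ?thesis by (simp add: lift)
      qed
    qed (use pos f in auto)
  qed
qed

section \<open>From the bounds on \<open>c / v0\<close> to the two regimes\<close>

theorem corollary3:
  fixes f :: "real \<Rightarrow> real"
  assumes "ignition_type f \<or> general_KPP_type f"
  shows "\<exists>C\<^sub>1>0. \<exists>C\<^sub>2>0. \<forall>U\<^sub>0>0. \<forall>H>0. \<forall>\<kappa>>0. \<forall>v\<^sub>0>0. \<forall>c U.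
    (let l = \<kappa> / v\<^sub>0; \<tau>\<^sub>c = \<kappa> / v\<^sub>0\<^sup>2; \<tau>\<^sub>u = H / U\<^sub>0 in
       U\<^sub>0 * H / \<kappa> \<ge> 1 \<longrightarrow> l / H \<le> 1 \<longrightarrow> traveling_wave f U\<^sub>0 H \<kappa> v\<^sub>0 c U \<longrightarrow>
         (\<tau>\<^sub>c \<le> \<tau>\<^sub>u \<longrightarrow> c \<ge> (C\<^sub>1 * sqrt (\<tau>\<^sub>c / \<tau>\<^sub>u) + C\<^sub>2) * v\<^sub>0) \<and>
         (\<tau>\<^sub>c \<ge> \<tau>\<^sub>u \<longrightarrow> c \<ge> (C\<^sub>1 * (\<tau>\<^sub>c / \<tau>\<^sub>u) powr (1 / 5) + C\<^sub>2) * v\<^sub>0))"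
proof -
  have adm: "admissible_nonlinearity f"
    using assms by (auto simp: ignition_type_def general_KPP_type_def)
  have f_cont: "continuous_on {0..1} f"
    using adm unfolding admissible_nonlinearity_def C1_on_def
    by (metis DERIV_continuous_on)
  have f_nonneg: "f z \<ge> 0" if "z \<in> {0..1}" for z
    using adm that unfolding admissible_nonlinearity_def by (cases "z = 0 \<or> z = 1") auto
  obtain \<theta> where \<theta>: "0 \<le> \<theta>" "\<theta> < 1" "\<And>z. z \<in> {\<theta><..<1} \<Longrightarrow> f z > 0"
  proof (cases "general_KPP_type f")
    case True
    then show thesis using that[of 0] by (auto simp: general_KPP_type_def)
  next
    case False
    with assms obtain \<theta>\<^sub>0 where "\<theta>\<^sub>0 \<in> {0<..<1}" "\<forall>z\<in>{\<theta>\<^sub>0<..<1}. f z > 0"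
      unfolding ignition_type_def by blast
    then show thesis using that[of \<theta>\<^sub>0] by auto
  qed
  \<comment> \<open>\<open>[a, b]\<close> is the middle third of \<open>[\<theta>, 1]\<close>; by
    compactness \<open>f\<close> has a positive minimum there, whatever it does near \<theta> and
    \<open>1\<close>.\<close>
  define a where "a = (2 * \<theta> + 1) / 3"
  define b where "b = (\<theta> + 2) / 3"
  have ab: "0 < a" "a < b" "b < 1" "\<theta> < a" using \<theta> by (simp_all add: a_def b_def)
  have f_pos: "f z > 0" if "z \<in> {a..b}" for z
    using \<theta>(3)[of z] ab that by auto
  obtain G G' G'' :: "real \<Rightarrow> real" and K where step:
    "K \<ge> 1" "continuous_on UNIV G'" "continuous_on UNIV G''"
    "\<And>z. z \<in> {0..1} \<Longrightarrow> (G has_real_derivative G' z) (at z)"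
    "\<And>z. (G' has_real_derivative G'' z) (at z)"
    "\<And>z. z \<in> {0..1} \<Longrightarrow> (G' z)\<^sup>2 \<le> K * f z"
    "\<And>z. z \<in> {0..1} \<Longrightarrow> \<bar>G' z\<bar> \<le> K" "\<And>z. z \<in> {0..1} \<Longrightarrow> \<bar>G'' z\<bar> \<le> K"
    "\<And>z. z \<in> {0..1} \<Longrightarrow> \<bar>G z\<bar> \<le> K * z" "\<And>z. z \<in> {0..1} \<Longrightarrow> \<bar>G z - 1\<bar> \<le> K * (1 - z)"
    "\<And>z. z \<in> {0..1} \<Longrightarrow> (G' z)\<^sup>2 \<le> K * z" "\<And>z. z \<in> {0..1} \<Longrightarrow> (G' z)\<^sup>2 \<le> K * (1 - z)"
    by (rule smooth_step_for_reaction[OF f_cont f_nonneg ab(1-3) f_pos]; (assumption | rule that)+)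
  define B where "B = 48 * K * (24 * K\<^sup>2) ^ 4"
  have B: "B \<ge> 1"
  proof -
    have "1 \<le> K\<^sup>2" using step(1) by (simp add: one_le_power)
    then have "1 \<le> 24 * K\<^sup>2" by linarith
    then have "1 * 1 \<le> (48 * K) * (24 * K\<^sup>2) ^ 4" using step(1) by (intro mult_mono one_le_power) auto
    then show ?thesis by (simp add: B_def)
  qed
  \<comment> \<open>\<open>r\<close> stands for either enhancement factor. In the first regime it is
    the square root, at most one, so \<open>1 \<le> B * (c / v0)\<close> is enough; in the second it
    is the fifth root. The \<open>2\<close> in \<open>1 / (2 * B)\<close> comes from adding the
    bounds for \<open>r\<close> and for \<open>1\<close>.\<close>
  have main: "(r / (2 * B) + 1 / (2 * B)) * v0 \<le> c"
    if pos: "U0 > 0" "H > 0" "\<kappa> > 0" "v0 > 0" and lH: "\<kappa> / v0 / H \<le> 1"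
      and tw: "traveling_wave f U0 H \<kappa> v0 c U"
      and r: "r \<le> 1 \<or> (0 \<le> r \<and> 1 \<le> (\<kappa> / v0\<^sup>2) / (H / U0) \<and> r ^ 5 \<le> (\<kappa> / v0\<^sup>2) / (H / U0))"
    for U0 H \<kappa> v0 c U r
  proof -
    define l where "l = \<kappa> / v0"
    define \<rho> where "\<rho> = l * U0 / (v0 * H)"
    have \<rho>_eq: "\<rho> = (\<kappa> / v0\<^sup>2) / (H / U0)"
      using pos by (simp add: \<rho>_def l_def field_simps power2_eq_square)
    obtain V Vt Vx Vy Vxx Vyy P N where
      mf: "moving_front V Vt Vx Vy Vxx Vyy f H U0 \<kappa> (v0\<^sup>2 / \<kappa>) c P N"
      by (rule traveling_wave_moving_front[OF pos f_cont f_nonneg tw]; (assumption | rule that)+)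
    interpret front_with_step V Vt Vx Vy Vxx Vyy f H U0 \<kappa> "v0\<^sup>2 / \<kappa>" c P N G G' G'' K
      by (rule front_with_step.intro[OF mf]) (unfold_locales; rule step; assumption)
    have l: "l > 0" "l \<le> H" "\<kappa> = l * v0" "v0\<^sup>2 / \<kappa> = v0 / l"
      using pos lH by (simp_all add: l_def power2_eq_square pos_divide_le_eq mult.commute)
    note alg = cellular_speed_algebra[OF step(1) pos(2) P l(1) pos(4,1) l(2,3,4) swept_def
        burning_bound[OF l(1)] tube_inequality[OF pos(1) _ l(1)] \<rho>_def, folded B_def]
    have "r \<le> B * (c / v0)"
      using r
    proof
      assume "r \<le> 1" then show ?thesis using alg(1) by simp
    next
      assume r: "0 \<le> r \<and> 1 \<le> (\<kappa> / v0\<^sup>2) / (H / U0) \<and> r ^ 5 \<le> (\<kappa> / v0\<^sup>2) / (H / U0)"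
      have \<gamma>: "c / v0 > 0"
      proof (rule ccontr)
        assume "\<not> c / v0 > 0"
        then have "B * (c / v0) \<le> 0" using B by (intro mult_nonneg_nonpos) auto
        with alg(1) show False by simp
      qed
      from alg(2) show ?thesis
      proof
        \<comment> \<open>The linear alternative is the stronger one here: the ratio is at least
          one, so its fifth root does not exceed it.\<close>
        assume a: "\<rho> \<le> B * (c / v0)"
        have "r \<le> \<rho>"
        proof (cases "r \<le> 1")
          case False
          then have "r ^ 1 \<le> r ^ 5" by (intro power_increasing) auto
          then show ?thesis using r by (simp add: \<rho>_eq)
        qed (use r in \<open>simp add: \<rho>_eq\<close>)
        with a show ?thesis by simp
      next
        assume a: "\<rho> \<le> B * (c / v0) ^ 5"
        have "B ^ 1 \<le> B ^ 5" using B by (intro power_increasing) auto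
        then have "B * (c / v0) ^ 5 \<le> B ^ 5 * (c / v0) ^ 5"
          using \<gamma> by (intro mult_right_mono) auto
        moreover have "r ^ 5 \<le> \<rho>" using r by (simp only: \<rho>_eq)
        ultimately have "r ^ 5 \<le> (B * (c / v0)) ^ 5" using a unfolding power_mult_distrib by linarith
        then have "r ^ Suc 4 \<le> (B * (c / v0)) ^ Suc 4" by simp
        moreover have "0 \<le> B * (c / v0)" using B \<gamma> by (intro mult_nonneg_nonneg) auto
        ultimately show ?thesis by (rule power_le_imp_le_base)
      qed
    qed
    then have "r + 1 \<le> 2 * B * (c / v0)" using alg(1) by simp
    then have "(r + 1) / (2 * B) \<le> c / v0" using B by (simp add: field_simps)
    then have "(r + 1) / (2 * B) * v0 \<le> c" using pos by (simp add: field_simps)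
    then show ?thesis by (simp add: add_divide_distrib)
  qed
  show ?thesis
  \<comment> \<open>One value serves as both constants. It depends only on \<open>K\<close>, which
    was fixed by \<open>f\<close> before any other parameter appeared.\<close>
  proof (intro exI[of _ "1 / (2 * B)"] conjI allI impI, goal_cases)
    case (3 U0 H \<kappa> v0 c U)
    let ?\<rho> = "(\<kappa> / v0\<^sup>2) / (H / U0)"
    have \<rho>0: "?\<rho> > 0" using 3 by simp
    have cmp: "x \<le> y \<Longrightarrow> x / y \<le> 1" "y \<le> x \<Longrightarrow> 1 \<le> x / y" if "y > 0" for x y :: real
      using that by simp_all
    show ?case
      unfolding Let_def
    proof (intro impI conjI)
      assume lH: "\<kappa> / v0 / H \<le> 1" and tw: "traveling_wave f U0 H \<kappa> v0 c U"
      note m = main[OF 3(1-4) lH tw]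
      {
        assume "\<kappa> / v0\<^sup>2 \<le> H / U0"
        then have "?\<rho> \<le> 1" using 3 by (intro cmp(1)) auto
        then have "sqrt ?\<rho> \<le> 1" by (simp only: real_sqrt_le_1_iff)
        from m[OF disjI1[OF this]]
        show "(1 / (2 * B) * sqrt ?\<rho> + 1 / (2 * B)) * v0 \<le> c"
          by (simp only: times_divide_eq_left mult_1_left)
      next
        assume "H / U0 \<le> \<kappa> / v0\<^sup>2"
        then have "1 \<le> ?\<rho>" using 3 by (intro cmp(2)) auto
        moreover have "(?\<rho> powr (1 / 5)) ^ 5 = ?\<rho>"
        proof -
          have "(x powr (1 / 5)) ^ 5 = x" if "x > 0" for x :: real
            using that by (simp add: powr_power)
          from this[OF \<rho>0] show ?thesis .
        qed
        ultimately have "0 \<le> ?\<rho> powr (1 / 5) \<and> 1 \<le> ?\<rho> \<and> (?\<rho> powr (1 / 5)) ^ 5 \<le> ?\<rho>"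
          by (simp only: powr_ge_zero order_refl simp_thms)
        from m[OF disjI2[OF this]]
        show "(1 / (2 * B) * ?\<rho> powr (1 / 5) + 1 / (2 * B)) * v0 \<le> c"
          by (simp only: times_divide_eq_left mult_1_left)
      }
    qed
  qed (use B in auto)
qed

end
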